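(* Let $\mathcal{N}\to\mathcal{G}_2$ be an $n$-fold covering over $\mathcal{G}_2$. If $n$ is odd then $\mathcal{N}$ is homeomorphic to $\mathcal{G}_2$. If $n$ is even then $\mathcal{N}$ is homeomorphic to $\mathcal{G}_2$ or $\mathcal{G}_1$. The corresponding numbers of nonequivalent $n$-fold coverings (with $\mathcal{N}$ homeomorphic to $\mathcal{G}_2$ in (i) and to $\mathcal{G}_1$ in (ii)) are given by the following formulas: (i) $c_{\pi_1(\mathcal{G}_2),\pi_1(\mathcal{G}_2)}(n)=\sigma_2(n)+2\sigma_2\left(\frac{n}{2}\right)-3\sigma_2\left(\frac{n}{4}\right)$; (ii) $c_{\mathbb{Z}^3,\pi_1(\mathcal{G}_2)}(n)=\frac{1}{2}\left(\omega\left(\frac{n}{2}\right)+\sigma_2\left(\frac{n}{2}\right)+3\sigma_2\left(\frac{n}{4}\right)\right)$.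
   Context: $\mathcal{G}_1$ and $\mathcal{G}_2$ are the closed orientable flat (Euclidean) 3-manifolds, determined up to homeomorphism by their fundamental groups $\pi_1(\mathcal{G}_1)=\mathbb{Z}^3$ and $\pi_1(\mathcal{G}_2)=\langle x,y,z : xyx^{-1}y^{-1}=1,\ zxz^{-1}=x^{-1},\ zyz^{-1}=y^{-1}\rangle$ (so $\mathcal{G}_1$ is the 3-torus). Coverings have connected total space. Two coverings $p_1:\mathcal{M}_1\to\mathcal{M}$ and $p_2:\mathcal{M}_2\to\mathcal{M}$ are equivalent if there is a homeomorphism $h:\mathcal{M}_1\to\mathcal{M}_2$ with $p_1=p_2\circ h$; equivalence classes of $n$-fold coverings of $\mathcal{M}$ correspond bijectively to conjugacy classes of subgroups of index $n$ in $\pi_1(\mathcal{M})$. For groups $H,G$, $c_{H,G}(n)$ denotes the number of conjugacy classes of subgroups of index $n$ in $G$ that are isomorphic to $H$. For a positive integer $n$, $\sigma_1(n)=\sum_{k\mid n}k$, $\sigma_2(n)=\sum_{k\mid n}\sigma_1(k)$, $\omega(n)=\sum_{k\mid n}k\,\sigma_1(k)$. By convention these functions take the value $0$ at arguments that are not positive integers. *)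

theory Defs
  imports
    "HOL-Analysis.Analysis"
    "HOL-Algebra.Bij"
    "HOL-Algebra.Generated_Groups"
    "HOL-Algebra.Elementary_Groups"
begin

section \<open>Coverings of topological spaces\<close>

text \<open>The library's \<open>covering_space\<close> speaks about subsets of one fixed type with one fixed
  topology; the version below is the same definition for the abstract type of topologies.\<close>

definition covering_map :: "'a topology \<Rightarrow> 'b topology \<Rightarrow> ('a \<Rightarrow> 'b) \<Rightarrow> bool" where
  "covering_map N M p \<longleftrightarrow>
     continuous_map N M p \<and> p ` topspace N = topspace M \<and>
     (\<forall>x \<in> topspace M. \<exists>U. openin M U \<and> x \<in> U \<and>
        (\<exists>\<V>. \<Union>\<V> = {y \<in> topspace N. p y \<in> U} \<and> pairwise disjnt \<V> \<and>
             (\<forall>V \<in> \<V>. openin N V \<and>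
                homeomorphic_map (subtopology N V) (subtopology M U) p)))"

definition fold_covering :: "nat \<Rightarrow> 'a topology \<Rightarrow> 'b topology \<Rightarrow> ('a \<Rightarrow> 'b) \<Rightarrow> bool" where
  "fold_covering n N M p \<longleftrightarrow>
     covering_map N M p \<and> connected_space N \<and>
     (\<forall>x \<in> topspace M. finite {y \<in> topspace N. p y = x} \<and> card {y \<in> topspace N. p y = x} = n)"

definition covering_equiv ::
    "'a topology \<times> ('a \<Rightarrow> 'b) \<Rightarrow> 'c topology \<times> ('c \<Rightarrow> 'b) \<Rightarrow> bool" where
  "covering_equiv = (\<lambda>(N1, p1) (N2, p2).
     \<exists>h. homeomorphic_map N1 N2 h \<and> (\<forall>y \<in> topspace N1. p1 y = p2 (h y)))"

text \<open>Equivalence classes of \<open>n\<close>-fold coverings of \<open>M\<close> with total space homeomorphic to \<open>X\<close>.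
  The points of the total spaces are taken from the type \<open>'a\<close>, so that the count is meaningful
  only if \<open>'a\<close> is large enough to carry every such covering up to equivalence.\<close>

definition covering_classes ::
    "nat \<Rightarrow> 'c topology \<Rightarrow> 'b topology \<Rightarrow> ('a topology \<times> ('a \<Rightarrow> 'b)) set set" where
  "covering_classes n X M =
     (let C = {(N, p). fold_covering n N M p \<and> N homeomorphic_space X}
      in C // {(c1, c2). c1 \<in> C \<and> c2 \<in> C \<and> covering_equiv c1 c2})"

section \<open>The flat manifolds \<open>\<G>\<^sub>1\<close> and \<open>\<G>\<^sub>2\<close>\<close>

definition orbit_of :: "('a \<Rightarrow> 'a) set \<Rightarrow> 'a \<Rightarrow> 'a set" where
  "orbit_of \<Gamma> x = {g x | g. g \<in> \<Gamma>}"

definition orbit_space :: "('a::topological_space \<Rightarrow> 'a) set \<Rightarrow> 'a set topology" where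
  "orbit_space \<Gamma> = topology (\<lambda>U. U \<subseteq> range (orbit_of \<Gamma>) \<and> open (orbit_of \<Gamma> -` U))"

lemma openin_orbit_space:
  "openin (orbit_space \<Gamma>) U \<longleftrightarrow> U \<subseteq> range (orbit_of \<Gamma>) \<and> open (orbit_of \<Gamma> -` U)"
proof -
  have "istopology (\<lambda>U. U \<subseteq> range (orbit_of \<Gamma>) \<and> open (orbit_of \<Gamma> -` U))"
    unfolding istopology_def by (auto simp: vimage_Int vimage_Union)
  then show ?thesis
    by (simp add: orbit_space_def topology_inverse')
qed

lemma topspace_orbit_space: "topspace (orbit_space \<Gamma>) = range (orbit_of \<Gamma>)"
proof
  show "topspace (orbit_space \<Gamma>) \<subseteq> range (orbit_of \<Gamma>)"
    using openin_topspace[of "orbit_space \<Gamma>"] by (simp only: openin_orbit_space)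
  have "openin (orbit_space \<Gamma>) (range (orbit_of \<Gamma>))"
    by (simp add: openin_orbit_space vimage_def)
  then show "range (orbit_of \<Gamma>) \<subseteq> topspace (orbit_space \<Gamma>)"
    by (rule openin_subset)
qed

lemma quotient_map_orbit_of: "quotient_map euclidean (orbit_space \<Gamma>) (orbit_of \<Gamma>)"
  by (auto simp: quotient_map_def topspace_orbit_space openin_orbit_space vimage_def)

definition translate :: "3 \<Rightarrow> real^3 \<Rightarrow> real^3" where
  "translate i v = v + axis i 1"

definition screw :: "real^3 \<Rightarrow> real^3" where
  "screw v = vector [- v$1, - v$2, v$3 + 1]"

definition deck1 :: "(real^3 \<Rightarrow> real^3) set" where
  "deck1 = generate (BijGroup UNIV) {translate 1, translate 2, translate 3}"

definition deck2 :: "(real^3 \<Rightarrow> real^3) set" where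
  "deck2 = generate (BijGroup UNIV) {translate 1, translate 2, screw}"

text \<open>Both groups consist of orientation preserving isometries and act freely and properly
  discontinuously, with compact quotient, on the simply connected space \<open>real^3\<close>.  Hence the
  quotients are closed orientable flat 3-manifolds with fundamental groups \<open>deck1\<close> and \<open>deck2\<close>.
  The lemma below gives the relations of the presentation of \<open>\<pi>\<^sub>1(\<G>\<^sub>2)\<close>, with \<open>x\<close>, \<open>y\<close>, \<open>z\<close>
  acting as \<open>translate 1\<close>, \<open>translate 2\<close>, \<open>screw\<close>.\<close>

lemma deck2_relations:
  "translate 1 \<circ> translate 2 = translate 2 \<circ> translate 1"
  "translate 1 \<circ> screw \<circ> translate 1 = screw"
  "translate 2 \<circ> screw \<circ> translate 2 = screw"
  by (auto simp: fun_eq_iff vec_eq_iff forall_3 translate_def screw_def axis_def vector_3)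

definition manifold_G1 :: "(real^3) set topology" where
  "manifold_G1 = orbit_space deck1"

definition manifold_G2 :: "(real^3) set topology" where
  "manifold_G2 = orbit_space deck2"

section \<open>Groups given by generators and relators\<close>

text \<open>A letter \<open>(g, True)\<close> stands for the generator \<open>g\<close>, and \<open>(g, False)\<close> for its inverse.\<close>

type_synonym 'g word = "('g \<times> bool) list"

inductive word_eq :: "'g word set \<Rightarrow> 'g word \<Rightarrow> 'g word \<Rightarrow> bool" for R where
  refl: "word_eq R u u"
| sym: "word_eq R u v \<Longrightarrow> word_eq R v u"
| trans: "word_eq R u v \<Longrightarrow> word_eq R v w \<Longrightarrow> word_eq R u w"
| append: "word_eq R u u' \<Longrightarrow> word_eq R v v' \<Longrightarrow> word_eq R (u @ v) (u' @ v')"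
| cancel: "word_eq R [(g, b), (g, \<not> b)] []"
| relator: "r \<in> R \<Longrightarrow> word_eq R r []"

definition word_class :: "'g word set \<Rightarrow> 'g word \<Rightarrow> 'g word set" where
  "word_class R u = {v. word_eq R u v}"

definition presented_group :: "'g word set \<Rightarrow> 'g word set monoid" where
  "presented_group R =
     \<lparr>carrier = range (word_class R),
      monoid.mult = (\<lambda>A B. \<Union>u\<in>A. \<Union>v\<in>B. word_class R (u @ v)),
      one = word_class R []\<rparr>"

datatype gen = GX | GY | GZ

definition relators_G2 :: "gen word set" where
  "relators_G2 =
     {[(GX, True), (GY, True), (GX, False), (GY, False)],
      [(GZ, True), (GX, True), (GZ, False), (GX, True)],
      [(GZ, True), (GY, True), (GZ, False), (GY, True)]}"

definition pi1_G2 :: "gen word set monoid" where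
  "pi1_G2 = presented_group relators_G2"

definition pi1_G1 :: "(int \<times> int \<times> int) monoid" where
  "pi1_G1 = integer_group \<times>\<times> integer_group \<times>\<times> integer_group"

section \<open>Conjugacy classes of subgroups\<close>

definition subgroup_classes ::
    "('a, 'c) monoid_scheme \<Rightarrow> ('b, 'd) monoid_scheme \<Rightarrow> nat \<Rightarrow> 'b set set set" where
  "subgroup_classes H G n =
     {{g <#\<^bsub>G\<^esub> K #>\<^bsub>G\<^esub> inv\<^bsub>G\<^esub> g | g. g \<in> carrier G} | K.
        subgroup K G \<and> finite (rcosets\<^bsub>G\<^esub> K) \<and> card (rcosets\<^bsub>G\<^esub> K) = n \<and>
        G\<lparr>carrier := K\<rparr> \<cong> H}"

definition class_count ::
    "('a, 'c) monoid_scheme \<Rightarrow> ('b, 'd) monoid_scheme \<Rightarrow> nat \<Rightarrow> nat" where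
  "class_count H G n = card (subgroup_classes H G n)"

section \<open>Arithmetic functions, extended by zero\<close>

definition extend_by_zero :: "(nat \<Rightarrow> nat) \<Rightarrow> rat \<Rightarrow> rat" where
  "extend_by_zero f q = (if q \<in> \<nat> \<and> 0 < q then of_nat (f (nat \<lfloor>q\<rfloor>)) else 0)"

definition sigma1_nat :: "nat \<Rightarrow> nat" where
  "sigma1_nat n = (\<Sum>k | k dvd n. k)"

definition sigma2 :: "rat \<Rightarrow> rat" where
  "sigma2 = extend_by_zero (\<lambda>n. \<Sum>k | k dvd n. sigma1_nat k)"

definition omega :: "rat \<Rightarrow> rat" where
  "omega = extend_by_zero (\<lambda>n. \<Sum>k | k dvd n. k * sigma1_nat k)"

end

theory Submission
  imports Defs
begin

text \<open>
  Every connected covering \<open>p : N \<rightarrow> \<G>\<^sub>2\<close> is uniformized by \<open>real^3\<close>: the projection of \<open>real^3\<close> onto the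
  orbit space \<open>\<G>\<^sub>2\<close> lifts to a quotient map \<open>q : real^3 \<rightarrow> N\<close> whose fibres are the orbits of a subgroup \<open>K\<close>
  of the deck group (\<open>covering_uniformized\<close>). The fibres of \<open>p\<close> are in bijection with the cosets of
  \<open>K\<close>, equivalent coverings belong to conjugate subgroups (\<open>covering_equiv_iff\<close>), and every subgroup
  occurs. Hence equivalence classes of \<open>n\<close>-fold coverings correspond to conjugacy classes of subgroups of
  index \<open>n\<close> (\<open>covering_classes_card\<close>). The only topological input is that continuous maps from a normed
  space lift along coverings (\<open>lift_exists\<close>, \<open>lift_unique\<close>).

  Both the deck group and the group presented by \<open>x, y, z\<close> are isomorphic to the group \<open>screw_group\<close> of
  normal forms \<open>x\<^sup>a y\<^sup>b z\<^sup>c\<close>. A subgroup of finite index in it is determined by the generator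
  \<open>k > 0\<close> of its image under \<open>(a, b, c) \<mapsto> c\<close>, by the lattice \<open>L\<close> in \<open>\<int>\<^sup>2\<close> in which it meets the kernel
  of this map, and by the class modulo \<open>L\<close> of a vector \<open>u\<close> such that \<open>(u, k)\<close> lies in it
  (\<open>finite_index_sub\<close>, \<open>sub_eq_iff\<close>); the index is \<open>k\<close> times the index of \<open>L\<close>. If \<open>k\<close> is odd the
  subgroup is again isomorphic to the whole group, and an affine map of \<open>real^3\<close> conjugates it to the deck
  group of \<open>\<G>\<^sub>2\<close>. If \<open>k\<close> is even it is a lattice of translations, and the orbit space is the torus
  \<open>\<G>\<^sub>1\<close>. The two manifolds are distinguished by the commutativity of their deck groups
  (\<open>homeomorphic_orbit_spaces_commute\<close>).

  Conjugation fixes \<open>k\<close> and \<open>L\<close> and replaces \<open>u\<close> by \<open>\<plusminus> u\<close>, up to \<open>2 \<int>\<^sup>2\<close> if \<open>k\<close> is odd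
  (\<open>conj_sub_sub\<close>). So for \<open>A = \<int>\<^sup>2 / L\<close>, of order \<open>m = n / k\<close>, there are \<open>t = \<bar>A / 2 A\<bar> = \<bar>A[2]\<bar>\<close>
  classes for odd \<open>k\<close> and, as orbits of \<open>u \<mapsto> - u\<close> on \<open>A\<close>, \<open>(m + t) / 2\<close> classes for even \<open>k\<close>. There are
  \<open>\<sigma>\<^sub>1(m)\<close> lattices of index \<open>m\<close>, and the sum of \<open>t\<close> over them is \<open>\<sigma>\<^sub>1(m) + 3 \<sigma>\<^sub>1(m / 2)\<close>
  (\<open>sum_tor_lattices\<close>). Summation over the odd and the even divisors \<open>k\<close> of \<open>n\<close> gives the two formulas.
\<close>

section \<open>Lifting maps of a normed space to a covering\<close>

text \<open>The predicate unfolds continuity on the open set \<open>W\<close>, so that restriction and glueing need no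
  subspace topologies.\<close>

definition lift_on ::
    "'a::topological_space set \<Rightarrow> 'b topology \<Rightarrow> ('b \<Rightarrow> 'c) \<Rightarrow> ('a \<Rightarrow> 'c) \<Rightarrow> ('a \<Rightarrow> 'b) \<Rightarrow> bool" where
  "lift_on W N p f g \<longleftrightarrow> open W \<and> (\<forall>x\<in>W. g x \<in> topspace N \<and> p (g x) = f x) \<and>
     (\<forall>U. openin N U \<longrightarrow> open {x \<in> W. g x \<in> U})"

lemma lift_on_UNIV_continuous: "lift_on UNIV N p f g \<Longrightarrow> continuous_map euclidean N g"
  by (simp add: lift_on_def continuous_map_def)

lemma lift_on_subset:
  assumes "lift_on W N p f g" "open W'" "W' \<subseteq> W"
  shows "lift_on W' N p f g"
proof -
  have "{x \<in> W'. g x \<in> U} = W' \<inter> {x \<in> W. g x \<in> U}" for U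
    using assms(3) by auto
  then show ?thesis
    using assms by (auto simp: lift_on_def intro!: open_Int)
qed

lemma covering_mapE:
  assumes "covering_map N M p" "x \<in> topspace M"
  obtains U \<V> where "openin M U" "x \<in> U" "\<Union>\<V> = {y \<in> topspace N. p y \<in> U}" "pairwise disjnt \<V>"
    "\<And>V. V \<in> \<V> \<Longrightarrow> openin N V \<and> homeomorphic_map (subtopology N V) (subtopology M U) p"
  using assms unfolding covering_map_def by meson

lemma homeomorphic_sheet_inj:
  assumes "homeomorphic_map (subtopology N V) (subtopology M U) p" "openin N V"
    "a \<in> V" "b \<in> V" "p a = p b"
  shows "a = b"
proof -
  have "inj_on p (topspace (subtopology N V))"
    using assms(1) homeomorphic_eq_everything_map by blast
  moreover have "topspace (subtopology N V) = V"
    using openin_subset[OF assms(2)] by (auto simp: topspace_subtopology)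
  ultimately show ?thesis
    using assms(3-5) by (auto dest: inj_onD)
qed

text \<open>The set where two lifts agree is open because \<open>p\<close> is injective on each sheet, and its
  complement is open because different sheets over the same set are disjoint.\<close>

lemma lift_unique:
  assumes cov: "covering_map N M p"
    and g: "lift_on W N p f g" and g': "lift_on W N p f g'"
    and W: "connected W" "a \<in> W" "g a = g' a" "b \<in> W"
  shows "g b = g' b"
proof (rule connected_induction_simple[OF W(1,2,4), where P = "\<lambda>x. g x = g' x"])
  show "g a = g' a" by fact
  fix x assume x: "x \<in> W"
  have gx: "g x \<in> topspace N" "p (g x) = f x" "g' x \<in> topspace N" "p (g' x) = f x"
    using g g' x by (auto simp: lift_on_def)
  have "f x \<in> topspace M"
    using cov gx(1,2) unfolding covering_map_def by (metis imageI)
  then obtain U \<V> where U: "openin M U" "f x \<in> U" "\<Union>\<V> = {y \<in> topspace N. p y \<in> U}"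
    "pairwise disjnt \<V>"
    "\<And>V. V \<in> \<V> \<Longrightarrow> openin N V \<and> homeomorphic_map (subtopology N V) (subtopology M U) p"
    by (rule covering_mapE[OF cov]) blast
  obtain V V' where V: "V \<in> \<V>" "g x \<in> V" "V' \<in> \<V>" "g' x \<in> V'"
    using U(2,3) gx by (metis (mono_tags, lifting) UnionE mem_Collect_eq)
  define T where "T = {y \<in> W. g y \<in> V} \<inter> {y \<in> W. g' y \<in> V'}"
  have "open T"
    using g g' U(5) V unfolding T_def lift_on_def by blast
  then have "openin (top_of_set W) T"
    by (auto simp: openin_open T_def)
  moreover have "x \<in> T"
    using x V by (simp add: T_def)
  moreover have "g y = g' y \<longleftrightarrow> V = V'" if "y \<in> T" for y
  proof
    assume "g y = g' y"
    then show "V = V'"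
      using that V U(4) by (auto simp: T_def pairwise_def disjnt_iff)
  next
    assume "V = V'"
    moreover have "p (g y) = p (g' y)"
      using that g g' by (auto simp: T_def lift_on_def)
    ultimately show "g y = g' y"
      using that U(5)[OF V(1)] homeomorphic_sheet_inj by (fastforce simp: T_def)
  qed
  ultimately show "\<exists>T. openin (top_of_set W) T \<and> x \<in> T \<and>
      (\<forall>y\<in>T. \<forall>z\<in>T. g y = g' y \<longrightarrow> g z = g' z)"
    by blast
qed

text \<open>Around \<open>v\<close> the map \<open>f\<close> stays in an evenly covered set, so composing it with the inverse of \<open>p\<close> on
  the sheet through \<open>y\<close> gives a lift. The ball does not depend on \<open>w\<close> or \<open>y\<close>, which is what allows
  a lift arriving from elsewhere to be prolonged to all of it.\<close>

lemma local_lift: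
  fixes f :: "'a::real_normed_vector \<Rightarrow> 'c"
  assumes cov: "covering_map N M p" and f: "continuous_map euclidean M f"
  shows "\<exists>e>0. \<forall>w\<in>ball v e. \<forall>y\<in>topspace N. p y = f w \<longrightarrow>
      (\<exists>g. lift_on (ball v e) N p f g \<and> g w = y)"
proof -
  have "f v \<in> topspace M"
    using f by (auto simp: continuous_map_def)
  then obtain U \<V> where U: "openin M U" "f v \<in> U" "\<Union>\<V> = {y \<in> topspace N. p y \<in> U}"
    "pairwise disjnt \<V>"
    "\<And>V. V \<in> \<V> \<Longrightarrow> openin N V \<and> homeomorphic_map (subtopology N V) (subtopology M U) p"
    by (rule covering_mapE[OF cov]) blast
  have "open {x. f x \<in> U}"
    using f U(1) by (simp add: continuous_map_def)
  then obtain e where e: "e > 0" "ball v e \<subseteq> {x. f x \<in> U}"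
    using U(2) open_contains_ball by blast
  have "\<exists>g. lift_on (ball v e) N p f g \<and> g w = y"
    if w: "w \<in> ball v e" and y: "y \<in> topspace N" "p y = f w" for w y
  proof -
    obtain V where V: "V \<in> \<V>" "y \<in> V"
      using U(3) e(2) w y by (metis (mono_tags, lifting) UnionE mem_Collect_eq subsetD)
    obtain s where s: "homeomorphic_maps (subtopology N V) (subtopology M U) p s"
      using U(5)[OF V(1)] homeomorphic_map_maps by blast
    have tV: "topspace (subtopology N V) = V" "topspace (subtopology M U) = U"
      using U(5)[OF V(1)] U(1) openin_subset by (fastforce simp: topspace_subtopology)+
    have s1: "continuous_map (subtopology M U) (subtopology N V) s"
      "\<And>x. x \<in> V \<Longrightarrow> s (p x) = x" "\<And>x. x \<in> U \<Longrightarrow> p (s x) = x"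
      using s tV by (auto simp: homeomorphic_maps_def)
    have s2: "x \<in> U \<Longrightarrow> s x \<in> V" for x
      using continuous_map_image_subset_topspace[OF s1(1)] tV by auto
    have VN: "V \<subseteq> topspace N"
      using U(5)[OF V(1)] openin_subset by blast
    have "lift_on (ball v e) N p f (s \<circ> f)"
      unfolding lift_on_def
    proof (intro conjI allI impI ballI)
      fix x assume "x \<in> ball v e"
      then have "f x \<in> U"
        using e by auto
      then show "(s \<circ> f) x \<in> topspace N" "p ((s \<circ> f) x) = f x"
        using s1 s2 VN by auto
    next
      fix T assume "openin N T"
      then have "openin (subtopology N V) (T \<inter> V)"
        by (auto simp: openin_subtopology)
      then have "openin (subtopology M U) {x \<in> U. s x \<in> T \<inter> V}"
        using s1(1) unfolding continuous_map_def tV by blast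
      then have "openin M {x \<in> U. s x \<in> T \<inter> V}"
        using U(1) openin_open_subtopology by blast
      then have "open {x. f x \<in> {x \<in> U. s x \<in> T \<inter> V}}"
        using f unfolding continuous_map_def
          by (metis (mono_tags, lifting) Collect_cong UNIV_I open_openin topspace_euclidean)
      then have "open (ball v e \<inter> {x. f x \<in> {x \<in> U. s x \<in> T \<inter> V}})"
        by blast
      moreover have "ball v e \<inter> {x. f x \<in> {x \<in> U. s x \<in> T \<inter> V}} = {x \<in> ball v e. (s \<circ> f) x \<in> T}"
        using e s2 by auto
      ultimately show "open {x \<in> ball v e. (s \<circ> f) x \<in> T}"
        by simp
    qed simp
    moreover have "(s \<circ> f) w = y"
      using s1(2)[OF V(2)] y by simp
    ultimately show ?thesis by blast
  qed
  then show ?thesis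
    using e(1) by blast
qed

lemma lift_on_glue:
  assumes F: "\<And>W g. (W, g) \<in> F \<Longrightarrow> lift_on W N p f g"
    and agree: "\<And>W g W' g' x. (W, g) \<in> F \<Longrightarrow> (W', g') \<in> F \<Longrightarrow> x \<in> W \<Longrightarrow> x \<in> W' \<Longrightarrow> g x = g' x"
  shows "\<exists>q. lift_on (\<Union>(fst ` F)) N p f q \<and> (\<forall>(W, g)\<in>F. \<forall>x\<in>W. q x = g x)"
proof -
  define q where "q x = snd (SOME Wg. Wg \<in> F \<and> x \<in> fst Wg) x" for x
  have q: "q x = g x" if "(W, g) \<in> F" "x \<in> W" for W g x
  proof -
    have "(SOME Wg. Wg \<in> F \<and> x \<in> fst Wg) \<in> F \<and> x \<in> fst (SOME Wg. Wg \<in> F \<and> x \<in> fst Wg)"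
      by (rule someI[where x = "(W, g)"]) (use that in auto)
    then obtain W' g' where "(W', g') \<in> F" "x \<in> W'" "q x = g' x"
      unfolding q_def by (metis (no_types, lifting) prod.collapse)
    then show ?thesis
      using agree[OF that(1) _ that(2)] by simp
  qed
  have "lift_on (\<Union>(fst ` F)) N p f q"
    unfolding lift_on_def
  proof (intro conjI allI impI)
    show "open (\<Union>(fst ` F))"
      using F by (auto simp: lift_on_def)
    show "\<forall>x\<in>\<Union>(fst ` F). q x \<in> topspace N \<and> p (q x) = f x"
      using F q by (fastforce simp: lift_on_def)
    fix U assume U: "openin N U"
    have "{x \<in> \<Union>(fst ` F). q x \<in> U} = (\<Union>(W, g)\<in>F. {x \<in> W. g x \<in> U})"
      using q by fastforce
    also have "open \<dots>"
      using F U by (auto simp: lift_on_def)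
    finally show "open {x \<in> \<Union>(fst ` F). q x \<in> U}" .
  qed
  then show ?thesis
    using q by fast
qed

lemma convex_tube:
  fixes A :: "'a::real_normed_vector set"
  assumes "convex A"
  shows "convex (\<Union>x\<in>A. ball x e)"
proof -
  have "(\<Union>x\<in>A. ball x e) = (\<Union>x\<in>A. \<Union>y\<in>ball 0 e. {x + y})"
  proof (intro equalityI subsetI)
    fix z assume "z \<in> (\<Union>x\<in>A. ball x e)"
    then obtain x where "x \<in> A" "z - x \<in> ball 0 e" "z = x + (z - x)"
      by (auto simp: dist_norm norm_minus_commute)
    then show "z \<in> (\<Union>x\<in>A. \<Union>y\<in>ball 0 e. {x + y})"
      by blast
  next
    fix z assume "z \<in> (\<Union>x\<in>A. \<Union>y\<in>ball 0 e. {x + y})"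
    then obtain x y where "x \<in> A" "y \<in> ball 0 e" "z = x + y"
      by blast
    then show "z \<in> (\<Union>x\<in>A. ball x e)"
      by (auto simp: dist_norm intro!: bexI[of _ x])
  qed
  then show ?thesis
    using assms convex_sums[of A "ball 0 e"] by simp
qed

text \<open>Lifts on convex open neighbourhoods of \<open>a\<close> agree where they overlap, so they glue to
  one lift on the union \<open>S\<close> of these neighbourhoods. Each segment from \<open>a\<close> stays in \<open>S\<close>:
  a thin tube around its part inside \<open>S\<close> can be prolonged by a lift on a small ball.\<close>

lemma lift_exists:
  fixes f :: "'a::real_normed_vector \<Rightarrow> 'c"
  assumes cov: "covering_map N M p" and f: "continuous_map euclidean M f"
    and y: "y \<in> topspace N" "p y = f a"
  shows "\<exists>g. lift_on UNIV N p f g \<and> g a = y"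
proof -
  define F where "F = {(W, g). convex W \<and> a \<in> W \<and> g a = y \<and> lift_on W N p f g}"
  have "\<exists>q. lift_on (\<Union>(fst ` F)) N p f q \<and> (\<forall>(W, g)\<in>F. \<forall>x\<in>W. q x = g x)"
  proof (rule lift_on_glue)
    fix W g W' g' x assume A: "(W, g) \<in> F" "(W', g') \<in> F" "x \<in> W" "x \<in> W'"
    then have "open (W \<inter> W')"
      by (auto simp: F_def lift_on_def)
    then have "lift_on (W \<inter> W') N p f g" "lift_on (W \<inter> W') N p f g'"
      using A by (auto simp: F_def intro: lift_on_subset)
    moreover have "connected (W \<inter> W')"
      using A by (auto simp: F_def intro!: convex_connected convex_Int)
    moreover have "a \<in> W \<inter> W'" "g a = g' a" "x \<in> W \<inter> W'"
      using A by (auto simp: F_def)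
    ultimately show "g x = g' x"
      by (rule lift_unique[OF cov])
  qed (simp add: F_def)
  then obtain q where q: "lift_on (\<Union>(fst ` F)) N p f q" "\<And>W g x. (W, g) \<in> F \<Longrightarrow> x \<in> W \<Longrightarrow> q x = g x"
    by blast
  obtain e0 where e0: "e0 > 0" "\<exists>g. lift_on (ball a e0) N p f g \<and> g a = y"
    using local_lift[OF cov f, of a] y by (metis centre_in_ball)
  then obtain g0 where g0: "(ball a e0, g0) \<in> F"
    by (auto simp: F_def)
  have aS: "a \<in> \<Union>(fst ` F)" "q a = y"
    using g0 e0(1) q(2)[OF g0, of a] by (force simp: F_def)+
  have "b \<in> \<Union>(fst ` F)" for b
  proof -
    define c where "c t = a + t *\<^sub>R (b - a)" for t
    have seg: "c ` {s..t} = closed_segment (c s) (c t)" if "s \<le> t" for s t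
    proof -
      have "c ` closed_segment s t = closed_segment (c s) (c t)"
      proof -
        have "closed_segment (s *\<^sub>R (b - a)) (t *\<^sub>R (b - a)) = (\<lambda>r. r *\<^sub>R (b - a)) ` closed_segment s t"
          by (rule closed_segment_linear_image) (simp add: linear_iff scaleR_left_distrib)
        then show ?thesis
          unfolding c_def closed_segment_translation by (simp add: image_image)
      qed
      then show ?thesis
        using that by (simp add: closed_segment_eq_real_ivl)
    qed
    have c_cont: "continuous_on UNIV c"
      unfolding c_def by (intro continuous_intros)
    have "c 1 \<in> \<Union>(fst ` F)"
    proof (rule connected_induction_simple[where P = "\<lambda>t. c t \<in> \<Union>(fst ` F)" and a = 0
      and S = "{0..1::real}"])
      show "c 0 \<in> \<Union>(fst ` F)"
        using aS by (simp add: c_def)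
      fix t0 :: real assume t0: "t0 \<in> {0..1}"
      obtain e where e: "e > 0" "\<And>w y. w \<in> ball (c t0) e \<Longrightarrow> y \<in> topspace N \<Longrightarrow> p y = f w \<Longrightarrow>
          \<exists>g. lift_on (ball (c t0) e) N p f g \<and> g w = y"
        using local_lift[OF cov f, of "c t0"] by blast
      define T where "T = {0..1} \<inter> c -` ball (c t0) e"
      have "openin (top_of_set {0..1}) T"
        using open_vimage[OF open_ball c_cont] unfolding T_def by (rule openin_open_Int)
      moreover have "t0 \<in> T"
        using t0 e(1) by (simp add: T_def)
      moreover have "c t \<in> \<Union>(fst ` F)" if st: "s \<in> T" "t \<in> T" "c s \<in> \<Union>(fst ` F)" for s t
      proof -
        obtain W g where W: "(W, g) \<in> F" "c s \<in> W"
          using st(3) by auto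
        have W': "convex W" "open W" "a \<in> W" "g a = y" "lift_on W N p f g"
          using W(1) by (auto simp: F_def lift_on_def)
        have c0: "c 0 = a" by (simp add: c_def)
        have s0: "0 \<le> s" "0 \<le> t" "c s \<in> ball (c t0) e" "c t \<in> ball (c t0) e"
          using st by (auto simp: T_def)
        have segW: "closed_segment a (c s) \<subseteq> W"
          using W' W(2) by (simp add: closed_segment_subset)
        show ?thesis
        \<comment> \<open>Towards \<open>a\<close> the segment stays in \<open>W\<close>; only the outward direction needs a new lift.\<close>
        proof (cases "t \<le> s")
          case True
          then have "c t \<in> closed_segment a (c s)"
            using seg[of 0 s] s0 c0 by (metis atLeastAtMost_iff image_eqI)
          then show ?thesis
            using segW W(1) by force
        next
          case False
          have segB: "closed_segment (c s) (c t) \<subseteq> ball (c t0) e"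
            using s0 by (intro closed_segment_subset) auto
          obtain d1 where d1: "d1 > 0" "(\<Union>x\<in>closed_segment a (c s). ball x d1) \<subseteq> W"
            by (rule compact_subset_open_imp_ball_epsilon_subset[OF compact_segment W'(2) segW]) blast
          obtain d2 where d2: "d2 > 0" "(\<Union>x\<in>closed_segment (c s) (c t). ball x d2) \<subseteq> ball (c t0) e"
            by (rule compact_subset_open_imp_ball_epsilon_subset[OF compact_segment open_ball segB])
              blast
          define d where "d = min d1 d2"
          define T1 where "T1 = (\<Union>x\<in>closed_segment a (c s). ball x d)"
          define T2 where "T2 = (\<Union>x\<in>closed_segment (c s) (c t). ball x d)"
          have d: "d > 0"
            using d1(1) d2(1) by (simp add: d_def)
          have segT: "closed_segment a (c s) \<subseteq> T1" "closed_segment (c s) (c t) \<subseteq> T2"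
            using d unfolding T1_def T2_def by (auto intro: centre_in_ball[THEN iffD2])
          have "T1 \<subseteq> W"
            using d1(2) by (fastforce simp: T1_def d_def)
          moreover have "open T1" "convex T1"
            unfolding T1_def by (auto intro: convex_tube)
          ultimately have T1: "T1 \<subseteq> W" "open T1" "convex T1" "c s \<in> T1" "a \<in> T1"
            using segT by auto
          have "T2 \<subseteq> ball (c t0) e"
            using d2(2) by (fastforce simp: T2_def d_def)
          moreover have "open T2" "convex T2"
            unfolding T2_def by (auto intro: convex_tube)
          ultimately have T2: "T2 \<subseteq> ball (c t0) e" "open T2" "convex T2" "c s \<in> T2" "c t \<in> T2"
            using segT by auto
          have "c ` {0..t} = c ` {0..s} \<union> c ` {s..t}"
            using False s0 by (auto simp: image_Un[symmetric] ivl_disj_un_two_touch)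
          then have "closed_segment a (c t) = closed_segment a (c s) \<union> closed_segment (c s) (c t)"
            using seg[of 0 t] seg[of 0 s] seg[of s t] False s0 c0 by simp
          then have T12: "T1 \<union> T2 = (\<Union>x\<in>closed_segment a (c t). ball x d)"
            unfolding T1_def T2_def by auto
          obtain g2 where g2: "lift_on (ball (c t0) e) N p f g2" "g2 (c s) = g (c s)"
            using e(2)[of "c s" "g (c s)"] s0 W' W(2) by (auto simp: lift_on_def)
          have L: "lift_on T1 N p f g" "lift_on T2 N p f g2"
            using W'(5) g2(1) T1 T2 by (blast intro: lift_on_subset)+
          have ag: "g x = g2 x" if "x \<in> T1" "x \<in> T2" for x
          proof (rule lift_unique[OF cov])
            show "lift_on (T1 \<inter> T2) N p f g" "lift_on (T1 \<inter> T2) N p f g2"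
              using L T1 T2 by (blast intro: lift_on_subset)+
            show "connected (T1 \<inter> T2)"
              using T1 T2 by (intro convex_connected convex_Int)
            show "c s \<in> T1 \<inter> T2" "g (c s) = g2 (c s)" "x \<in> T1 \<inter> T2"
              using that T1 T2 g2 by auto
          qed
          have "\<exists>h. lift_on (\<Union>(fst ` {(T1, g), (T2, g2)})) N p f h \<and>
              (\<forall>(W, g)\<in>{(T1, g), (T2, g2)}. \<forall>x\<in>W. h x = g x)"
            by (rule lift_on_glue) (use L ag in auto)
          then obtain h where h: "lift_on (T1 \<union> T2) N p f h" "\<forall>x\<in>T1. h x = g x"
            by auto
          have "convex (T1 \<union> T2)"
            unfolding T12 by (simp add: convex_tube)
          then have "(T1 \<union> T2, h) \<in> F"
            using h T1 W' by (simp add: F_def)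
          then show ?thesis
            using T2(5) by force
        qed
      qed
      ultimately show "\<exists>T. openin (top_of_set {0..1}) T \<and> t0 \<in> T \<and>
          (\<forall>x\<in>T. \<forall>y\<in>T. c x \<in> \<Union>(fst ` F) \<longrightarrow> c y \<in> \<Union>(fst ` F))"
        by blast
    qed auto
    then show ?thesis
      by (simp add: c_def)
  qed
  then have "\<Union>(fst ` F) = UNIV"
    by blast
  then show ?thesis
    using q(1) aS(2) by auto
qed

section \<open>Coverings of the orbit space of a free action\<close>

text \<open>If related elements of \<open>C\<close> and \<open>D\<close> have the same coincidences under \<open>f\<close> and \<open>g\<close>, the relation
  induces a bijection between the images. This compares sets of classes without first proving that
  the relation defining the classes on either side is an equivalence.\<close>

lemma matched_images:
  assumes "\<And>c. c \<in> C \<Longrightarrow> \<exists>d\<in>D. R c d" "\<And>d. d \<in> D \<Longrightarrow> \<exists>c\<in>C. R c d"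
    and eq: "\<And>c c' d d'. c \<in> C \<Longrightarrow> c' \<in> C \<Longrightarrow> d \<in> D \<Longrightarrow> d' \<in> D \<Longrightarrow> R c d \<Longrightarrow> R c' d' \<Longrightarrow>
      f c = f c' \<longleftrightarrow> g d = g d'"
  shows "\<exists>h. bij_betw h (f ` C) (g ` D)"
proof -
  obtain t where t: "\<And>c. c \<in> C \<Longrightarrow> t c \<in> D" "\<And>c. c \<in> C \<Longrightarrow> R c (t c)"
    using assms(1) by metis
  define h where "h y = g (t (SOME c. c \<in> C \<and> f c = y))" for y
  have h: "h (f c) = g d" if cd: "c \<in> C" "d \<in> D" "R c d" for c d
  proof -
    define c' where "c' = (SOME c'. c' \<in> C \<and> f c' = f c)"
    have "c' \<in> C \<and> f c' = f c"
      unfolding c'_def by (rule someI[of _ c]) (use cd in auto)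
    then show ?thesis
      using eq[of c' c "t c'" d] t[of c'] cd unfolding h_def c'_def[symmetric] by simp
  qed
  have "bij_betw h (f ` C) (g ` D)"
    unfolding bij_betw_def
  proof (intro conjI inj_onI equalityI subsetI)
    fix x y assume "x \<in> f ` C" "y \<in> f ` C" "h x = h y"
    then show "x = y"
      using assms(1) h eq by (smt (verit) imageE)
  next
    fix x assume "x \<in> h ` f ` C"
    then show "x \<in> g ` D"
      using t h by (smt (verit) imageE imageI)
  next
    fix x assume "x \<in> g ` D"
    then show "x \<in> h ` f ` C"
      using assms(2) h by (smt (verit) imageE imageI)
  qed
  then show ?thesis by blast
qed

lemma matched_images_card:
  assumes "\<And>c. c \<in> C \<Longrightarrow> \<exists>d\<in>D. R c d" "\<And>d. d \<in> D \<Longrightarrow> \<exists>c\<in>C. R c d"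
    and "\<And>c c' d d'. c \<in> C \<Longrightarrow> c' \<in> C \<Longrightarrow> d \<in> D \<Longrightarrow> d' \<in> D \<Longrightarrow> R c d \<Longrightarrow> R c' d' \<Longrightarrow>
      f c = f c' \<longleftrightarrow> g d = g d'"
  shows "card (f ` C) = card (g ` D)" "finite (f ` C) \<longleftrightarrow> finite (g ` D)"
proof -
  have "\<exists>h. bij_betw h (f ` C) (g ` D)"
    by (rule matched_images[where R = R]) (fact assms)+
  then show "card (f ` C) = card (g ` D)" "finite (f ` C) \<longleftrightarrow> finite (g ` D)"
    using bij_betw_same_card bij_betw_finite by blast+
qed

lemma quotient_maps_homeomorphic:
  assumes q1: "quotient_map X Y1 q1" and q2: "quotient_map X Y2 q2"
    and eq: "\<And>x y. x \<in> topspace X \<Longrightarrow> y \<in> topspace X \<Longrightarrow> q1 x = q1 y \<longleftrightarrow> q2 x = q2 y"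
  shows "\<exists>h. homeomorphic_map Y1 Y2 h \<and> (\<forall>x\<in>topspace X. h (q1 x) = q2 x)"
proof -
  obtain h where h: "continuous_map Y1 Y2 h" "\<And>x. x \<in> topspace X \<Longrightarrow> h (q1 x) = q2 x"
    using quotient_map_lift_exists[OF q1 quotient_imp_continuous_map[OF q2]] eq by metis
  obtain k where k: "continuous_map Y2 Y1 k" "\<And>x. x \<in> topspace X \<Longrightarrow> k (q2 x) = q1 x"
    using quotient_map_lift_exists[OF q2 quotient_imp_continuous_map[OF q1]] eq by metis
  have "topspace Y1 = q1 ` topspace X" "topspace Y2 = q2 ` topspace X"
    using q1 q2 quotient_imp_surjective_map by metis+
  then have "homeomorphic_maps Y1 Y2 h k"
    using h k by (auto simp: homeomorphic_maps_def)
  then show ?thesis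
    using h(2) homeomorphic_maps_map by blast
qed

lemma quotient_map_topology:
  fixes q :: "'a::topological_space \<Rightarrow> 'b"
  shows "\<exists>N. quotient_map euclidean N q"
proof -
  define N where "N = topology (\<lambda>U. U \<subseteq> range q \<and> open (q -` U))"
  have "istopology (\<lambda>U. U \<subseteq> range q \<and> open (q -` U))"
    unfolding istopology_def by (auto simp: vimage_Int vimage_Union)
  then have N: "openin N U \<longleftrightarrow> U \<subseteq> range q \<and> open (q -` U)" for U
    by (simp add: N_def topology_inverse')
  have "openin N (range q)"
    by (simp add: N vimage_def)
  then have "topspace N = range q"
    using openin_subset openin_topspace[of N] N by blast
  then have "quotient_map euclidean N q"
    by (auto simp: quotient_map_def N vimage_def)
  then show ?thesis ..
qed

subsection \<open>Conjugation of subgroups\<close>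

definition conj_sub :: "('g, 'x) monoid_scheme \<Rightarrow> 'g \<Rightarrow> 'g set \<Rightarrow> 'g set" where
  "conj_sub G g K = g <#\<^bsub>G\<^esub> K #>\<^bsub>G\<^esub> inv\<^bsub>G\<^esub> g"

definition conj_class :: "('g, 'x) monoid_scheme \<Rightarrow> 'g set \<Rightarrow> 'g set set" where
  "conj_class G K = {conj_sub G g K | g. g \<in> carrier G}"

context group
begin

lemma conj_sub_eq: "conj_sub G g K = (\<lambda>k. g \<otimes> k \<otimes> inv g) ` K"
  by (auto simp: conj_sub_def l_coset_def r_coset_def)

lemma conj_sub_mult:
  assumes "K \<subseteq> carrier G" "g \<in> carrier G" "h \<in> carrier G"
  shows "conj_sub G g (conj_sub G h K) = conj_sub G (g \<otimes> h) K"
  unfolding conj_sub_eq image_image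
  by (rule image_cong) (use assms in \<open>auto simp: inv_mult_group m_assoc subset_iff\<close>)

lemma conj_sub_one: "K \<subseteq> carrier G \<Longrightarrow> conj_sub G \<one> K = K"
  by (force simp: conj_sub_eq subset_iff)

lemma conj_sub_carrier: "K \<subseteq> carrier G \<Longrightarrow> g \<in> carrier G \<Longrightarrow> conj_sub G g K \<subseteq> carrier G"
  by (auto simp: conj_sub_eq)

lemma conj_class_eq_iff:
  assumes K: "K \<subseteq> carrier G" "K' \<subseteq> carrier G"
  shows "conj_class G K = conj_class G K' \<longleftrightarrow> (\<exists>g\<in>carrier G. K' = conj_sub G g K)"
proof
  assume "conj_class G K = conj_class G K'"
  moreover have "K' \<in> conj_class G K'"
    unfolding conj_class_def using conj_sub_one[OF K(2)]
      by (metis (mono_tags, lifting) CollectI one_closed)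
  ultimately have "K' \<in> conj_class G K"
    by simp
  then show "\<exists>g\<in>carrier G. K' = conj_sub G g K"
    by (auto simp: conj_class_def)
next
  assume "\<exists>g\<in>carrier G. K' = conj_sub G g K"
  then obtain g where g: "g \<in> carrier G" "K' = conj_sub G g K"
    by blast
  have 1: "conj_sub G h K' = conj_sub G (h \<otimes> g) K" if "h \<in> carrier G" for h
    using that g K conj_sub_mult by simp
  have 2: "conj_sub G h K = conj_sub G (h \<otimes> inv g) K'" if "h \<in> carrier G" for h
    using that g K conj_sub_mult by (simp add: m_assoc)
  show "conj_class G K = conj_class G K'"
    unfolding conj_class_def using 1 2 g(1) by (auto) (metis inv_closed m_closed)+
qed

lemma rcosets_image: "rcosets K = (\<lambda>g. K #> g) ` carrier G"
  by (auto simp: RCOSETS_def)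

lemma r_coset_eq_iff:
  assumes "subgroup K G" "g \<in> carrier G" "h \<in> carrier G"
  shows "K #> g = K #> h \<longleftrightarrow> (\<exists>k\<in>K. h = k \<otimes> g)"
proof
  assume "K #> g = K #> h"
  then have "h \<in> K #> g"
    using assms rcos_self by blast
  then show "\<exists>k\<in>K. h = k \<otimes> g"
    by (auto simp: r_coset_def)
next
  assume "\<exists>k\<in>K. h = k \<otimes> g"
  then have "h \<in> K #> g"
    by (auto simp: r_coset_def)
  then show "K #> g = K #> h"
    using repr_independence assms by blast
qed

end

subsection \<open>Free actions\<close>

text \<open>The last assumption says that the action is free and that orbits are discrete. It makes the
  projection to the orbit space a covering, although that space need not be Hausdorff.\<close>

locale free_action = group G for G :: "('g, 'x) monoid_scheme" (structure) +
  fixes act :: "'g \<Rightarrow> 'a::real_normed_vector \<Rightarrow> 'a"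
  assumes act_one: "act \<one> x = x"
    and act_mult: "g \<in> carrier G \<Longrightarrow> h \<in> carrier G \<Longrightarrow> act (g \<otimes> h) x = act g (act h x)"
    and act_continuous: "g \<in> carrier G \<Longrightarrow> continuous_on UNIV (act g)"
    and act_disjoint: "\<exists>U. open U \<and> x \<in> U \<and> (\<forall>g\<in>carrier G. \<forall>y\<in>U. act g y \<in> U \<longrightarrow> g = \<one>)"
begin

abbreviation "proj \<equiv> orbit_of (act ` carrier G)"

abbreviation "base \<equiv> orbit_space (act ` carrier G)"

text \<open>\<open>uniformizes K N p q\<close> exhibits \<open>N\<close> as the orbit space of \<open>K\<close> with \<open>p\<close> as the induced projection,
  whatever the type of its points.\<close>

definition uniformizes :: "'g set \<Rightarrow> 'b topology \<Rightarrow> ('b \<Rightarrow> 'a set) \<Rightarrow> ('a \<Rightarrow> 'b) \<Rightarrow> bool" where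
  "uniformizes K N p q \<longleftrightarrow> quotient_map euclidean N q \<and> (\<forall>x. p (q x) = proj x) \<and>
     (\<forall>x y. q x = q y \<longleftrightarrow> (\<exists>k\<in>K. y = act k x))"

lemma act_inv [simp]:
  "g \<in> carrier G \<Longrightarrow> act (inv g) (act g x) = x"
  "g \<in> carrier G \<Longrightarrow> act g (act (inv g) x) = x"
  by (metis act_mult act_one inv_closed l_inv) (metis act_mult act_one inv_closed r_inv)

lemma act_free:
  assumes "g \<in> carrier G" "h \<in> carrier G" "act g x = act h x"
  shows "g = h"
proof -
  have "act (inv h \<otimes> g) x = x"
    using assms by (simp add: act_mult)
  then have "inv h \<otimes> g = \<one>"
    using act_disjoint[of x] assms by (metis inv_closed m_closed)
  then show ?thesis
    using assms by (metis inv_closed inv_equality inv_inv)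
qed

lemma orbit_eq_iff:
  assumes "subgroup K G"
  shows "orbit_of (act ` K) x = orbit_of (act ` K) y \<longleftrightarrow> (\<exists>k\<in>K. y = act k x)"
proof -
  interpret K: subgroup K G by fact
  have mem: "z \<in> orbit_of (act ` K) x \<longleftrightarrow> (\<exists>k\<in>K. z = act k x)" for z x
    by (auto simp: orbit_of_def)
  show ?thesis
  proof
    assume "orbit_of (act ` K) x = orbit_of (act ` K) y"
    moreover have "y \<in> orbit_of (act ` K) y"
      unfolding mem using K.one_closed act_one by metis
    ultimately show "\<exists>k\<in>K. y = act k x"
      using mem by blast
  next
    assume "\<exists>k\<in>K. y = act k x"
    then obtain k where k: "k \<in> K" "y = act k x" by blast
    have "\<exists>m\<in>K. z = act m y" if "l \<in> K" "z = act l x" for z l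
      using that k by (intro bexI[of _ "l \<otimes> inv k"]) (auto simp: act_mult)
    moreover have "\<exists>m\<in>K. z = act m x" if "l \<in> K" "z = act l y" for z l
      using that k by (intro bexI[of _ "l \<otimes> k"]) (auto simp: act_mult)
    ultimately show "orbit_of (act ` K) x = orbit_of (act ` K) y"
      unfolding set_eq_iff mem by blast
  qed
qed

lemma proj_eq_iff: "proj x = proj y \<longleftrightarrow> (\<exists>g\<in>carrier G. y = act g x)"
  by (rule orbit_eq_iff) (rule subgroup_self)

lemma proj_act [simp]: "g \<in> carrier G \<Longrightarrow> proj (act g x) = proj x"
  using proj_eq_iff by blast

lemma topspace_base: "topspace base = range proj"
  by (rule topspace_orbit_space)

lemma proj_continuous: "continuous_map euclidean base proj"
  by (rule quotient_imp_continuous_map) (rule quotient_map_orbit_of)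

lemma open_act_image:
  assumes "open W" "g \<in> carrier G"
  shows "open (act g ` W)"
proof -
  have "act g ` W = act (inv g) -` W"
    using assms(2) by (force intro: image_eqI[where x = "act (inv g) _"])
  then show ?thesis
    using open_vimage[OF assms(1) act_continuous] assms(2) by simp
qed

lemma open_orbit_union:
  assumes "open W" "K \<subseteq> carrier G"
  shows "open {y. \<exists>x\<in>W. \<exists>k\<in>K. y = act k x}"
proof -
  have "{y. \<exists>x\<in>W. \<exists>k\<in>K. y = act k x} = (\<Union>k\<in>K. act k ` W)"
    by auto
  also have "open \<dots>"
    using assms open_act_image by blast
  finally show ?thesis .
qed

lemma proj_open: "open W \<Longrightarrow> openin base (proj ` W)"
proof -
  assume W: "open W"
  have "proj -` proj ` W = {y. \<exists>x\<in>W. \<exists>k\<in>carrier G. y = act k x}"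
    using proj_eq_iff by (auto simp: image_iff) metis+
  then show ?thesis
    using open_orbit_union[OF W subset_refl] by (auto simp: openin_orbit_space)
qed

lemma lift_on_act:
  assumes q: "lift_on UNIV N p f q" and g: "g \<in> carrier G" and f: "\<And>x. f (act g x) = f x"
  shows "lift_on UNIV N p f (\<lambda>x. q (act g x))"
  unfolding lift_on_def
proof (intro conjI allI impI ballI)
  fix U assume "openin N U"
  then have "open (act g -` {x. q x \<in> U})"
    using q act_continuous[OF g] by (intro open_vimage) (auto simp: lift_on_def)
  then show "open {x \<in> UNIV. q (act g x) \<in> U}"
    by (simp add: vimage_def)
qed (use q f in \<open>auto simp: lift_on_def\<close>)

text \<open>Near \<open>q w\<close> the image of an open set \<open>W'\<close> is the part of a sheet lying over the open set
  \<open>proj ` W'\<close>.\<close>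

lemma lift_open_map:
  assumes cov: "covering_map N base p" and q: "lift_on UNIV N p proj q" and W: "open W"
  shows "openin N (q ` W)"
proof (subst openin_subopen, intro ballI)
  fix y assume "y \<in> q ` W"
  then obtain w where w: "w \<in> W" "y = q w" by blast
  have qx: "q x \<in> topspace N" "p (q x) = proj x" for x
    using q by (auto simp: lift_on_def)
  have "p y \<in> topspace base"
    using qx w topspace_base by simp
  then obtain U \<V> where U: "openin base U" "p y \<in> U" "\<Union>\<V> = {y \<in> topspace N. p y \<in> U}"
    "pairwise disjnt \<V>"
    "\<And>V. V \<in> \<V> \<Longrightarrow> openin N V \<and> homeomorphic_map (subtopology N V) (subtopology base U) p"
    by (rule covering_mapE[OF cov]) blast
  obtain V where V: "V \<in> \<V>" "y \<in> V"
    using U(2,3) qx w by (metis (mono_tags, lifting) UnionE mem_Collect_eq)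
  define W' where "W' = W \<inter> {x. q x \<in> V}"
  have "open W'"
    using W q U(5)[OF V(1)] unfolding W'_def lift_on_def by auto
  then have "openin base (proj ` W')"
    by (rule proj_open)
  moreover have "continuous_map N base p"
    using cov by (simp add: covering_map_def)
  ultimately have "openin N {z \<in> topspace N. p z \<in> proj ` W'}"
    unfolding continuous_map_def by blast
  then have "openin N (V \<inter> {z \<in> topspace N. p z \<in> proj ` W'})"
    using U(5)[OF V(1)] by blast
  moreover have "y \<in> V \<inter> {z \<in> topspace N. p z \<in> proj ` W'}"
    using V w qx by (auto simp: W'_def)
  moreover have "V \<inter> {z \<in> topspace N. p z \<in> proj ` W'} \<subseteq> q ` W"
  proof
    fix z assume z: "z \<in> V \<inter> {z \<in> topspace N. p z \<in> proj ` W'}"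
    then obtain x where x: "x \<in> W'" "p z = proj x" by blast
    then have "q x = z"
      using z qx U(5)[OF V(1)] homeomorphic_sheet_inj unfolding W'_def
        by (metis (no_types, lifting) IntD1 IntD2 mem_Collect_eq)
    then show "z \<in> q ` W"
      using x by (auto simp: W'_def)
  qed
  ultimately show "\<exists>T. openin N T \<and> y \<in> T \<and> T \<subseteq> q ` W"
    by blast
qed

lemma lift_proj_exists:
  assumes cov: "covering_map N base p" and y: "y \<in> topspace N"
  shows "\<exists>q. lift_on UNIV N p proj q \<and> y \<in> range q"
proof -
  have "p y \<in> topspace base"
    using cov y unfolding covering_map_def by blast
  then obtain a where "p y = proj a"
    unfolding topspace_base by blast
  then show ?thesis
    using lift_exists[OF cov proj_continuous y] by (metis rangeI)
qed

text \<open>Ranges of lifts of \<open>proj\<close> are open, and two of them are equal or disjoint, since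
  lifts that meet differ by an element of \<open>G\<close>. As the total space is connected, one lift
  already fills it.\<close>

lemma covering_uniformized:
  assumes cov: "covering_map N base p" and conn: "connected_space N"
  shows "\<exists>K q. subgroup K G \<and> uniformizes K N p q"
proof -
  have "proj undefined \<in> topspace base"
    by (simp add: topspace_base)
  then have "topspace N \<noteq> {}"
    using cov by (force simp: covering_map_def)
  then obtain q where q: "lift_on UNIV N p proj q"
    using lift_proj_exists[OF cov] by blast
  have qx: "q x \<in> topspace N" "p (q x) = proj x" for x
    using q by (auto simp: lift_on_def)
  have shift: "\<exists>g\<in>carrier G. \<forall>x. q' x = q (act g x)" if q': "lift_on UNIV N p proj q'" "q' b = q a"
      for q' a b
  proof -
    have "p (q' b) = proj b"
      using q'(1) by (simp add: lift_on_def)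
    then have "proj b = proj a"
      using qx q'(2) by simp
    then obtain g where g: "g \<in> carrier G" "a = act g b"
      using proj_eq_iff by blast
    have "q' x = q (act g x)" for x
      by (rule lift_unique[OF cov q'(1) lift_on_act[OF q g(1)], of b])
        (use g q' in \<open>auto simp: connected_UNIV\<close>)
    then show ?thesis
      using g by blast
  qed
  have "openin N (topspace N - range q)"
  proof (subst openin_subopen, intro ballI)
    fix y assume y: "y \<in> topspace N - range q"
    then obtain q' where q': "lift_on UNIV N p proj q'" "y \<in> range q'"
      using lift_proj_exists[OF cov] by blast
    have "range q' \<subseteq> topspace N - range q"
    proof -
      have "q' b \<noteq> q a" for a b
        using shift[OF q'(1), of b a] q'(2) y by fastforce
      moreover have "range q' \<subseteq> topspace N"
        using q' by (auto simp: lift_on_def)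
      ultimately show ?thesis by fastforce
    qed
    then show "\<exists>T. openin N T \<and> y \<in> T \<and> T \<subseteq> topspace N - range q"
      using lift_open_map[OF cov q'(1) open_UNIV] q'(2) by blast
  qed
  moreover have "range q \<subseteq> topspace N"
    using qx by blast
  ultimately have "closedin N (range q)"
    by (simp add: closedin_def)
  moreover have "openin N (range q)"
    by (rule lift_open_map[OF cov q open_UNIV])
  ultimately have surj: "range q = topspace N"
    using conn unfolding connected_space_clopen_in by blast
  have quot: "quotient_map euclidean N q"
  proof (rule continuous_open_imp_quotient_map)
    show "continuous_map euclidean N q"
      using q by (rule lift_on_UNIV_continuous)
    show "open_map euclidean N q"
      using lift_open_map[OF cov q] by (simp add: open_map_def)
  qed (simp add: surj)
  define K where "K = {g \<in> carrier G. \<forall>x. q (act g x) = q x}"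
  have "subgroup K G"
  proof (rule subgroupI)
    show "K \<noteq> {}"
      unfolding K_def using act_one by auto
    fix g assume "g \<in> K"
    then have "g \<in> carrier G" "\<And>x. q (act g x) = q x"
      by (auto simp: K_def)
    then show "inv g \<in> K"
      by (auto simp: K_def) (metis act_inv(2))
  qed (auto simp: K_def act_mult)
  moreover have "q x = q y \<longleftrightarrow> (\<exists>k\<in>K. y = act k x)" for x y
  proof
    assume "q x = q y"
    moreover have "p (q x) = p (q y) \<longrightarrow> proj x = proj y"
      using qx by simp
    ultimately obtain g where g: "g \<in> carrier G" "y = act g x"
      using proj_eq_iff by auto
    have "q (act g z) = q z" for z
      by (rule lift_unique[OF cov lift_on_act[OF q g(1)] q, of x])
        (use g \<open>q x = q y\<close> in \<open>auto simp: connected_UNIV\<close>)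
    then show "\<exists>k\<in>K. y = act k x"
      using g by (auto simp: K_def)
  qed (auto simp: K_def)
  ultimately show ?thesis
    using quot qx by (auto simp: uniformizes_def)
qed

text \<open>A neighbourhood \<open>B\<close> disjoint from its translates gives an evenly covered set \<open>proj ` B\<close>.
  Its sheets are the images of the translates \<open>act g ` B\<close>, two of which coincide when they
  belong to the same coset of \<open>K\<close>.\<close>

lemma uniformizes_covering:
  assumes K: "subgroup K G" and u: "uniformizes K N p q"
  shows "covering_map N base p" "connected_space N"
proof -
  have quot: "quotient_map euclidean N q" and pq: "\<And>x. p (q x) = proj x"
    and qq: "\<And>x y. q x = q y \<longleftrightarrow> (\<exists>k\<in>K. y = act k x)"
    using u by (auto simp: uniformizes_def)
  have KG: "K \<subseteq> carrier G"
    using K by (rule subgroup.subset)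
  have tN: "topspace N = range q"
    using quotient_imp_surjective_map[OF quot] by simp
  have qc: "continuous_map euclidean N q"
    using quot by (rule quotient_imp_continuous_map)
  show "connected_space N"
    using connectedin_continuous_map_image[OF qc, of UNIV] tN connected_UNIV
    by (simp add: connectedin_topspace[symmetric] connectedin_iff_connected)
  have qo: "openin N (q ` W)" if "open W" for W
  proof -
    have "{x. q x \<in> q ` W} = {y. \<exists>x\<in>W. \<exists>k\<in>K. y = act k x}"
      using qq by (auto simp: image_iff) metis+
    then have "open {x. q x \<in> q ` W}"
      using open_orbit_union[OF that KG] by simp
    moreover have "q ` W \<subseteq> topspace N"
      using tN by auto
    ultimately show ?thesis
      using quot by (auto simp: quotient_map_def)
  qed
  have "p \<circ> q = proj"
    using pq by auto
  then have pc: "continuous_map N base p"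
    using continuous_compose_quotient_map[OF quot] proj_continuous by metis
  have po: "openin base (p ` T)" if "openin N T" for T
  proof -
    have "open {x. q x \<in> T}"
      using qc that by (simp add: continuous_map_def)
    moreover have "p ` T = proj ` {x. q x \<in> T}"
    proof -
      have "T = q ` {x. q x \<in> T}"
        using openin_subset[OF that] tN by auto
      then have "p ` T = p ` q ` {x. q x \<in> T}"
        by simp
      then show ?thesis
        by (simp only: image_image pq)
    qed
    ultimately show ?thesis
      using proj_open by simp
  qed
  have even: "\<exists>U. openin base U \<and> z \<in> U \<and>
        (\<exists>\<V>. \<Union>\<V> = {y \<in> topspace N. p y \<in> U} \<and> pairwise disjnt \<V> \<and>
             (\<forall>V \<in> \<V>. openin N V \<and>
                homeomorphic_map (subtopology N V) (subtopology base U) p))"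
    if z: "z \<in> topspace base" for z
  proof -
    obtain x where x: "z = proj x"
      using z topspace_base by auto
    obtain B where B: "open B" "x \<in> B" "\<And>g y. g \<in> carrier G \<Longrightarrow> y \<in> B \<Longrightarrow> act g y \<in> B \<Longrightarrow> g = \<one>"
      using act_disjoint[of x] by blast
    define S where "S g = q ` act g ` B" for g
    have U: "openin base (proj ` B)"
      by (rule proj_open) fact
    have 1: "\<Union>(S ` carrier G) = {y \<in> topspace N. p y \<in> proj ` B}"
    proof (intro equalityI subsetI)
      fix y assume "y \<in> {y \<in> topspace N. p y \<in> proj ` B}"
      then obtain w b where "y = q w" "b \<in> B" "proj w = proj b"
        using tN pq by auto
      moreover from this(3) obtain g where "g \<in> carrier G" "w = act g b"
        using proj_eq_iff by metis
      ultimately show "y \<in> \<Union>(S ` carrier G)"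
        by (auto simp: S_def)
    qed (auto simp: S_def tN pq)
    have 2: "S g = S h" if gh: "g \<in> carrier G" "h \<in> carrier G" "S g \<inter> S h \<noteq> {}" for g h
    proof -
      obtain b c where bc: "b \<in> B" "c \<in> B" "q (act g b) = q (act h c)"
        using gh(3) by (auto simp: S_def)
      then obtain k where k: "k \<in> K" "act h c = act k (act g b)"
        using qq by blast
      have kG: "k \<in> carrier G"
        using k KG by blast
      have "c = act (inv h \<otimes> k \<otimes> g) b"
        using k gh kG by (metis act_inv(1) act_mult inv_closed m_closed)
      then have "inv h \<otimes> k \<otimes> g = \<one>"
        using B(3)[of "inv h \<otimes> k \<otimes> g" b] bc gh kG by simp
      then have "h = k \<otimes> g"
        using gh kG by (metis inv_closed inv_equality inv_inv m_assoc m_closed)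
      then have "q (act h d) = q (act g d)" for d
        using qq k(1) gh kG by (metis act_mult)
      then show ?thesis
        by (simp add: S_def image_image)
    qed
    have 3: "homeomorphic_map (subtopology N (S g)) (subtopology base (proj ` B)) p"
        if g: "g \<in> carrier G" for g
    proof (rule bijective_open_imp_homeomorphic_map)
      have SN: "openin N (S g)"
        unfolding S_def by (intro qo open_act_image B g)
      have St: "topspace (subtopology N (S g)) = S g"
        using openin_subset[OF SN] by auto
      have pS: "p ` S g = proj ` B"
        using pq g by (auto simp: S_def image_image)
      show "continuous_map (subtopology N (S g)) (subtopology base (proj ` B)) p"
        using pc pS by (auto simp: continuous_map_in_subtopology continuous_map_from_subtopology)
      show "p ` topspace (subtopology N (S g)) = topspace (subtopology base (proj ` B))"
        using St pS topspace_base by auto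
      show "open_map (subtopology N (S g)) (subtopology base (proj ` B)) p"
        unfolding open_map_def
      proof (intro allI impI)
        fix T assume "openin (subtopology N (S g)) T"
        then have T: "openin N T" "T \<subseteq> S g"
          using SN openin_open_subtopology by blast+
        then show "openin (subtopology base (proj ` B)) (p ` T)"
          unfolding openin_open_subtopology[OF U] using po[OF T(1)] image_mono[OF T(2), of p] pS by simp
      qed
      show "inj_on p (topspace (subtopology N (S g)))"
        unfolding St
      proof (rule inj_onI)
        fix y y' assume y: "y \<in> S g" "y' \<in> S g" "p y = p y'"
        then obtain b b' where b: "b \<in> B" "b' \<in> B" "y = q (act g b)" "y' = q (act g b')"
          by (auto simp: S_def)
        then have "proj b = proj b'"
          using y(3) pq g by simp
        then obtain h where "h \<in> carrier G" "b' = act h b"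
          using proj_eq_iff by blast
        then have "b' = b"
          using B(3) b act_one by metis
        then show "y = y'"
          using b by simp
      qed
    qed
    show ?thesis
    proof (intro exI conjI ballI)
      show "openin base (proj ` B)" by fact
      show "z \<in> proj ` B" using x B by blast
      show "\<Union>(S ` carrier G) = {y \<in> topspace N. p y \<in> proj ` B}" by fact
      show "pairwise disjnt (S ` carrier G)"
        unfolding pairwise_def disjnt_def using 2 by blast
      fix V assume "V \<in> S ` carrier G"
      then obtain g where g: "g \<in> carrier G" "V = S g" by blast
      show "openin N V"
        unfolding g(2) S_def by (intro qo open_act_image B g)
      show "homeomorphic_map (subtopology N V) (subtopology base (proj ` B)) p"
        using 3 g by simp
    qed
  qed
  have "p ` topspace N = topspace base"
    using tN pq topspace_base by (auto simp: image_image)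
  then show "covering_map N base p"
    unfolding covering_map_def using pc even by blast
qed

text \<open>The fibre over \<open>proj x\<close> is the image under \<open>q\<close> of the orbit of \<open>x\<close>, and since the action is free
  \<open>q (act g x) = q (act h x)\<close> holds exactly if \<open>g\<close> and \<open>h\<close> lie in the same coset of \<open>K\<close>.\<close>

lemma uniformizes_fibre:
  fixes x :: 'a
  assumes K: "subgroup K G" and u: "uniformizes K N p q"
  defines "F \<equiv> {y \<in> topspace N. p y = proj x}"
  shows "card F = card (rcosets K)" "finite F \<longleftrightarrow> finite (rcosets K)"
proof -
  have tN: "topspace N = range q" and pq: "\<And>x. p (q x) = proj x"
    and qq: "\<And>x y. q x = q y \<longleftrightarrow> (\<exists>k\<in>K. y = act k x)"
    using u quotient_imp_surjective_map[of euclidean N q] by (auto simp: uniformizes_def)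
  have F: "F = (\<lambda>g. q (act g x)) ` carrier G"
  proof (intro equalityI subsetI)
    fix y assume "y \<in> F"
    then obtain w where "y = q w" "proj x = proj w"
      unfolding F_def using tN pq by auto
    then show "y \<in> (\<lambda>g. q (act g x)) ` carrier G"
      using proj_eq_iff by (metis imageI)
  qed (auto simp: F_def tN pq)
  have eq: "q (act g x) = q (act h x) \<longleftrightarrow> K #> g = K #> h"
    if gh: "g \<in> carrier G" "h \<in> carrier G" for g h
  proof -
    have "act h x = act k (act g x) \<longleftrightarrow> h = k \<otimes> g" if "k \<in> K" for k
    proof -
      have kG: "k \<in> carrier G"
        using that K subgroup.subset by blast
      then show ?thesis
        using gh act_free[of h "k \<otimes> g" x] act_mult[of k g x] by auto
    qed
    then show ?thesis
      unfolding qq r_coset_eq_iff[OF K gh] by blast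
  qed
  show "card F = card (rcosets K)" "finite F \<longleftrightarrow> finite (rcosets K)"
    unfolding F rcosets_image
    by (rule matched_images_card[where R = "(=)"]; use eq in blast)+
qed

lemma fold_covering_iff:
  assumes K: "subgroup K G" and u: "uniformizes K N p q"
  shows "fold_covering n N base p \<longleftrightarrow> finite (rcosets K) \<and> card (rcosets K) = n"
  using uniformizes_covering[OF assms] uniformizes_fibre[OF assms]
  by (auto simp: fold_covering_def topspace_base)

lemma uniformizes_shift:
  assumes K: "subgroup K G" and u: "uniformizes K N p q" and g: "g \<in> carrier G"
  shows "uniformizes (conj_sub G (inv g) K) N p (q \<circ> act g)"
  unfolding uniformizes_def
proof (intro conjI allI)
  have "quotient_map euclidean euclidean (act g)"
  proof (rule continuous_open_imp_quotient_map)
    show "continuous_map euclidean euclidean (act g)"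
      using act_continuous[OF g] by simp
    show "open_map euclidean euclidean (act g)"
      using open_act_image[OF _ g] by (simp add: open_map_def)
    show "act g ` topspace euclidean = topspace euclidean"
      using g by (auto intro!: image_eqI[where x = "act (inv g) _"])
  qed
  then show "quotient_map euclidean N (q \<circ> act g)"
    using u quotient_map_compose by (auto simp: uniformizes_def)
  show "p ((q \<circ> act g) x) = proj x" for x
    using u g by (simp add: uniformizes_def)
  show "(q \<circ> act g) x = (q \<circ> act g) y \<longleftrightarrow> (\<exists>k\<in>conj_sub G (inv g) K. y = act k x)" for x y
  proof -
    have "act g y = act k (act g x) \<longleftrightarrow> y = act (inv g \<otimes> k \<otimes> inv (inv g)) x" if "k \<in> K" for k
    proof -
      have kG: "k \<in> carrier G"
        using that K subgroup.subset by blast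
      have "act (inv g \<otimes> k \<otimes> inv (inv g)) x = act (inv g) (act k (act g x))"
        using g kG by (simp add: act_mult)
      then show ?thesis
        using g by (metis act_inv)
    qed
    then show ?thesis
      using u by (auto simp: uniformizes_def conj_sub_eq)
  qed
qed

text \<open>An equivalence of coverings carries one uniformization to another one of the same
  covering, and the latter two differ by an element of \<open>G\<close>.\<close>

lemma covering_equiv_iff:
  assumes K: "subgroup K G" "subgroup K' G"
    and u: "uniformizes K N p q" and u': "uniformizes K' N' p' q'"
  shows "covering_equiv (N, p) (N', p') \<longleftrightarrow> conj_class G K = conj_class G K'"
proof -
  have KG: "K \<subseteq> carrier G" "K' \<subseteq> carrier G"
    using K subgroup.subset by blast+
  show ?thesis
  proof
    assume "covering_equiv (N, p) (N', p')"
    then obtain h where h: "homeomorphic_map N N' h" "\<And>y. y \<in> topspace N \<Longrightarrow> p y = p' (h y)"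
      by (auto simp: covering_equiv_def)
    have tN: "topspace N = range q"
      using u quotient_imp_surjective_map[of euclidean N q] by (simp add: uniformizes_def)
    have inj: "inj_on h (topspace N)"
      using h(1) homeomorphic_eq_everything_map by blast
    have u2: "uniformizes K N' p' (h \<circ> q)"
      unfolding uniformizes_def
    proof (intro conjI allI)
      show "quotient_map euclidean N' (h \<circ> q)"
        using u h(1) by (auto simp: uniformizes_def homeomorphic_map_def intro: quotient_map_compose)
      show "p' ((h \<circ> q) x) = proj x" for x
        using u h(2) tN by (auto simp: uniformizes_def)
      show "(h \<circ> q) x = (h \<circ> q) y \<longleftrightarrow> (\<exists>k\<in>K. y = act k x)" for x y
      proof -
        have "h (q x) = h (q y) \<longleftrightarrow> q x = q y"
          using inj tN by (metis inj_on_eq_iff rangeI)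
        then show ?thesis
          using u by (simp add: uniformizes_def)
      qed
    qed
    have cov: "covering_map N' base p'"
      using uniformizes_covering[OF K(2) u'] by simp
    have "h (q 0) \<in> topspace N'"
      using u2 quotient_imp_surjective_map[of euclidean N' "h \<circ> q"] by (auto simp: uniformizes_def)
    then obtain b where b: "h (q 0) = q' b"
      using u' quotient_imp_surjective_map[of euclidean N' q'] by (force simp: uniformizes_def)
    have "proj 0 = proj b"
      using u2 u' b unfolding uniformizes_def comp_def by metis
    then obtain g where g: "g \<in> carrier G" "b = act g 0"
      using proj_eq_iff by blast
    have l: "lift_on UNIV N' p' proj q''" if "uniformizes L N' p' q''" for L q''
      using that by (auto simp: uniformizes_def lift_on_def continuous_map_def Pi_iff dest!:
        quotient_imp_continuous_map)
    have u3: "uniformizes (conj_sub G (inv g) K') N' p' (q' \<circ> act g)"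
      by (rule uniformizes_shift[OF K(2) u' g(1)])
    have "(h \<circ> q) x = (q' \<circ> act g) x" for x
      by (rule lift_unique[OF cov l[OF u2] l[OF u3], of 0]) (use b g in \<open>auto simp: connected_UNIV\<close>)
    then have "h \<circ> q = q' \<circ> act g"
      by blast
    then have u4: "uniformizes K N' p' (q' \<circ> act g)"
      using u2 by simp
    have "\<forall>x\<in>K. \<exists>k\<in>conj_sub G (inv g) K'. act x 0 = act k 0"
      "\<forall>x\<in>conj_sub G (inv g) K'. \<exists>k\<in>K. act x 0 = act k 0"
      using u3 u4 unfolding uniformizes_def by blast+
    then have "K = conj_sub G (inv g) K'"
      using act_free KG conj_sub_carrier[OF KG(2) inv_closed[OF g(1)]]
      by (intro equalityI subsetI) (metis subsetD)+
    then show "conj_class G K = conj_class G K'"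
      using conj_class_eq_iff KG g by (metis inv_closed)
  next
    assume "conj_class G K = conj_class G K'"
    then obtain g where g: "g \<in> carrier G" "K = conj_sub G g K'"
      using conj_class_eq_iff KG by metis
    have u3: "uniformizes K N' p' (q' \<circ> act (inv g))"
      using uniformizes_shift[OF K(2) u' inv_closed[OF g(1)]] g by simp
    obtain h where h: "homeomorphic_map N N' h" "\<And>x. h (q x) = (q' \<circ> act (inv g)) x"
      using quotient_maps_homeomorphic[of euclidean N q N' "q' \<circ> act (inv g)"] u u3
      unfolding uniformizes_def by auto
    have "topspace N = range q"
      using u quotient_imp_surjective_map[of euclidean N q] by (simp add: uniformizes_def)
    then have "p y = p' (h y)" if "y \<in> topspace N" for y
      using that u u3 h(2) unfolding uniformizes_def by auto
    then show "covering_equiv (N, p) (N', p')"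
      using h(1) by (auto simp: covering_equiv_def)
  qed
qed

lemma uniformizes_homeomorphic:
  assumes K: "subgroup K G" and u: "uniformizes K N p q"
  shows "N homeomorphic_space orbit_space (act ` K)"
proof -
  have "\<exists>h. homeomorphic_map N (orbit_space (act ` K)) h \<and>
      (\<forall>x\<in>topspace euclidean. h (q x) = orbit_of (act ` K) x)"
    using u by (intro quotient_maps_homeomorphic quotient_map_orbit_of)
      (auto simp: uniformizes_def orbit_eq_iff[OF K])
  then show ?thesis
    using homeomorphic_map_imp_homeomorphic_space by blast
qed

text \<open>The embedding carries a representative of each orbit into \<open>'b\<close>, so that type is large enough to
  hold the orbit space.\<close>

lemma uniformizes_exists:
  assumes K: "subgroup K G" and emb: "inj (emb :: 'a \<Rightarrow> 'b)"
  shows "\<exists>(N :: 'b topology) p q. uniformizes K N p q"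
proof -
  define q where "q x = emb (SOME y. y \<in> orbit_of (act ` K) x)" for x
  have some: "(SOME y. y \<in> orbit_of (act ` K) x) \<in> orbit_of (act ` K) x" for x
    by (rule someI[of _ "act \<one> x"]) (use subgroup.one_closed[OF K] in \<open>auto simp: orbit_of_def\<close>)
  have qq: "q x = q y \<longleftrightarrow> (\<exists>k\<in>K. y = act k x)" for x y
    unfolding orbit_eq_iff[OF K, symmetric]
  proof
    assume "q x = q y"
    then have "(SOME z. z \<in> orbit_of (act ` K) x) = (SOME z. z \<in> orbit_of (act ` K) y)"
      using emb by (simp add: q_def inj_eq)
    moreover have "orbit_of (act ` K) z = orbit_of (act ` K) x" if "z \<in> orbit_of (act ` K) x" for x z
    proof -
      have "\<exists>k\<in>K. z = act k x"
        using that by (auto simp: orbit_of_def)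
      then show ?thesis
        using orbit_eq_iff[OF K] by metis
    qed
    ultimately show "orbit_of (act ` K) x = orbit_of (act ` K) y"
      using some by metis
  qed (simp add: q_def)
  obtain N where N: "quotient_map euclidean N q"
    using quotient_map_topology by blast
  define p where "p y = proj (SOME x. q x = y)" for y
  have "p (q x) = proj x" for x
  proof -
    have "q (SOME z. q z = q x) = q x"
      by (rule someI[of "\<lambda>z. q z = q x"]) simp
    then show ?thesis
      unfolding p_def using qq proj_eq_iff subgroup.subset[OF K] by (metis subsetD)
  qed
  then show ?thesis
    using N qq unfolding uniformizes_def by blast
qed

lemma uniformizes_base: "uniformizes {\<one>} euclidean proj id"
  using act_one by (auto simp: uniformizes_def quotient_map_def)

lemma proj_covering: "covering_map euclidean base proj"
  by (rule uniformizes_covering[OF _ uniformizes_base]) (rule triv_subgroup)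

text \<open>A covering is related to the subgroups that uniformize it. The choice of \<open>q\<close> matters only up to
  conjugation, by \<open>covering_equiv_iff\<close>. The predicate \<open>P\<close> is an algebraic criterion for the topological
  type of the total space.\<close>

theorem covering_classes_card:
  fixes X :: "'c topology"
  assumes emb: "inj (emb :: 'a \<Rightarrow> 'b)"
    and P: "\<And>K. subgroup K G \<Longrightarrow> finite (rcosets K) \<Longrightarrow> card (rcosets K) = n \<Longrightarrow>
      orbit_space (act ` K) homeomorphic_space X \<longleftrightarrow> P K"
  defines "D \<equiv> {K. subgroup K G \<and> finite (rcosets K) \<and> card (rcosets K) = n \<and> P K}"
    and "Q \<equiv> covering_classes n X base :: ('b topology \<times> ('b \<Rightarrow> 'a set)) set set"
  shows "card Q = card (conj_class G ` D)" "finite Q \<longleftrightarrow> finite (conj_class G ` D)"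
proof -
  define C where "C = {(N :: 'b topology, p). fold_covering n N base p \<and> N homeomorphic_space X}"
  define E where "E = {(c1, c2). c1 \<in> C \<and> c2 \<in> C \<and> covering_equiv c1 c2}"
  define R where "R c K \<longleftrightarrow> (\<exists>q. uniformizes K (fst c) (snd c) q)"
    for c :: "'b topology \<times> ('b \<Rightarrow> 'a set)" and K
  have cc: "Q = (\<lambda>c. E `` {c}) ` C"
    unfolding Q_def covering_classes_def C_def[symmetric] Let_def E_def[symmetric] quotient_def by auto
  have hom: "N homeomorphic_space X \<longleftrightarrow> orbit_space (act ` K) homeomorphic_space X"
    if "subgroup K G" "uniformizes K N p q" for N :: "'b topology" and p K q
  proof -
    have "N homeomorphic_space orbit_space (act ` K)"
      using that by (rule uniformizes_homeomorphic)
    then show ?thesis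
      by (metis homeomorphic_space_sym homeomorphic_space_trans)
  qed
  have 1: "\<exists>K\<in>D. R c K" if c: "c \<in> C" for c
  proof -
    obtain N p where Np: "c = (N, p)" "fold_covering n N base p" "N homeomorphic_space X"
      using c by (auto simp: C_def)
    then obtain K q where K: "subgroup K G" "uniformizes K N p q"
      using covering_uniformized[of N p] by (auto simp: fold_covering_def)
    then show ?thesis
      using Np fold_covering_iff[OF K] hom[OF K] P[OF K(1)] by (auto simp: R_def D_def)
  qed
  have 2: "\<exists>c\<in>C. R c K" if K: "K \<in> D" for K
  proof -
    have sK: "subgroup K G"
      using K by (simp add: D_def)
    obtain N :: "'b topology" and p q where u: "uniformizes K N p q"
      using uniformizes_exists[OF sK emb] by blast
    have "fold_covering n N base p" "N homeomorphic_space X"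
      using K fold_covering_iff[OF sK u] hom[OF sK u] P[OF sK] by (auto simp: D_def)
    then show ?thesis
      using u by (intro bexI[of _ "(N, p)"]) (auto simp: R_def C_def)
  qed
  have equiv: "covering_equiv c c' \<longleftrightarrow> conj_class G K = conj_class G K'"
    if "c \<in> C" "c' \<in> C" "K \<in> D" "K' \<in> D" "R c K" "R c' K'" for c c' K K'
  proof -
    obtain q q' where "uniformizes K (fst c) (snd c) q" "uniformizes K' (fst c') (snd c') q'"
      using \<open>R c K\<close> \<open>R c' K'\<close> by (auto simp: R_def)
    moreover have "subgroup K G" "subgroup K' G"
      using that by (auto simp: D_def)
    ultimately show ?thesis
      using covering_equiv_iff[of K K' "fst c" "snd c" q "fst c'" "snd c'" q'] by simp
  qed
  have 3: "E `` {c} = E `` {c'} \<longleftrightarrow> conj_class G K = conj_class G K'"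
    if cK: "c \<in> C" "c' \<in> C" "K \<in> D" "K' \<in> D" "R c K" "R c' K'" for c c' K K'
  proof -
    have E: "E `` {d} = {e \<in> C. covering_equiv d e}" if "d \<in> C" for d
      using that by (auto simp: E_def)
    show ?thesis
    proof
      assume "E `` {c} = E `` {c'}"
      moreover have "c' \<in> E `` {c'}"
        using E[OF cK(2)] cK equiv[of c' c' K' K'] by auto
      ultimately show "conj_class G K = conj_class G K'"
        using E[OF cK(1)] equiv cK by blast
    next
      assume eq: "conj_class G K = conj_class G K'"
      have "covering_equiv c e \<longleftrightarrow> covering_equiv c' e" if e: "e \<in> C" for e
      proof -
        obtain L where "L \<in> D" "R e L"
          using 1[OF e] by blast
        then show ?thesis
          using equiv[OF cK(1) e cK(3)] equiv[OF cK(2) e cK(4)] cK eq by auto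
      qed
      then show "E `` {c} = E `` {c'}"
        using E cK by auto
    qed
  qed
  show "card Q = card (conj_class G ` D)" "finite Q \<longleftrightarrow> finite (conj_class G ` D)"
    unfolding cc by (rule matched_images_card[where R = R]; (rule 1 2 3; assumption))+
qed

end

text \<open>A homeomorphism between orbit spaces lifts to a map \<open>F\<close> of the spaces above them that
  intertwines the actions. A lift of the inverse is a left inverse of \<open>F\<close>, so \<open>F\<close> is injective and
  commutators that vanish in \<open>G'\<close> already vanish in \<open>G\<close>.\<close>

lemma homeomorphic_orbit_spaces_commute:
  fixes act :: "'g \<Rightarrow> 'a::real_normed_vector \<Rightarrow> 'a" and act' :: "'h \<Rightarrow> 'b::real_normed_vector \<Rightarrow> 'b"
  assumes "free_action G act" "free_action G' act'"
    and homeo: "orbit_space (act ` carrier G) homeomorphic_space orbit_space (act' ` carrier G')"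
    and comm: "\<And>x y. x \<in> carrier G' \<Longrightarrow> y \<in> carrier G' \<Longrightarrow> x \<otimes>\<^bsub>G'\<^esub> y = y \<otimes>\<^bsub>G'\<^esub> x"
    and gh: "g \<in> carrier G" "h \<in> carrier G"
  shows "g \<otimes>\<^bsub>G\<^esub> h = h \<otimes>\<^bsub>G\<^esub> g"
proof -
  interpret A: free_action G act by fact
  interpret B: free_action G' act' by fact
  obtain i j where ij: "homeomorphic_maps A.base B.base i j"
    using homeo by (auto simp: homeomorphic_space_def)
  have ci: "continuous_map A.base B.base i" and cj: "continuous_map B.base A.base j"
    and ji: "\<And>x. j (i (A.proj x)) = A.proj x"
    using ij by (auto simp: homeomorphic_maps_def A.topspace_base)
  define f where "f = i \<circ> A.proj"
  have cf: "continuous_map euclidean B.base f"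
    unfolding f_def by (rule continuous_map_compose[OF A.proj_continuous ci])
  have "f 0 \<in> topspace B.base"
    using cf by (auto simp: continuous_map_def)
  then obtain b where "B.proj b = f 0"
    using B.topspace_base by auto
  then obtain F where F: "lift_on UNIV euclidean B.proj f F"
    using lift_exists[OF B.proj_covering cf, of b 0] by auto
  then have pF: "B.proj (F x) = i (A.proj x)" for x
    by (auto simp: lift_on_def f_def)
  have F_cont: "open {x. F x \<in> U}" if "open U" for U
    using F that by (simp add: lift_on_def)
  have cj': "continuous_map euclidean A.base (j \<circ> B.proj)"
    by (rule continuous_map_compose[OF B.proj_continuous cj])
  have "A.proj 0 = (j \<circ> B.proj) (F 0)"
    using pF ji by simp
  then obtain F' where F': "lift_on UNIV euclidean A.proj (j \<circ> B.proj) F'" "F' (F 0) = 0"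
    using lift_exists[OF A.proj_covering cj', of 0 "F 0"] by auto
  have FF: "F' (F x) = x" for x
  proof -
    have 1: "lift_on UNIV euclidean A.proj A.proj (\<lambda>x. F' (F x))"
      unfolding lift_on_def
    proof (intro conjI allI impI ballI)
      show "A.proj (F' (F x)) = A.proj x" for x
        using F' pF ji by (simp add: lift_on_def)
      fix U :: "'a set" assume "openin euclidean U"
      then have "open {x. F' x \<in> U}"
        using F' by (auto simp: lift_on_def)
      then show "open {x \<in> UNIV. F' (F x) \<in> U}"
        using F_cont[of "{x. F' x \<in> U}"] by simp
    qed auto
    have 2: "lift_on UNIV euclidean A.proj A.proj (\<lambda>x. x)"
      by (auto simp: lift_on_def)
    show ?thesis
      by (rule lift_unique[OF A.proj_covering 1 2, of 0]) (use F' in \<open>auto simp: connected_UNIV\<close>)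
  qed
  have ex: "\<exists>k\<in>carrier G'. \<forall>x. F (act g x) = act' k (F x)" if g: "g \<in> carrier G" for g
  proof -
    have "B.proj (F 0) = B.proj (F (act g 0))"
      using pF g by simp
    then obtain k where k: "k \<in> carrier G'" "F (act g 0) = act' k (F 0)"
      using B.proj_eq_iff by blast
    have 1: "lift_on UNIV euclidean B.proj f (\<lambda>x. F (act g x))"
      by (rule A.lift_on_act[OF F g]) (use g in \<open>simp add: f_def\<close>)
    have 2: "lift_on UNIV euclidean B.proj f (\<lambda>x. act' k (F x))"
      unfolding lift_on_def
    proof (intro conjI allI impI ballI)
      show "B.proj (act' k (F x)) = f x" for x
        using F k by (simp add: lift_on_def)
      fix U :: "'b set" assume "openin euclidean U"
      then have "open (act' k -` U)"
        using open_vimage[OF _ B.act_continuous[OF k(1)]] by simp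
      then show "open {x \<in> UNIV. act' k (F x) \<in> U}"
        using F_cont[of "act' k -` U"] by simp
    qed auto
    have "F (act g x) = act' k (F x)" for x
      by (rule lift_unique[OF B.proj_covering 1 2, of 0]) (use k in \<open>auto simp: connected_UNIV\<close>)
    then show ?thesis
      using k by blast
  qed
  obtain k l where kl: "k \<in> carrier G'" "l \<in> carrier G'" "\<And>x. F (act g x) = act' k (F x)"
    "\<And>x. F (act h x) = act' l (F x)"
    using ex gh by metis
  have "F (act (g \<otimes>\<^bsub>G\<^esub> h) 0) = act' (k \<otimes>\<^bsub>G'\<^esub> l) (F 0)"
    using kl gh by (simp add: A.act_mult B.act_mult)
  also have "\<dots> = F (act (h \<otimes>\<^bsub>G\<^esub> g) 0)"
    using kl gh comm[of k l] by (simp add: A.act_mult B.act_mult)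
  finally have "act (g \<otimes>\<^bsub>G\<^esub> h) 0 = act (h \<otimes>\<^bsub>G\<^esub> g) 0"
    using FF by metis
  then show ?thesis
    using gh by (intro A.act_free[of _ _ 0]) auto
qed

section \<open>The group of the manifold \<open>\<G>\<^sub>2\<close> and its subgroups of finite index\<close>

subsection \<open>Normal forms\<close>

definition sgn_par :: "int \<Rightarrow> int" where
  "sgn_par c = (if even c then 1 else - 1)"

lemma sgn_par_simps [simp]:
  "sgn_par 0 = 1" "sgn_par 1 = - 1" "sgn_par (- 1) = - 1" "sgn_par (- c) = sgn_par c"
  "sgn_par (c + d) = sgn_par c * sgn_par d" "sgn_par (c - d) = sgn_par c * sgn_par d"
  "sgn_par c * sgn_par c = 1" "sgn_par c * (sgn_par c * x) = x"
  by (auto simp: sgn_par_def)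

lemma sgn_par_cases: "sgn_par c = 1 \<or> sgn_par c = - 1"
  by (simp add: sgn_par_def)

text \<open>The triple \<open>(a, b, c)\<close> stands for the element \<open>x\<^sup>a y\<^sup>b z\<^sup>c\<close>.\<close>

definition screw_group :: "(int \<times> int \<times> int) monoid" where
  "screw_group = \<lparr>carrier = UNIV,
     monoid.mult = (\<lambda>(a, b, c) (a', b', c'). (a + sgn_par c * a', b + sgn_par c * b', c + c')),
     one = (0, 0, 0)\<rparr>"

abbreviation screw_times (infixl "\<star>" 70) where
  "x \<star> y \<equiv> x \<otimes>\<^bsub>screw_group\<^esub> y"

lemma screw_carrier [simp]: "carrier screw_group = UNIV"
  and screw_mult [simp]: "(a, b, c) \<star> (a', b', c') =
    (a + sgn_par c * a', b + sgn_par c * b', c + c')"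
  and screw_one: "\<one>\<^bsub>screw_group\<^esub> = (0, 0, 0)"
  by (simp_all add: screw_group_def)

lemma group_screw: "group screw_group"
proof (rule groupI)
  fix x y z
  show "x \<star> y \<star> z = x \<star> (y \<star> z)"
    by (cases x; cases y; cases z) (simp add: algebra_simps)
  show "\<one>\<^bsub>screw_group\<^esub> \<star> x = x"
    by (cases x) (simp add: screw_one)
  obtain a b c where "x = (a, b, c)"
    by (cases x)
  then have "(- sgn_par c * a, - sgn_par c * b, - c) \<star> x = \<one>\<^bsub>screw_group\<^esub>"
    by (simp add: screw_one)
  then show "\<exists>y\<in>carrier screw_group. y \<star> x = \<one>\<^bsub>screw_group\<^esub>"
    by (metis UNIV_I screw_carrier)
qed simp_all

interpretation E: group screw_group
  by (rule group_screw)

lemma screw_inv [simp]: "inv\<^bsub>screw_group\<^esub> (a, b, c) = (- sgn_par c * a, - sgn_par c * b, - c)"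
  by (rule E.inv_equality) (simp_all add: screw_one)

lemma pi1_G1_simps [simp]:
  "carrier pi1_G1 = UNIV"
  "(a, b, c) \<otimes>\<^bsub>pi1_G1\<^esub> (a', b', c') = (a + a', b + b', c + c')"
  "\<one>\<^bsub>pi1_G1\<^esub> = (0, 0, 0)"
  by (auto simp: pi1_G1_def DirProd_def integer_group_def)

lemma group_pi1_G1: "group pi1_G1"
  unfolding pi1_G1_def by (intro DirProd_group group_integer_group)

subsection \<open>The presentation\<close>

lemma word_class_eq_iff: "word_class R u = word_class R v \<longleftrightarrow> word_eq R u v"
  unfolding word_class_def using word_eq.refl word_eq.sym word_eq.trans by blast

lemma presented_mult:
  "word_class R u \<otimes>\<^bsub>presented_group R\<^esub> word_class R v = word_class R (u @ v)"
proof -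
  have "word_class R (u' @ v') = word_class R (u @ v)" if "u' \<in> word_class R u"
      "v' \<in> word_class R v" for u' v'
    unfolding word_class_eq_iff using that by (simp add: word_class_def word_eq.append word_eq.sym)
  moreover have "u \<in> word_class R u" "v \<in> word_class R v"
    by (simp_all add: word_class_def word_eq.refl)
  ultimately have "(\<Union>u'\<in>word_class R u. \<Union>v'\<in>word_class R v. word_class R (u' @ v')) =
    word_class R (u @ v)"
    by blast
  then show ?thesis
    by (simp add: presented_group_def)
qed

lemma presented_one: "\<one>\<^bsub>presented_group R\<^esub> = word_class R []"
  and presented_carrier: "carrier (presented_group R) = range (word_class R)"
  by (simp_all add: presented_group_def)

text \<open>The inverse of a word is spelled backwards with inverted letters.\<close>

lemma presented_inverse:
  "word_class R (map (\<lambda>(g, b). (g, \<not> b)) (rev u)) \<otimes>\<^bsub>presented_group R\<^esub> word_class R u = word_class R []"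
proof (induction u)
  case (Cons l u)
  obtain g b where l: "l = (g, b)" by (cases l)
  have "word_eq R [(g, \<not> b), (g, b)] []"
    using word_eq.cancel[of R g "\<not> b"] by simp
  then have "word_eq R (([(g, \<not> b), (g, b)]) @ u) ([] @ u)"
    by (intro word_eq.append word_eq.refl)
  then have "word_eq R (map (\<lambda>(g, b). (g, \<not> b)) (rev u) @ ([(g, \<not> b), (g, b)] @ u))
      (map (\<lambda>(g, b). (g, \<not> b)) (rev u) @ ([] @ u))"
    by (rule word_eq.append[OF word_eq.refl])
  then show ?case
    using Cons.IH l by (simp add: presented_mult word_class_eq_iff) (meson word_eq.trans)
qed (simp add: presented_mult)

lemma group_presented: "group (presented_group R)"
proof (rule groupI)
  fix x y z assume "x \<in> carrier (presented_group R)" "y \<in> carrier (presented_group R)"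
    "z \<in> carrier (presented_group R)"
  then show "x \<otimes>\<^bsub>presented_group R\<^esub> y \<otimes>\<^bsub>presented_group R\<^esub> z =
      x \<otimes>\<^bsub>presented_group R\<^esub> (y \<otimes>\<^bsub>presented_group R\<^esub> z)"
    by (auto simp: presented_carrier presented_mult)
next
  fix x assume "x \<in> carrier (presented_group R)"
  then show "\<exists>y\<in>carrier (presented_group R). y \<otimes>\<^bsub>presented_group R\<^esub> x = \<one>\<^bsub>presented_group R\<^esub>"
    using presented_inverse by (fastforce simp: presented_carrier presented_one)
qed (auto simp: presented_carrier presented_mult presented_one)

fun letter_val :: "gen \<times> bool \<Rightarrow> int \<times> int \<times> int" where
  "letter_val (g, b) = (let e = (if b then 1 else - 1) in
     case g of GX \<Rightarrow> (e, 0, 0) | GY \<Rightarrow> (0, e, 0) | GZ \<Rightarrow> (0, 0, e))"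

fun word_val :: "gen word \<Rightarrow> int \<times> int \<times> int" where
  "word_val [] = (0, 0, 0)"
| "word_val (l # u) = letter_val l \<star> word_val u"

lemma word_val_append: "word_val (u @ v) = word_val u \<star> word_val v"
proof (induction u)
  case Nil
  then show ?case
    using E.l_one[of "word_val v"] by (simp add: screw_one)
next
  case (Cons l u)
  then show ?case
    using E.m_assoc[of "letter_val l" "word_val u" "word_val v"] by simp
qed

lemma word_eq_val: "word_eq relators_G2 u v \<Longrightarrow> word_val u = word_val v"
proof (induction rule: word_eq.induct)
  case (cancel g b)
  then show ?case by (cases g; cases b) simp_all
next
  case (relator r)
  then show ?case by (auto simp: relators_G2_def)
qed (simp_all add: word_val_append)

lemma word_val_replicate:
  "word_val (replicate n (GX, b)) = ((if b then int n else - int n), 0, 0)"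
  "word_val (replicate n (GY, b)) = (0, (if b then int n else - int n), 0)"
  "word_val (replicate n (GZ, b)) = (0, 0, (if b then int n else - int n))"
  by (induction n; simp)+

lemma word_val_surj: "\<exists>u. word_val u = x"
proof -
  obtain a b c where x: "x = (a, b, c)" by (cases x)
  have "word_val (replicate (nat \<bar>a\<bar>) (GX, 0 \<le> a) @ replicate (nat \<bar>b\<bar>) (GY, 0 \<le> b) @
      replicate (nat \<bar>c\<bar>) (GZ, 0 \<le> c)) = x"
    by (simp add: word_val_append word_val_replicate x)
  then show ?thesis ..
qed

text \<open>Read as \<open>z \<otimes> x \<otimes> inv z = y\<close>, the hypothesis is preserved by powers because conjugation is a
  homomorphism.\<close>

lemma (in group) conjugation_int_pow:
  assumes "z \<in> carrier G" "x \<in> carrier G" "y \<in> carrier G" and zx: "z \<otimes> x = y \<otimes> z"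
  shows "z \<otimes> x [^] (a::int) = y [^] a \<otimes> z"
proof -
  have "(\<lambda>x. z \<otimes> x \<otimes> inv z) \<in> hom G G"
  proof (rule homI)
    have "inv z \<otimes> (z \<otimes> w) = w" if "w \<in> carrier G" for w
      using that assms(1) by (simp add: m_assoc[symmetric])
    then show "z \<otimes> (x \<otimes> y) \<otimes> inv z = z \<otimes> x \<otimes> inv z \<otimes> (z \<otimes> y \<otimes> inv z)"
      if "x \<in> carrier G" "y \<in> carrier G" for x y
      using that assms(1) by (simp add: m_assoc)
  qed (use assms(1) in simp)
  then have "(z \<otimes> x \<otimes> inv z) [^] a = z \<otimes> x [^] a \<otimes> inv z"
    by (rule hom_int_pow[OF _ assms(2) is_group is_group, symmetric])
  moreover have "z \<otimes> x \<otimes> inv z = y"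
    using assms by (simp add: m_assoc)
  ultimately show ?thesis
    using assms by (metis inv_solve_right int_pow_closed m_closed inv_closed)
qed

text \<open>These identities say how multiplication by a generator acts on normal forms.\<close>

lemma (in group) normal_form_mult:
  assumes XYZ [simp]: "X \<in> carrier G" "Y \<in> carrier G" "Z \<in> carrier G"
    and YX: "Y \<otimes> X = X \<otimes> Y" and ZX: "Z \<otimes> X = inv X \<otimes> Z" and ZY: "Z \<otimes> Y = inv Y \<otimes> Z"
  defines "\<psi> \<equiv> \<lambda>(a::int, b::int, c::int). X [^] a \<otimes> (Y [^] b \<otimes> Z [^] c)"
  shows "\<psi> (e + a, b, c) = X [^] e \<otimes> \<psi> (a, b, c)"
    and "\<psi> (a, e + b, c) = Y [^] e \<otimes> \<psi> (a, b, c)"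
    and "e = 1 \<or> e = - 1 \<Longrightarrow> \<psi> (- a, - b, e + c) = Z [^] e \<otimes> \<psi> (a, b, c)"
proof -
  show psi_X: "\<psi> (e + a, b, c) = X [^] e \<otimes> \<psi> (a, b, c)" for e a b c
    by (simp add: \<psi>_def int_pow_mult m_assoc)
  show psi_Y: "\<psi> (a, e + b, c) = Y [^] e \<otimes> \<psi> (a, b, c)" for e a b c
  proof -
    have "X \<otimes> Y [^] e = Y [^] e \<otimes> X"
      by (rule conjugation_int_pow) (simp_all add: YX)
    then have "Y [^] e \<otimes> X [^] a = X [^] a \<otimes> Y [^] e"
      by (intro conjugation_int_pow) simp_all
    then show ?thesis
      by (simp add: \<psi>_def int_pow_mult m_assoc[symmetric])
  qed
  show psi_Z: "\<psi> (- a, - b, e + c) = Z [^] e \<otimes> \<psi> (a, b, c)" if e: "e = 1 \<or> e = - 1" for e a b c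
  proof -
    have 1: "Z [^] e \<otimes> W [^] n = W [^] (- n) \<otimes> Z [^] e"
      if W: "W \<in> carrier G" "Z \<otimes> W = inv W \<otimes> Z" for W and n :: int
    proof -
      have pos: "Z \<otimes> W [^] n = W [^] (- n) \<otimes> Z" for n :: int
        using conjugation_int_pow[OF _ W(1) inv_closed[OF W(1)] W(2), of n] W(1)
        by (simp add: int_pow_neg int_pow_inv)
      have "inv Z \<otimes> W [^] n = W [^] (- n) \<otimes> inv Z"
      proof -
        have "Z \<otimes> (W [^] (- n) \<otimes> inv Z) = W [^] n \<otimes> Z \<otimes> inv Z"
          using pos[of "- n"] W(1) by (simp add: m_assoc[symmetric])
        also have "\<dots> = W [^] n"
          using W(1) by (simp add: m_assoc)
        finally show ?thesis
          using W(1) inv_solve_left by (metis int_pow_closed inv_closed m_closed XYZ(3))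
      qed
      then show ?thesis
        using e pos by (auto simp: int_pow_neg)
    qed
    have "Z [^] e \<otimes> \<psi> (a, b, c) =
        (Z [^] e \<otimes> X [^] a) \<otimes> (Y [^] b \<otimes> Z [^] c)"
      by (simp add: \<psi>_def m_assoc)
    also have "\<dots> = X [^] (- a) \<otimes> ((Z [^] e \<otimes> Y [^] b) \<otimes> Z [^] c)"
      unfolding 1[OF _ ZX, simplified] by (simp add: m_assoc)
    also have "\<dots> = \<psi> (- a, - b, e + c)"
      unfolding 1[OF _ ZY, simplified] by (simp add: \<psi>_def int_pow_mult m_assoc)
    finally show ?thesis by simp
  qed
qed

text \<open>Every word can be brought to the normal form \<open>x\<^sup>a y\<^sup>b z\<^sup>c\<close>, so words with the
  same value are equal in the presented group.\<close>

lemma word_val_determines: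
  assumes "word_val u = word_val v"
  shows "word_eq relators_G2 u v"
proof -
  interpret P: group pi1_G2
    unfolding pi1_G2_def by (rule group_presented)
  define cl where "cl = word_class relators_G2"
  have clm: "cl u \<otimes>\<^bsub>pi1_G2\<^esub> cl v = cl (u @ v)" for u v
    by (simp add: cl_def pi1_G2_def presented_mult)
  have clc [simp]: "cl u \<in> carrier pi1_G2" for u
    by (simp add: cl_def pi1_G2_def presented_carrier)
  have cl1: "cl [] = \<one>\<^bsub>pi1_G2\<^esub>"
    by (simp add: cl_def pi1_G2_def presented_one)
  have clinv: "cl [(g, False)] = inv\<^bsub>pi1_G2\<^esub> cl [(g, True)]" for g
  proof -
    have "cl [(g, False), (g, True)] = cl []"
      unfolding cl_def word_class_eq_iff using word_eq.cancel[of relators_G2 g False] by simp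
    then have "cl [(g, False)] \<otimes>\<^bsub>pi1_G2\<^esub> cl [(g, True)] = \<one>\<^bsub>pi1_G2\<^esub>"
      by (simp add: clm cl1)
    then show ?thesis
      using P.inv_equality by simp
  qed
  have rel: "r \<in> relators_G2 \<Longrightarrow> cl r = \<one>\<^bsub>pi1_G2\<^esub>" for r
    unfolding cl1[symmetric] cl_def word_class_eq_iff by (rule word_eq.relator)
  define X Y Z where "X = cl [(GX, True)]" and "Y = cl [(GY, True)]" and "Z = cl [(GZ, True)]"
  have XYZ [simp]: "X \<in> carrier pi1_G2" "Y \<in> carrier pi1_G2" "Z \<in> carrier pi1_G2"
    by (simp_all add: X_def Y_def Z_def)
  have "X \<otimes>\<^bsub>pi1_G2\<^esub> (Y \<otimes>\<^bsub>pi1_G2\<^esub> (inv\<^bsub>pi1_G2\<^esub> X \<otimes>\<^bsub>pi1_G2\<^esub> inv\<^bsub>pi1_G2\<^esub> Y)) = \<one>\<^bsub>pi1_G2\<^esub>"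
    using rel[of "[(GX, True), (GY, True), (GX, False), (GY, False)]"]
    by (simp add: X_def Y_def clinv[symmetric] clm relators_G2_def)
  then have YX: "Y \<otimes>\<^bsub>pi1_G2\<^esub> X = X \<otimes>\<^bsub>pi1_G2\<^esub> Y"
    by (metis P.inv_closed P.inv_equality P.inv_inv P.inv_mult_group P.m_assoc P.m_closed
        XYZ(1) XYZ(2))
  have "Z \<otimes>\<^bsub>pi1_G2\<^esub> (X \<otimes>\<^bsub>pi1_G2\<^esub> (inv\<^bsub>pi1_G2\<^esub> Z \<otimes>\<^bsub>pi1_G2\<^esub> X)) = \<one>\<^bsub>pi1_G2\<^esub>"
    using rel[of "[(GZ, True), (GX, True), (GZ, False), (GX, True)]"]
    by (simp add: X_def Z_def clinv[symmetric] clm relators_G2_def)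
  then have ZX: "Z \<otimes>\<^bsub>pi1_G2\<^esub> X = inv\<^bsub>pi1_G2\<^esub> X \<otimes>\<^bsub>pi1_G2\<^esub> Z"
    by (metis P.inv_closed P.inv_equality P.inv_inv P.inv_mult_group P.m_assoc P.m_closed
        XYZ(1) XYZ(3))
  have "Z \<otimes>\<^bsub>pi1_G2\<^esub> (Y \<otimes>\<^bsub>pi1_G2\<^esub> (inv\<^bsub>pi1_G2\<^esub> Z \<otimes>\<^bsub>pi1_G2\<^esub> Y)) = \<one>\<^bsub>pi1_G2\<^esub>"
    using rel[of "[(GZ, True), (GY, True), (GZ, False), (GY, True)]"]
    by (simp add: Y_def Z_def clinv[symmetric] clm relators_G2_def)
  then have ZY: "Z \<otimes>\<^bsub>pi1_G2\<^esub> Y = inv\<^bsub>pi1_G2\<^esub> Y \<otimes>\<^bsub>pi1_G2\<^esub> Z"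
    by (metis P.inv_closed P.inv_equality P.inv_inv P.inv_mult_group P.m_assoc P.m_closed
        XYZ(2) XYZ(3))
  define \<psi> where "\<psi> = (\<lambda>(a::int, b::int, c::int). X [^]\<^bsub>pi1_G2\<^esub> a \<otimes>\<^bsub>pi1_G2\<^esub>
    (Y [^]\<^bsub>pi1_G2\<^esub> b \<otimes>\<^bsub>pi1_G2\<^esub> Z [^]\<^bsub>pi1_G2\<^esub> c))"
  note psi_mult = P.normal_form_mult[of X Y Z, folded \<psi>_def, OF _ _ _ YX ZX ZY]
  have psi: "\<psi> (word_val u) = cl u" for u
  proof (induction u)
    case Nil
    then show ?case by (simp add: \<psi>_def cl1)
  next
    case (Cons l u)
    obtain g t where l: "l = (g, t)" by (cases l)
    obtain a b c where abc: "word_val u = (a, b, c)" by (cases "word_val u")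
    define e :: int where "e = (if t then 1 else - 1)"
    have e: "e = 1 \<or> e = - 1" by (simp add: e_def)
    have lt: "cl [(g, t)] = cl [(g, True)] [^]\<^bsub>pi1_G2\<^esub> e"
      by (simp add: e_def clinv P.int_pow_neg)
    have "cl (l # u) = cl [(g, True)] [^]\<^bsub>pi1_G2\<^esub> e \<otimes>\<^bsub>pi1_G2\<^esub> \<psi> (a, b, c)"
      using Cons.IH abc lt clm[of "[l]" u] l by simp
    also have "\<dots> = \<psi> (letter_val l \<star> (a, b, c))"
      using psi_mult(1)[of e a b c] psi_mult(2)[of a e b c] psi_mult(3)[OF _ _ _ e, of a b c] e
      by (cases g) (auto simp: l e_def[symmetric] X_def[symmetric] Y_def[symmetric] Z_def[symmetric]
        sgn_par_def)
    finally show ?case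
      using abc by simp
  qed
  have "cl u = cl v"
    using psi[of u] psi[of v] assms by simp
  then show ?thesis
    by (simp only: cl_def word_class_eq_iff)
qed

lemma screw_iso_pi1_G2: "\<exists>\<phi>. \<phi> \<in> iso screw_group pi1_G2"
proof -
  define w where "w x = (SOME u. word_val u = x)" for x
  have w: "word_val (w x) = x" for x
    using someI_ex[OF word_val_surj[of x]] by (simp only: w_def)
  define \<phi> where "\<phi> x = word_class relators_G2 (w x)" for x
  have eq: "word_class relators_G2 u = word_class relators_G2 v \<longleftrightarrow> word_val u = word_val v" for u v
    unfolding word_class_eq_iff using word_val_determines word_eq_val by (rule iffI[rotated])
  have "\<phi> \<in> hom screw_group pi1_G2"
  proof (rule homI)
    show "\<phi> x \<in> carrier pi1_G2" for x
      by (simp add: \<phi>_def pi1_G2_def presented_carrier)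
    show "\<phi> (x \<star> y) = \<phi> x \<otimes>\<^bsub>pi1_G2\<^esub> \<phi> y" for x y
      unfolding \<phi>_def pi1_G2_def presented_mult eq by (simp only: w word_val_append)
  qed
  moreover have "inj \<phi>"
    by (rule injI) (simp only: \<phi>_def eq w)
  moreover have "range \<phi> = carrier pi1_G2"
  proof -
    have "word_class relators_G2 u = \<phi> (word_val u)" for u
      by (simp only: \<phi>_def eq w)
    then show ?thesis
      by (auto simp: pi1_G2_def presented_carrier \<phi>_def)
  qed
  ultimately have "\<phi> \<in> iso screw_group pi1_G2"
    by (simp add: iso_def bij_betw_def)
  then show ?thesis by (rule exI[of _ \<phi>])
qed

subsection \<open>Parametrization of the subgroups of finite index\<close>

text \<open>The sublattice of \<open>\<int>\<^sup>2\<close> with basis \<open>(d1, s), (0, d2)\<close>, that is, in Hermite normal form when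
  \<open>0 \<le> s < d2\<close>.\<close>

definition lat :: "int \<Rightarrow> int \<Rightarrow> int \<Rightarrow> (int \<times> int) set" where
  "lat d1 d2 s = {(i * d1, i * s + l * d2) | i l. True}"

text \<open>The exponent of \<open>(u1, u2)\<close> in the power \<open>(u1, u2, k)\<^sup>j\<close>: for odd \<open>k\<close> the square of
  \<open>(u1, u2, k)\<close> is \<open>(0, 0, 2 * k)\<close>.\<close>

definition twist :: "int \<Rightarrow> int \<Rightarrow> int" where
  "twist k j = (if even k then j else j mod 2)"

text \<open>The image of \<open>(i, l, j)\<close> is the product of \<open>(i * d1, i * s + l * d2, 0)\<close> and the \<open>j\<close>-th power of
  \<open>(u1, u2, k)\<close>. For odd \<open>k\<close> this is an embedding of \<open>screw_group\<close> into itself, for even \<open>k\<close> one of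
  \<open>\<int>\<^sup>3\<close>.\<close>

definition sub_param :: "int \<Rightarrow> int \<Rightarrow> int \<Rightarrow> int \<Rightarrow> int \<times> int \<Rightarrow> int \<times> int \<times> int \<Rightarrow> int \<times> int \<times> int" where
  "sub_param k d1 d2 s = (\<lambda>(u1, u2) (i, l, j).
     (i * d1 + twist k j * u1, i * s + l * d2 + twist k j * u2, k * j))"

definition sub :: "int \<Rightarrow> int \<Rightarrow> int \<Rightarrow> int \<Rightarrow> int \<times> int \<Rightarrow> (int \<times> int \<times> int) set" where
  "sub k d1 d2 s u = range (sub_param k d1 d2 s u)"

lemma twist_0 [simp]: "twist k 0 = 0" and twist_1 [simp]: "twist k 1 = 1"
  by (simp_all add: twist_def)

lemma twist_add: "twist k (j + j') = twist k j + sgn_par (k * j) * twist k j'"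
proof -
  have "(j + j') mod 2 = j mod 2 + (if even j then 1 else - 1) * (j' mod 2)"
    by (cases "even j"; cases "even j'") (auto simp: mod_2_eq_odd)
  then show ?thesis
    by (simp add: twist_def sgn_par_def)
qed

lemma lat_iff:
  assumes "d1 > 0"
  shows "(a, b) \<in> lat d1 d2 s \<longleftrightarrow> d1 dvd a \<and> d2 dvd b - (a div d1) * s"
proof
  assume "(a, b) \<in> lat d1 d2 s"
  then show "d1 dvd a \<and> d2 dvd b - (a div d1) * s"
    using assms by (auto simp: lat_def)
next
  assume "d1 dvd a \<and> d2 dvd b - (a div d1) * s"
  then obtain l where "a = (a div d1) * d1" "b - (a div d1) * s = d2 * l"
    unfolding dvd_def[of d2] by auto
  then have "a = (a div d1) * d1 \<and> b = (a div d1) * s + l * d2"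
    by (simp add: algebra_simps)
  then show "(a, b) \<in> lat d1 d2 s"
    unfolding lat_def by blast
qed

lemma lat_0 [simp]: "(0, 0) \<in> lat d1 d2 s"
  by (auto simp: lat_def)

lemma lat_add:
  assumes "(a, b) \<in> lat d1 d2 s" "(a', b') \<in> lat d1 d2 s"
  shows "(a + a', b + b') \<in> lat d1 d2 s"
proof -
  obtain i l i' l' where "a = i * d1" "b = i * s + l * d2" "a' = i' * d1" "b' = i' * s + l' * d2"
    using assms by (auto simp: lat_def)
  then have "a + a' = (i + i') * d1 \<and> b + b' = (i + i') * s + (l + l') * d2"
    by (simp add: algebra_simps)
  then show ?thesis
    unfolding lat_def by blast
qed

lemma lat_mult:
  assumes "(a, b) \<in> lat d1 d2 s"
  shows "(m * a, m * b) \<in> lat d1 d2 s"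
proof -
  obtain i l where "a = i * d1" "b = i * s + l * d2"
    using assms by (auto simp: lat_def)
  then have "m * a = (m * i) * d1 \<and> m * b = (m * i) * s + (m * l) * d2"
    by (simp add: algebra_simps)
  then show ?thesis
    unfolding lat_def by blast
qed

lemma lat_uminus: "(a, b) \<in> lat d1 d2 s \<Longrightarrow> (- a, - b) \<in> lat d1 d2 s"
  using lat_mult[of a b d1 d2 s "- 1"] by simp

lemma lat_minus: "(a, b) \<in> lat d1 d2 s \<Longrightarrow> (a', b') \<in> lat d1 d2 s \<Longrightarrow> (a - a', b - b') \<in> lat d1 d2 s"
  using lat_add[OF _ lat_uminus] by fastforce

lemma mem_sub_iff:
  "(a, b, c) \<in> sub k d1 d2 s (u1, u2) \<longleftrightarrow>
    (\<exists>j. c = k * j \<and> (a - twist k j * u1, b - twist k j * u2) \<in> lat d1 d2 s)"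
proof
  assume "(a, b, c) \<in> sub k d1 d2 s (u1, u2)"
  then obtain i l j where "a = i * d1 + twist k j * u1" "b = i * s + l * d2 + twist k j * u2"
      "c = k * j"
    by (auto simp: sub_def sub_param_def)
  then show "\<exists>j. c = k * j \<and> (a - twist k j * u1, b - twist k j * u2) \<in> lat d1 d2 s"
    by (intro exI[of _ j]) (auto simp: lat_def)
next
  assume "\<exists>j. c = k * j \<and> (a - twist k j * u1, b - twist k j * u2) \<in> lat d1 d2 s"
  then obtain j i l where "c = k * j" "a - twist k j * u1 = i * d1"
      "b - twist k j * u2 = i * s + l * d2"
    by (auto simp: lat_def)
  then have "(a, b, c) = sub_param k d1 d2 s (u1, u2) (i, l, j)"
    by (simp add: sub_param_def)
  then show "(a, b, c) \<in> sub k d1 d2 s (u1, u2)"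
    by (simp add: sub_def)
qed

lemma sub_param_hom:
  assumes "odd k"
  shows "sub_param k d1 d2 s u (x \<star> y) =
    sub_param k d1 d2 s u x \<star> sub_param k d1 d2 s u y"
proof -
  have "sgn_par (k * j) = sgn_par j" for j
    using assms by (simp add: sgn_par_def)
  then show ?thesis
    using twist_add[of k]
    by (cases u; cases x; cases y) (simp add: sub_param_def algebra_simps)
qed

lemma sub_param_hom_even:
  assumes "even k"
  shows "sub_param k d1 d2 s u (x \<otimes>\<^bsub>pi1_G1\<^esub> y) =
    sub_param k d1 d2 s u x \<star> sub_param k d1 d2 s u y"
proof -
  have "sgn_par (k * j) = 1" for j
    using assms by (simp add: sgn_par_def)
  then show ?thesis
    using twist_add[of k]
    by (cases u; cases x; cases y) (simp add: sub_param_def algebra_simps)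
qed

lemma sub_param_inj:
  assumes "k > 0" "d1 > 0" "d2 > 0"
  shows "inj (sub_param k d1 d2 s u)"
proof (rule injI)
  fix x y assume xy: "sub_param k d1 d2 s u x = sub_param k d1 d2 s u y"
  obtain u1 u2 i l j i' l' j' where [simp]: "u = (u1, u2)" "x = (i, l, j)" "y = (i', l', j')"
    by (cases u; cases x; cases y)
  have "j = j'"
    using xy assms by (simp add: sub_param_def)
  then have "i = i'"
    using xy assms by (simp add: sub_param_def)
  then show "x = y"
    using xy assms \<open>j = j'\<close> by (simp add: sub_param_def)
qed

lemma subgroup_sub: "subgroup (sub k d1 d2 s u) screw_group"
proof -
  have "group_hom (if even k then pi1_G1 else screw_group) screw_group (sub_param k d1 d2 s u)"
    using group_pi1_G1 group_screw sub_param_hom sub_param_hom_even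
    by (auto simp: group_hom_def group_hom_axioms_def hom_def)
  from group_hom.img_is_subgroup[OF this] show ?thesis
    by (simp add: sub_def split: if_splits)
qed

lemma sub_iso:
  assumes "k > 0" "d1 > 0" "d2 > 0"
  shows "odd k \<Longrightarrow> screw_group \<cong> screw_group\<lparr>carrier := sub k d1 d2 s u\<rparr>"
    "even k \<Longrightarrow> pi1_G1 \<cong> screw_group\<lparr>carrier := sub k d1 d2 s u\<rparr>"
proof -
  show "screw_group \<cong> screw_group\<lparr>carrier := sub k d1 d2 s u\<rparr>" if "odd k"
  proof -
    have "sub_param k d1 d2 s u \<in> hom screw_group (screw_group\<lparr>carrier := sub k d1 d2 s u\<rparr>)"
      by (rule homI) (simp_all add: sub_def sub_param_hom[OF that])
    moreover have "bij_betw (sub_param k d1 d2 s u) UNIV (sub k d1 d2 s u)"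
      using sub_param_inj[OF assms] by (simp only: sub_def bij_betw_def)
    ultimately show ?thesis
      by (intro is_isoI[of "sub_param k d1 d2 s u"]) (simp add: iso_def)
  qed
  show "pi1_G1 \<cong> screw_group\<lparr>carrier := sub k d1 d2 s u\<rparr>" if "even k"
  proof -
    have "sub_param k d1 d2 s u \<in> hom pi1_G1 (screw_group\<lparr>carrier := sub k d1 d2 s u\<rparr>)"
      by (rule homI) (simp_all add: sub_def sub_param_hom_even[OF that])
    moreover have "bij_betw (sub_param k d1 d2 s u) UNIV (sub k d1 d2 s u)"
      using sub_param_inj[OF assms] by (simp only: sub_def bij_betw_def)
    ultimately show ?thesis
      by (intro is_isoI[of "sub_param k d1 d2 s u"]) (simp add: iso_def)
  qed
qed

subsection \<open>Every subgroup of finite index is of this form\<close>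

lemma int_subgroup_dvd:
  fixes I :: "int set"
  assumes diff: "\<And>x y. x \<in> I \<Longrightarrow> y \<in> I \<Longrightarrow> x - y \<in> I" and m: "m \<in> I" "m > 0"
  shows "\<exists>d>0. \<forall>x. x \<in> I \<longleftrightarrow> d dvd x"
proof -
  define n where "n = (LEAST n. n > 0 \<and> int n \<in> I)"
  have "nat m > 0 \<and> int (nat m) \<in> I"
    using m by simp
  then have n: "n > 0 \<and> int n \<in> I"
    unfolding n_def by (rule LeastI)
  have least: "\<not> (0 < x \<and> x < int n \<and> x \<in> I)" for x
    using not_less_Least[of "nat x" "\<lambda>n. n > 0 \<and> int n \<in> I"] unfolding n_def[symmetric]
    by auto
  have zero: "0 \<in> I"
    using diff[OF m(1) m(1)] by simp
  have neg: "- x \<in> I" if "x \<in> I" for x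
    using diff[OF zero that] by simp
  have add: "x + y \<in> I" if "x \<in> I" "y \<in> I" for x y
    using diff[OF that(1) neg[OF that(2)]] by simp
  have nmult: "int i * int n \<in> I" for i
    using n add zero by (induction i) (auto simp: algebra_simps)
  have mult: "i * int n \<in> I" for i
    using nmult[of "nat i"] neg[OF nmult[of "nat (- i)"]] by (cases "i \<ge> 0") auto
  have "x \<in> I \<longleftrightarrow> int n dvd x" for x
  proof
    assume "x \<in> I"
    then have "x mod int n \<in> I"
      using diff[OF \<open>x \<in> I\<close> mult[of "x div int n"]] by (simp add: minus_div_mult_eq_mod)
    moreover have "0 \<le> x mod int n" "x mod int n < int n"
      using n by simp_all
    ultimately have "x mod int n = 0"
      using least by force
    then show "int n dvd x"
      by auto
  next
    assume "int n dvd x"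
    then show "x \<in> I"
      using mult by (auto elim!: dvdE simp: mult.commute)
  qed
  then show ?thesis
    using n by (intro exI[of _ "int n"]) auto
qed

text \<open>Two of the infinitely many elements \<open>f m\<close> lie in the same one of finitely many cosets.\<close>

lemma (in group) power_mem_finite_index:
  fixes f :: "int \<Rightarrow> 'a"
  assumes K: "subgroup K G" "finite (rcosets K)"
    and f: "\<And>m. f m \<in> carrier G" "\<And>m n. f (m + n) = f m \<otimes> f n"
  shows "\<exists>m>0. f m \<in> K"
proof -
  have "range (\<lambda>m::nat. K #> f (int m)) \<subseteq> rcosets K"
    using f(1) by (auto simp: RCOSETS_def)
  then have "finite (range (\<lambda>m::nat. K #> f (int m)))"
    using K(2) finite_subset by blast
  then have "\<not> inj (\<lambda>m::nat. K #> f (int m))"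
    using range_inj_infinite by blast
  then obtain m n :: nat where mn: "m < n" "K #> f (int m) = K #> f (int n)"
    unfolding inj_def by (metis linorder_neqE_nat)
  then obtain k where k: "k \<in> K" "f (int n) = k \<otimes> f (int m)"
    using r_coset_eq_iff[OF K(1)] f(1) by blast
  have "f (int n) = f (int n - int m) \<otimes> f (int m)"
    using f(2)[of "int n - int m" "int m"] by simp
  then have "f (int n - int m) = k"
    using k f(1) subgroup.mem_carrier[OF K(1) k(1)] by (metis right_cancel)
  then show ?thesis
    using mn k by (intro exI[of _ "int n - int m"]) auto
qed

lemma (in group) power_mem_all:
  fixes f :: "int \<Rightarrow> 'a"
  assumes K: "subgroup K G" and f: "\<And>m. f m \<in> carrier G" "\<And>m n. f (m + n) = f m \<otimes> f n" and 1: "f 1 \<in> K"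
  shows "f m \<in> K"
proof -
  define I where "I = {m. f m \<in> K}"
  have "\<exists>d>0. \<forall>x. x \<in> I \<longleftrightarrow> d dvd x"
  proof (rule int_subgroup_dvd)
    show "x - y \<in> I" if xy: "x \<in> I" "y \<in> I" for x y
    proof -
      have "f x = f (x - y) \<otimes> f y"
        using f(2)[of "x - y" y] by simp
      then have "f (x - y) = f x \<otimes> inv (f y)"
        using f(1) by (simp add: m_assoc)
      then show ?thesis
        using xy K unfolding I_def by (simp add: subgroup.m_closed subgroup.m_inv_closed)
    qed
    show "1 \<in> I"
      using 1 by (simp add: I_def)
  qed simp
  then obtain d where d: "\<forall>x. x \<in> I \<longleftrightarrow> d dvd x"
    by blast
  have "1 \<in> I"
    using 1 by (simp add: I_def)
  then have "m \<in> I"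
    using d by (metis dvd_trans one_dvd)
  then show ?thesis
    by (simp add: I_def)
qed

text \<open>The three subgroups of \<open>\<int>\<close> formed by the last coordinates of \<open>K\<close>, by the first coordinates of its
  elements \<open>(a, b, 0)\<close>, and by the second coordinates of its elements \<open>(0, b, 0)\<close> are generated by
  \<open>k\<close>, \<open>d1\<close> and \<open>d2\<close>. They are nonzero because the index is finite.\<close>

theorem finite_index_sub:
  assumes K: "subgroup K screw_group" "finite (rcosets\<^bsub>screw_group\<^esub> K)"
  shows "\<exists>k d1 d2 s u. k > 0 \<and> d1 > 0 \<and> d2 > 0 \<and> 0 \<le> s \<and> s < d2 \<and> K = sub k d1 d2 s u"
proof -
  interpret K: subgroup K screw_group by fact
  have mult: "(a + sgn_par c * a', b + sgn_par c * b', c + c') \<in> K"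
    if "(a, b, c) \<in> K" "(a', b', c') \<in> K" for a b c a' b' c'
    using K.m_closed[OF that] by simp
  have divide: "(a - sgn_par (c - c') * a', b - sgn_par (c - c') * b', c - c') \<in> K"
    if "(a, b, c) \<in> K" "(a', b', c') \<in> K" for a b c a' b' c'
    using K.m_closed[OF that(1) K.m_inv_closed[OF that(2)]] by (simp add: algebra_simps)
  have "\<exists>d>0. \<forall>x. x \<in> {b. (0, b, 0) \<in> K} \<longleftrightarrow> d dvd x"
  proof -
    obtain m where "m > 0" "(0, m, 0) \<in> K"
      using E.power_mem_finite_index[OF K, of "\<lambda>m. (0, m, 0)"] by auto
    then show ?thesis
      using divide[of 0 _ 0 0 _ 0] by (intro int_subgroup_dvd[of _ m]) auto
  qed
  then obtain d2 where d2: "d2 > 0" "\<And>b. (0, b, 0) \<in> K \<longleftrightarrow> d2 dvd b"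
    by auto
  have "\<exists>d>0. \<forall>x. x \<in> {a. \<exists>b. (a, b, 0) \<in> K} \<longleftrightarrow> d dvd x"
  proof -
    obtain m where "m > 0" "(m, 0, 0) \<in> K"
      using E.power_mem_finite_index[OF K, of "\<lambda>m. (m, 0, 0)"] by auto
    then show ?thesis
      using divide[of _ _ 0 _ _ 0] by (intro int_subgroup_dvd[of _ m]) (auto, blast+)
  qed
  then obtain d1 where d1: "d1 > 0" "\<And>a. (\<exists>b. (a, b, 0) \<in> K) \<longleftrightarrow> d1 dvd a"
    by auto
  have "\<exists>d>0. \<forall>x. x \<in> {c. \<exists>a b. (a, b, c) \<in> K} \<longleftrightarrow> d dvd x"
  proof -
    obtain m where "m > 0" "(0, 0, m) \<in> K"
      using E.power_mem_finite_index[OF K, of "\<lambda>m. (0, 0, m)"] by auto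
    then show ?thesis
      using divide by (intro int_subgroup_dvd[of _ m]) (auto, blast+)
  qed
  then obtain k where k: "k > 0" "\<And>c. (\<exists>a b. (a, b, c) \<in> K) \<longleftrightarrow> k dvd c"
    by auto
  obtain s0 where s0: "(d1, s0, 0) \<in> K"
    using d1(2)[of d1] by auto
  define s where "s = s0 mod d2"
  have s: "0 \<le> s" "s < d2"
    using d2(1) by (simp_all add: s_def)
  have "d2 dvd s0 - s"
    by (simp add: s_def minus_mod_eq_mult_div)
  then have sK: "(d1, s, 0) \<in> K"
    using divide[OF s0, of 0 "s0 - s" 0] d2(2) by simp
  obtain u1 u2 where u: "(u1, u2, k) \<in> K"
    using k(2)[of k] by auto
  have d2K: "(0, l * d2, 0) \<in> K" for l
    using d2(2) by simp
  have iK: "(i * d1, i * s, 0) \<in> K" for i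
    by (rule E.power_mem_all[OF K(1), of "\<lambda>i. (i * d1, i * s, 0)"])
      (use sK in \<open>auto simp: algebra_simps\<close>)
  have latK: "(a, b, 0) \<in> K \<longleftrightarrow> (a, b) \<in> lat d1 d2 s" for a b
  proof
    assume ab: "(a, b, 0) \<in> K"
    then obtain i where i: "a = i * d1"
      using d1(2)[of a] by (metis dvd_def mult.commute)
    then have "(0, b - i * s, 0) \<in> K"
      using divide[OF ab iK[of i]] by simp
    then obtain l where "b - i * s = l * d2"
      using d2(2) by (metis dvd_def mult.commute)
    then have "a = i * d1 \<and> b = i * s + l * d2"
      using i by simp
    then show "(a, b) \<in> lat d1 d2 s"
      unfolding lat_def by blast
  next
    assume "(a, b) \<in> lat d1 d2 s"
    then obtain i l where "a = i * d1" "b = i * s + l * d2"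
      by (auto simp: lat_def)
    then show "(a, b, 0) \<in> K"
      using mult[OF iK[of i] d2K[of l]] by simp
  qed
  have zK: "(twist k j * u1, twist k j * u2, k * j) \<in> K" for j
    by (rule E.power_mem_all[OF K(1), of "\<lambda>j. (twist k j * u1, twist k j * u2, k * j)"])
      (use u in \<open>auto simp: twist_add algebra_simps\<close>)
  have "(a, b, c) \<in> K \<longleftrightarrow> (a, b, c) \<in> sub k d1 d2 s (u1, u2)" for a b c
  proof
    assume abc: "(a, b, c) \<in> K"
    then obtain j where j: "c = k * j"
      using k(2)[of c] by (auto elim!: dvdE)
    then have "(a - twist k j * u1, b - twist k j * u2) \<in> lat d1 d2 s"
      using divide[OF abc zK[of j]] latK by simp
    then show "(a, b, c) \<in> sub k d1 d2 s (u1, u2)"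
      unfolding mem_sub_iff using j by blast
  next
    assume "(a, b, c) \<in> sub k d1 d2 s (u1, u2)"
    then obtain j where j: "c = k * j" "(a - twist k j * u1, b - twist k j * u2) \<in> lat d1 d2 s"
      unfolding mem_sub_iff by blast
    then show "(a, b, c) \<in> K"
      using mult[OF latK[THEN iffD2, OF j(2)] zK[of j]] by simp
  qed
  then have "K = sub k d1 d2 s (u1, u2)"
    by auto
  then show ?thesis
    using k d1 d2 s by blast
qed

subsection \<open>Index, equality and conjugacy\<close>

text \<open>The representative modulo \<open>lat d1 d2 s\<close> in the box \<open>{0..<d1} \<times> {0..<d2}\<close>.\<close>

definition reduce :: "int \<Rightarrow> int \<Rightarrow> int \<Rightarrow> int \<times> int \<Rightarrow> int \<times> int" where
  "reduce d1 d2 s = (\<lambda>(a, b). (a mod d1, (b - (a div d1) * s) mod d2))"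

lemma reduce_box:
  assumes "d1 > 0" "d2 > 0"
  shows "reduce d1 d2 s u \<in> {0..<d1} \<times> {0..<d2}"
  using assms by (cases u) (simp add: reduce_def)

lemma reduce_diff:
  assumes "d1 > 0" "d2 > 0" "reduce d1 d2 s (a, b) = (a', b')"
  shows "(a - a', b - b') \<in> lat d1 d2 s"
proof -
  have a': "a' = a mod d1" and b': "b' = (b - (a div d1) * s) mod d2"
    using assms(3) by (simp_all add: reduce_def)
  have "a - a' = (a div d1) * d1"
    by (simp add: a' minus_mod_eq_div_mult)
  moreover have "b - b' = (a div d1) * s + ((b - (a div d1) * s) div d2) * d2"
    using minus_mod_eq_div_mult[of "b - (a div d1) * s" d2] by (simp add: b')
  ultimately show ?thesis
    unfolding lat_def by blast
qed

lemma box_lat_unique: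
  assumes "d1 > 0" "d2 > 0" "(a - a', b - b') \<in> lat d1 d2 s"
    "(a, b) \<in> {0..<d1} \<times> {0..<d2}" "(a', b') \<in> {0..<d1} \<times> {0..<d2}"
  shows "a = a' \<and> b = b'"
proof -
  have 1: "d1 dvd a - a'" "d2 dvd b - b' - ((a - a') div d1) * s"
    using assms(3) lat_iff[OF assms(1)] by auto
  then have "a = a'"
    using assms(4,5) by (metis SigmaD1 atLeastLessThan_iff mod_eq_dvd_iff mod_pos_pos_trivial)
  moreover have "b = b'"
    using 1(2) assms(4,5) \<open>a = a'\<close> by (simp add: mod_eq_dvd_iff[symmetric])
  ultimately show ?thesis by simp
qed

lemma reduce_eq_iff:
  assumes "d1 > 0" "d2 > 0"
  shows "reduce d1 d2 s (a, b) = reduce d1 d2 s (a', b') \<longleftrightarrow> (a - a', b - b') \<in> lat d1 d2 s"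
proof -
  obtain x y x' y' where xy: "reduce d1 d2 s (a, b) = (x, y)" "reduce d1 d2 s (a', b') = (x', y')"
    by (cases "reduce d1 d2 s (a, b)"; cases "reduce d1 d2 s (a', b')")
  note r = reduce_diff[OF assms xy(1)] reduce_diff[OF assms xy(2)]
  have box: "(x, y) \<in> {0..<d1} \<times> {0..<d2}" "(x', y') \<in> {0..<d1} \<times> {0..<d2}"
    using reduce_box[OF assms] xy by metis+
  show ?thesis
  proof
    assume "reduce d1 d2 s (a, b) = reduce d1 d2 s (a', b')"
    then show "(a - a', b - b') \<in> lat d1 d2 s"
      using lat_minus[OF r] xy by simp
  next
    assume "(a - a', b - b') \<in> lat d1 d2 s"
    then have "(x - x', y - y') \<in> lat d1 d2 s"
      using lat_minus[OF lat_add[OF _ r(2)] r(1)] by (fastforce simp: algebra_simps)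
    then show "reduce d1 d2 s (a, b) = reduce d1 d2 s (a', b')"
      using box_lat_unique[OF assms _ box] xy by simp
  qed
qed

lemma reduce_fixed:
  assumes "(a, b) \<in> {0..<d1} \<times> {0..<d2}"
  shows "reduce d1 d2 s (a, b) = (a, b)"
  using assms by (simp add: reduce_def)

text \<open>Every coset has exactly one representative in the box \<open>B\<close>: a power of \<open>(u1, u2, k)\<close> reduces the
  last coordinate modulo \<open>k\<close>, then a lattice element reduces the other two.\<close>

lemma index_sub:
  assumes "k > 0" "d1 > 0" "d2 > 0"
  shows "finite (rcosets\<^bsub>screw_group\<^esub> (sub k d1 d2 s u))"
    "card (rcosets\<^bsub>screw_group\<^esub> (sub k d1 d2 s u)) = nat (k * d1 * d2)"
proof -
  obtain u1 u2 where u: "u = (u1, u2)" by (cases u)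
  define K where "K = sub k d1 d2 s u"
  have K: "subgroup K screw_group"
    unfolding K_def by (rule subgroup_sub)
  define B where "B = {0..<d1} \<times> {0..<d2} \<times> {0..<k}"
  have latK: "(a, b, 0) \<in> K" if "(a, b) \<in> lat d1 d2 s" for a b
    unfolding K_def u mem_sub_iff using that by (intro exI[of _ 0]) simp
  have surj: "\<exists>y\<in>B. K #>\<^bsub>screw_group\<^esub> x = K #>\<^bsub>screw_group\<^esub> y" for x
  proof -
    obtain a b c where x: "x = (a, b, c)" by (cases x)
    have "(twist k (- (c div k)) * u1, twist k (- (c div k)) * u2, k * - (c div k)) \<in> K"
      unfolding K_def u mem_sub_iff by (intro exI[of _ "- (c div k)"]) simp
    then obtain \<kappa> a' b' where \<kappa>: "\<kappa> \<in> K" "\<kappa> \<star> x = (a', b', c mod k)"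
      by (force simp: x minus_mult_div_eq_mod)
    obtain a'' b'' where r: "reduce d1 d2 s (a', b') = (a'', b'')"
      by (cases "reduce d1 d2 s (a', b')")
    have "(a'' - a', b'' - b', 0) \<in> K"
      using lat_uminus[OF reduce_diff[OF assms(2,3) r]] latK by simp
    moreover have "(a'' - a', b'' - b', 0) \<star> (\<kappa> \<star> x) = (a'', b'', c mod k)"
      unfolding \<kappa>(2) by simp
    ultimately have "\<exists>m\<in>K. (a'', b'', c mod k) = m \<star> x"
      using \<kappa>(1) subgroup.m_closed[OF K] E.m_assoc by (metis UNIV_I screw_carrier)
    then have "K #>\<^bsub>screw_group\<^esub> x = K #>\<^bsub>screw_group\<^esub> (a'', b'', c mod k)"
      by (subst E.r_coset_eq_iff[OF K]) auto
    moreover have "(a'', b'', c mod k) \<in> B"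
      using reduce_box[OF assms(2,3), of s "(a', b')"] r assms(1) by (simp add: B_def)
    ultimately show ?thesis by blast
  qed
  have inj: "inj_on (\<lambda>x. K #>\<^bsub>screw_group\<^esub> x) B"
  proof (rule inj_onI)
    fix x y assume xy: "x \<in> B" "y \<in> B" "K #>\<^bsub>screw_group\<^esub> x = K #>\<^bsub>screw_group\<^esub> y"
    obtain a b c a' b' c' where [simp]: "x = (a, b, c)" "y = (a', b', c')"
      by (cases x; cases y)
    obtain e f g where efg: "(e, f, g) \<in> K" "y = (e, f, g) \<star> x"
      using xy(3) E.r_coset_eq_iff[OF K, of x y] by force
    then obtain j where j: "g = k * j" "(e - twist k j * u1, f - twist k j * u2) \<in> lat d1 d2 s"
      unfolding K_def u mem_sub_iff by blast
    have "c' = k * j + c"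
      using efg j by simp
    moreover have "c' div k = j"
      unfolding \<open>c' = k * j + c\<close> using xy(1) assms(1) by (simp add: B_def div_pos_pos_trivial)
    moreover have "c' div k = 0"
      using xy(2) assms(1) by (simp add: B_def div_pos_pos_trivial)
    ultimately have "c = c'" "j = 0"
      by simp_all
    then have "(a' - a, b' - b) \<in> lat d1 d2 s"
      using j efg(2) by simp
    then show "x = y"
      using box_lat_unique[OF assms(2,3), of a' a b' b s] xy \<open>c = c'\<close> by (simp add: B_def)
  qed
  have "rcosets\<^bsub>screw_group\<^esub> K = (\<lambda>x. K #>\<^bsub>screw_group\<^esub> x) ` B"
    unfolding E.rcosets_image screw_carrier using surj by blast
  moreover have "card B = nat (k * d1 * d2)"
    using assms by (simp add: B_def card_cartesian_product nat_mult_distrib)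
  moreover have "finite B"
    by (simp add: B_def)
  ultimately show "finite (rcosets\<^bsub>screw_group\<^esub> (sub k d1 d2 s u))"
    "card (rcosets\<^bsub>screw_group\<^esub> (sub k d1 d2 s u)) = nat (k * d1 * d2)"
    unfolding K_def[symmetric] using inj by (simp_all add: card_image)
qed

lemma sub_subset:
  assumes "(u1 - v1, u2 - v2) \<in> lat d1 d2 s"
  shows "sub k d1 d2 s (u1, u2) \<subseteq> sub k d1 d2 s (v1, v2)"
proof
  fix x assume x: "x \<in> sub k d1 d2 s (u1, u2)"
  obtain a b c where [simp]: "x = (a, b, c)" by (cases x)
  obtain j where j: "c = k * j" "(a - twist k j * u1, b - twist k j * u2) \<in> lat d1 d2 s"
    using x unfolding \<open>x = (a, b, c)\<close> mem_sub_iff by blast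
  have "(a - twist k j * v1, b - twist k j * v2) \<in> lat d1 d2 s"
    using lat_add[OF j(2) lat_mult[OF assms, of "twist k j"]] by (simp add: algebra_simps)
  then show "x \<in> sub k d1 d2 s (v1, v2)"
    unfolding \<open>x = (a, b, c)\<close> mem_sub_iff using j(1) by blast
qed

lemma sub_eq_iff:
  assumes "k > 0" "d1 > 0" "d2 > 0" "0 \<le> s" "s < d2"
    and "k' > 0" "d1' > 0" "d2' > 0" "0 \<le> s'" "s' < d2'"
  shows "sub k d1 d2 s (u1, u2) = sub k' d1' d2' s' (v1, v2) \<longleftrightarrow>
    k = k' \<and> d1 = d1' \<and> d2 = d2' \<and> s = s' \<and> (u1 - v1, u2 - v2) \<in> lat d1 d2 s"
proof
  assume eq: "sub k d1 d2 s (u1, u2) = sub k' d1' d2' s' (v1, v2)"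
  have "(u1, u2, k) \<in> sub k d1 d2 s (u1, u2)"
    unfolding mem_sub_iff by (intro exI[of _ 1]) simp
  then have uk: "(u1, u2, k) \<in> sub k' d1' d2' s' (v1, v2)"
    using eq by simp
  have "(v1, v2, k') \<in> sub k' d1' d2' s' (v1, v2)"
    unfolding mem_sub_iff by (intro exI[of _ 1]) simp
  then have "(v1, v2, k') \<in> sub k d1 d2 s (u1, u2)"
    using eq by simp
  then have "k dvd k'"
    unfolding mem_sub_iff by auto
  moreover have "k' dvd k"
    using uk unfolding mem_sub_iff by auto
  ultimately have k: "k = k'"
    using assms by (simp add: zdvd_antisym_nonneg)
  have "(a, b, 0) \<in> sub k d1 d2 s (u1, u2) \<longleftrightarrow> (a, b) \<in> lat d1 d2 s"
    "(a, b, 0) \<in> sub k' d1' d2' s' (v1, v2) \<longleftrightarrow> (a, b) \<in> lat d1' d2' s'" for a b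
    unfolding mem_sub_iff using assms by auto
  then have L: "(a, b) \<in> lat d1 d2 s \<longleftrightarrow> (a, b) \<in> lat d1' d2' s'" for a b
    using eq by simp
  have "d2' dvd d2" "d2 dvd d2'"
    using L[of 0 d2] L[of 0 d2'] assms by (simp_all add: lat_iff)
  then have d2: "d2 = d2'"
    using assms by (simp add: zdvd_antisym_nonneg)
  have "d1' dvd d1" "d1 dvd d1'"
    using L[of d1 s] L[of d1' s'] assms by (simp_all add: lat_iff)
  then have d1: "d1 = d1'"
    using assms by (simp add: zdvd_antisym_nonneg)
  have "d2 dvd s - s'"
    using L[of d1 s] assms d1 d2 by (simp add: lat_iff)
  then have s: "s = s'"
    using assms d2 by (metis mod_eq_dvd_iff mod_pos_pos_trivial)
  obtain j where "k = k' * j" "(u1 - twist k' j * v1, u2 - twist k' j * v2) \<in> lat d1' d2' s'"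
    using uk unfolding mem_sub_iff by blast
  moreover from this(1) have "j = 1"
    using k assms by simp
  ultimately show "k = k' \<and> d1 = d1' \<and> d2 = d2' \<and> s = s' \<and> (u1 - v1, u2 - v2) \<in> lat d1 d2 s"
    using k d1 d2 s by simp
next
  assume A: "k = k' \<and> d1 = d1' \<and> d2 = d2' \<and> s = s' \<and> (u1 - v1, u2 - v2) \<in> lat d1 d2 s"
  then have "(u1 - v1, u2 - v2) \<in> lat d1 d2 s"
    by blast
  moreover from lat_uminus[OF this] have "(v1 - u1, v2 - u2) \<in> lat d1 d2 s"
    by simp
  ultimately have "sub k d1 d2 s (u1, u2) = sub k d1 d2 s (v1, v2)"
    by (intro equalityI sub_subset)
  then show "sub k d1 d2 s (u1, u2) = sub k' d1' d2' s' (v1, v2)"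
    using A by simp
qed

text \<open>Conjugation by \<open>(a, b, e)\<close> multiplies the lattice by a sign, which preserves it. It adds
  \<open>(1 - (-1)\<^sup>k) (a, b)\<close> to \<open>(u1, u2)\<close>, up to the sign given by \<open>e\<close> on the latter.\<close>

lemma conj_sub_sub:
  "conj_sub screw_group (a, b, e) (sub k d1 d2 s (u1, u2)) =
    sub k d1 d2 s (sgn_par e * u1 + (if even k then 0 else 2 * a), sgn_par e * u2 +
      (if even k then 0 else 2 * b))"
proof -
  have 1: "(a, b, e) \<star> sub_param k d1 d2 s (u1, u2) (i, l, j) \<star> inv\<^bsub>screw_group\<^esub> (a, b, e) =
      sub_param k d1 d2 s (sgn_par e * u1 + (if even k then 0 else 2 * a), sgn_par e * u2 +
        (if even k then 0 else 2 * b))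
        (sgn_par e * i, sgn_par e * l, j)" for i l j
  proof (cases "even k")
    case True
    then have "sgn_par (k * j) = 1"
      by (simp add: sgn_par_def)
    then show ?thesis
      using True by (simp add: sub_param_def algebra_simps)
  next
    case False
    then have eq: "sgn_par (k * j) = 1 - 2 * twist k j"
      by (cases "even j") (simp_all add: sgn_par_def twist_def mod_2_eq_odd)
    show ?thesis
      using False by (simp add: sub_param_def eq eq[unfolded mult.commute[of k j]] algebra_simps)
  qed
  define v where "v = (sgn_par e * u1 + (if even k then 0 else 2 * a), sgn_par e * u2 +
    (if even k then 0 else 2 * b))"
  have "conj_sub screw_group (a, b, e) (sub k d1 d2 s (u1, u2)) =
      sub_param k d1 d2 s v ` range (\<lambda>(i, l, j). (sgn_par e * i, sgn_par e * l, j))"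
    unfolding E.conj_sub_eq sub_def image_image
  proof (rule image_cong[OF HOL.refl])
    fix x :: "int \<times> int \<times> int"
    obtain i l j where x: "x = (i, l, j)" by (cases x)
    show "(a, b, e) \<star> sub_param k d1 d2 s (u1, u2) x \<star> inv\<^bsub>screw_group\<^esub> (a, b, e) =
        sub_param k d1 d2 s v (case x of (i, l, j) \<Rightarrow> (sgn_par e * i, sgn_par e * l, j))"
      unfolding x prod.case v_def by (rule 1)
  qed
  also have "range (\<lambda>(i, l, j). (sgn_par e * i, sgn_par e * l, j :: int)) = UNIV"
  proof -
    have "x \<in> range (\<lambda>(i, l, j). (sgn_par e * i, sgn_par e * l, j :: int))" for x
      by (cases x) (auto intro!: image_eqI[where x
        = "(sgn_par e * fst x, sgn_par e * fst (snd x), snd (snd x))"])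
    then show ?thesis by blast
  qed
  finally show ?thesis
    by (simp add: sub_def v_def)
qed

abbreviation sub_class :: "int \<Rightarrow> int \<Rightarrow> int \<Rightarrow> int \<Rightarrow> int \<times> int \<Rightarrow> (int \<times> int \<times> int) set set" where
  "sub_class k d1 d2 s u \<equiv> conj_class screw_group (sub k d1 d2 s u)"

lemma conj_class_sub_eq_iff:
  assumes "k > 0" "d1 > 0" "d2 > 0" "0 \<le> s" "s < d2"
    and "k' > 0" "d1' > 0" "d2' > 0" "0 \<le> s'" "s' < d2'"
  shows "sub_class k d1 d2 s (u1, u2) = sub_class k' d1' d2' s' (v1, v2) \<longleftrightarrow>
    k = k' \<and> d1 = d1' \<and> d2 = d2' \<and> s = s' \<and>
    (\<exists>a b e. (v1 - (sgn_par e * u1 + (if even k then 0 else 2 * a)),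
      v2 - (sgn_par e * u2 + (if even k then 0 else 2 * b))) \<in> lat d1 d2 s)"
    (is "_ \<longleftrightarrow> ?R")
proof -
  have "sub_class k d1 d2 s (u1, u2) = sub_class k' d1' d2' s' (v1, v2) \<longleftrightarrow>
      (\<exists>a b e. sub k' d1' d2' s' (v1, v2) =
        sub k d1 d2 s (sgn_par e * u1 + (if even k then 0 else 2 * a), sgn_par e * u2 +
          (if even k then 0 else 2 * b)))"
    by (subst E.conj_class_eq_iff) (auto simp: conj_sub_sub[symmetric])
  also have "\<dots> \<longleftrightarrow> ?R"
    unfolding sub_eq_iff[OF assms(6-10) assms(1-5)] by auto
  finally show ?thesis .
qed

subsection \<open>Transport of subgroup classes along an isomorphism\<close>

lemma subgroup_classes_eq:
  "subgroup_classes H G n = conj_class G ` {K. subgroup K G \<and> finite (rcosets\<^bsub>G\<^esub> K) \<and>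
     card (rcosets\<^bsub>G\<^esub> K) = n \<and> G\<lparr>carrier := K\<rparr> \<cong> H}"
  unfolding subgroup_classes_def conj_class_def conj_sub_def by blast

lemma iso_image_subgroup:
  assumes G: "group G" and G': "group G'" and \<phi>: "\<phi> \<in> iso G G'" and K: "subgroup K G"
  shows "subgroup (\<phi> ` K) G'" "G\<lparr>carrier := K\<rparr> \<cong> G'\<lparr>carrier := \<phi> ` K\<rparr>"
    "card (rcosets\<^bsub>G\<^esub> K) = card (rcosets\<^bsub>G'\<^esub> (\<phi> ` K))"
      "finite (rcosets\<^bsub>G\<^esub> K) \<longleftrightarrow> finite (rcosets\<^bsub>G'\<^esub> (\<phi> ` K))"
proof -
  interpret G: group G by fact
  interpret G': group G' by fact
  have hom: "\<phi> \<in> hom G G'" and inj: "inj_on \<phi> (carrier G)" and surj: "\<phi> ` carrier G = carrier G'"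
    using \<phi> by (auto simp: iso_def bij_betw_def)
  interpret \<phi>: group_hom G G' \<phi>
    by unfold_locales fact
  have KG: "K \<subseteq> carrier G"
    using K by (rule subgroup.subset)
  show K': "subgroup (\<phi> ` K) G'"
    by (rule \<phi>.subgroup_img_is_subgroup) fact
  have "\<phi> \<in> hom (G\<lparr>carrier := K\<rparr>) (G'\<lparr>carrier := \<phi> ` K\<rparr>)"
    by (rule homI) (use KG in \<open>auto simp: subset_iff\<close>)
  moreover have "inj_on \<phi> K"
    using inj KG by (rule inj_on_subset)
  ultimately show "G\<lparr>carrier := K\<rparr> \<cong> G'\<lparr>carrier := \<phi> ` K\<rparr>"
    by (intro is_isoI[of \<phi>]) (simp add: iso_def bij_betw_def)
  have eq: "K #>\<^bsub>G\<^esub> g = K #>\<^bsub>G\<^esub> h \<longleftrightarrow> \<phi> ` K #>\<^bsub>G'\<^esub> \<phi> g = \<phi> ` K #>\<^bsub>G'\<^esub> \<phi> h"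
    if gh: "g \<in> carrier G" "h \<in> carrier G" for g h
  proof -
    have "h = k \<otimes>\<^bsub>G\<^esub> g \<longleftrightarrow> \<phi> h = \<phi> k \<otimes>\<^bsub>G'\<^esub> \<phi> g" if "k \<in> K" for k
    proof -
      have "k \<in> carrier G"
        using that KG by blast
      then show ?thesis
        using gh inj by (metis G.m_closed \<phi>.hom_mult inj_on_eq_iff)
    qed
    then show ?thesis
      using gh by (auto simp: G.r_coset_eq_iff[OF K] G'.r_coset_eq_iff[OF K'])
  qed
  show "card (rcosets\<^bsub>G\<^esub> K) = card (rcosets\<^bsub>G'\<^esub> (\<phi> ` K))"
      "finite (rcosets\<^bsub>G\<^esub> K) \<longleftrightarrow> finite (rcosets\<^bsub>G'\<^esub> (\<phi> ` K))"
    unfolding G.rcosets_image G'.rcosets_image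
    by (rule matched_images_card[where R = "\<lambda>g h. h = \<phi> g"]; use eq surj in \<open>auto simp: image_iff\<close>)+
qed

lemma subgroup_classes_iso:
  assumes G: "group G" and G': "group G'" and \<phi>: "\<phi> \<in> iso G G'"
  shows "card (subgroup_classes H G n) = card (subgroup_classes H G' n)"
    "finite (subgroup_classes H G n) \<longleftrightarrow> finite (subgroup_classes H G' n)"
proof -
  interpret G: group G by fact
  interpret G': group G' by fact
  have hom: "\<phi> \<in> hom G G'" and inj: "inj_on \<phi> (carrier G)" and surj: "\<phi> ` carrier G = carrier G'"
    using \<phi> by (auto simp: iso_def bij_betw_def)
  interpret \<phi>: group_hom G G' \<phi>
    by unfold_locales fact
  define C where "C = {K. subgroup K G \<and> finite (rcosets\<^bsub>G\<^esub> K) \<and> card (rcosets\<^bsub>G\<^esub> K) =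
    n \<and> G\<lparr>carrier := K\<rparr> \<cong> H}"
  define D where "D = {K. subgroup K G' \<and> finite (rcosets\<^bsub>G'\<^esub> K) \<and> card (rcosets\<^bsub>G'\<^esub> K) =
    n \<and> G'\<lparr>carrier := K\<rparr> \<cong> H}"
  define \<psi> where "\<psi> = inv_into (carrier G) \<phi>"
  have \<psi>: "\<psi> \<in> iso G' G"
    unfolding \<psi>_def by (rule G.iso_set_sym) fact
  have transfer: "G1\<lparr>carrier := K\<rparr> \<cong> H \<Longrightarrow> group G1 \<Longrightarrow> subgroup K G1 \<Longrightarrow> G1\<lparr>carrier := K\<rparr> \<cong> G2 \<Longrightarrow> G2 \<cong> H"
      for G1 :: "('x, 'y) monoid_scheme" and K and G2 :: "('z, 'w) monoid_scheme"
    using group.iso_sym[of "G1\<lparr>carrier := K\<rparr>" G2] group.subgroup_imp_group iso_trans by blast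
  have 1: "\<exists>K'\<in>D. K' = \<phi> ` K" if K: "K \<in> C" for K
    using iso_image_subgroup[OF G G' \<phi>, of K] K transfer[OF _ G, of K] by (auto simp: C_def D_def)
  have 2: "\<exists>K\<in>C. K' = \<phi> ` K" if K': "K' \<in> D" for K'
  proof (rule bexI)
    show "\<psi> ` K' \<in> C"
      using iso_image_subgroup[OF G' G \<psi>, of K'] K' transfer[OF _ G', of K'] by (auto simp: C_def D_def)
    have "K' \<subseteq> carrier G'"
      using K' subgroup.subset by (auto simp: D_def)
    then have "\<phi> (\<psi> x) = x" if "x \<in> K'" for x
      using that surj unfolding \<psi>_def by (metis f_inv_into_f subsetD)
    then show "K' = \<phi> ` \<psi> ` K'"
      by (simp add: image_image)
  qed
  have 3: "conj_class G K = conj_class G L \<longleftrightarrow> conj_class G' (\<phi> ` K) = conj_class G' (\<phi> ` L)"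
    if KL: "K \<in> C" "L \<in> C" for K L
  proof -
    have KG: "K \<subseteq> carrier G" "L \<subseteq> carrier G"
      using KL subgroup.subset by (auto simp: C_def)
    then have KG': "\<phi> ` K \<subseteq> carrier G'" "\<phi> ` L \<subseteq> carrier G'"
      using surj by blast+
    have "L = conj_sub G g K \<longleftrightarrow> \<phi> ` L = conj_sub G' (\<phi> g) (\<phi> ` K)" if g: "g \<in> carrier G" for g
    proof -
      have "conj_sub G' (\<phi> g) (\<phi> ` K) = \<phi> ` conj_sub G g K"
        unfolding G.conj_sub_eq G'.conj_sub_eq image_image
        by (rule image_cong) (use g KG in auto)
      then show ?thesis
        using inj_on_image_eq_iff[OF inj KG(2) G.conj_sub_carrier[OF KG(1) g]] by simp
    qed
    then show ?thesis
      unfolding G.conj_class_eq_iff[OF KG] G'.conj_class_eq_iff[OF KG'] surj[symmetric] by auto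
  qed
  show "card (subgroup_classes H G n) = card (subgroup_classes H G' n)"
    "finite (subgroup_classes H G n) \<longleftrightarrow> finite (subgroup_classes H G' n)"
    unfolding subgroup_classes_eq C_def[symmetric] D_def[symmetric]
    by (rule matched_images_card[where R = "\<lambda>K K'. K' = \<phi> ` K"]; use 1 2 3 in simp)+
qed

section \<open>The flat manifolds and their coverings\<close>

subsection \<open>The deck groups as free actions\<close>

definition act1 :: "int \<times> int \<times> int \<Rightarrow> real^3 \<Rightarrow> real^3" where
  "act1 = (\<lambda>(a, b, c) v. vector [v$1 + of_int a, v$2 + of_int b, v$3 + of_int c])"

definition act2 :: "int \<times> int \<times> int \<Rightarrow> real^3 \<Rightarrow> real^3" where
  "act2 = (\<lambda>(a, b, c) v. vector [of_int (sgn_par c) * v$1 + of_int a,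
     of_int (sgn_par c) * v$2 + of_int b, v$3 + of_int c])"

lemma vec3_eq_iff: "(u :: real^3) = v \<longleftrightarrow> u$1 = v$1 \<and> u$2 = v$2 \<and> u$3 = v$3"
  by (simp add: vec_eq_iff forall_3)

lemma continuous_on_vector_3:
  fixes f g h :: "'a::topological_space \<Rightarrow> real"
  assumes "continuous_on S f" "continuous_on S g" "continuous_on S h"
  shows "continuous_on S (\<lambda>x. vector [f x, g x, h x] :: real^3)"
proof -
  have "(\<lambda>x. vector [f x, g x, h x] :: real^3) =
      (\<lambda>x. \<chi> i. if i = 1 then f x else if i = 2 then g x else h x)"
    by (auto simp: vec3_eq_iff)
  moreover have "continuous_on S (\<lambda>x. if i = 1 then f x else if i = 2 then g x else h x)" for i :: 3
    using assms by (cases "i = 1"; cases "i = 2") simp_all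
  then have "continuous_on S (\<lambda>x. \<chi> i::3. if i = 1 then f x else if i = 2 then g x else h x)"
    by (rule continuous_on_vec_lambda)
  ultimately show ?thesis
    by (simp only:)
qed

lemma act1_nth [simp]:
  "act1 (a, b, c) v $ 1 = v$1 + of_int a" "act1 (a, b, c) v $ 2 = v$2 + of_int b"
  "act1 (a, b, c) v $ 3 = v$3 + of_int c"
  by (simp_all add: act1_def)

lemma act2_nth [simp]:
  "act2 (a, b, c) v $ 1 = of_int (sgn_par c) * v$1 + of_int a"
  "act2 (a, b, c) v $ 2 = of_int (sgn_par c) * v$2 + of_int b"
  "act2 (a, b, c) v $ 3 = v$3 + of_int c"
  by (simp_all add: act2_def)

lemma half_ball_int:
  fixes x y z :: "real^3"
  assumes "y \<in> ball x (1/2)" "z \<in> ball x (1/2)" "z $ i = y $ i + of_int a"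
  shows "a = 0"
proof -
  have "\<bar>y $ i - x $ i\<bar> < 1/2" "\<bar>z $ i - x $ i\<bar> < 1/2"
    using assms(1,2) component_le_norm_cart[of "y - x" i] component_le_norm_cart[of "z - x" i]
    by (auto simp: dist_norm norm_minus_commute)
  then have "\<bar>real_of_int a\<bar> < 1"
    using assms(3) by linarith
  then show ?thesis by linarith
qed

interpretation A1: free_action pi1_G1 act1
proof (intro free_action.intro free_action_axioms.intro group_pi1_G1)
  fix x y :: "real^3" and g h :: "int \<times> int \<times> int"
  show "act1 \<one>\<^bsub>pi1_G1\<^esub> x = x"
    by (simp add: vec3_eq_iff)
  show "act1 (g \<otimes>\<^bsub>pi1_G1\<^esub> h) x = act1 g (act1 h x)"
    by (cases g; cases h) (simp add: vec3_eq_iff)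
  show "continuous_on UNIV (act1 g)"
    unfolding act1_def by (cases g) (auto intro!: continuous_on_vector_3 continuous_intros)
  have "g = \<one>\<^bsub>pi1_G1\<^esub>" if "y \<in> ball x (1/2)" "act1 g y \<in> ball x (1/2)" for g y
  proof -
    obtain a b c where g: "g = (a, b, c)" by (cases g)
    have "a = 0" "b = 0" "c = 0"
      using half_ball_int[OF that, of 1 a] half_ball_int[OF that, of 2 b] half_ball_int[OF that,
        of 3 c] by (simp_all add: g)
    then show ?thesis by (simp add: g)
  qed
  then show "\<exists>U. open U \<and> x \<in> U \<and> (\<forall>g\<in>carrier pi1_G1. \<forall>y\<in>U. act1 g y \<in> U \<longrightarrow> g = \<one>\<^bsub>pi1_G1\<^esub>)"
    by (intro exI[of _ "ball x (1/2)"]) auto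
qed

interpretation A2: free_action screw_group act2
proof (intro free_action.intro free_action_axioms.intro group_screw)
  fix x y :: "real^3" and g h :: "int \<times> int \<times> int"
  show "act2 \<one>\<^bsub>screw_group\<^esub> x = x"
    by (simp add: vec3_eq_iff screw_one)
  show "act2 (g \<star> h) x = act2 g (act2 h x)"
    by (cases g; cases h) (simp add: vec3_eq_iff algebra_simps)
  show "continuous_on UNIV (act2 g)"
    unfolding act2_def by (cases g) (auto intro!: continuous_on_vector_3 continuous_intros)
  have "g = \<one>\<^bsub>screw_group\<^esub>" if "y \<in> ball x (1/2)" "act2 g y \<in> ball x (1/2)" for g y
  proof -
    obtain a b c where g: "g = (a, b, c)" by (cases g)
    have "c = 0"
      using half_ball_int[OF that, of 3 c] by (simp add: g)
    then have "a = 0" "b = 0"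
      using half_ball_int[OF that, of 1 a] half_ball_int[OF that, of 2 b] by (simp_all add: g)
    then show ?thesis using \<open>c = 0\<close> by (simp add: g screw_one)
  qed
  then show "\<exists>U. open U \<and> x \<in> U \<and> (\<forall>g\<in>carrier screw_group. \<forall>y\<in>U. act2 g y \<in> U \<longrightarrow> g = \<one>\<^bsub>screw_group\<^esub>)"
    by (intro exI[of _ "ball x (1/2)"]) auto
qed

lemma BijGroup_UNIV:
  "carrier (BijGroup UNIV) = {f. bij f}"
  "bij f \<Longrightarrow> bij g \<Longrightarrow> f \<otimes>\<^bsub>BijGroup UNIV\<^esub> g = f \<circ> g"
  by (auto simp: BijGroup_def Bij_def extensional_def compose_def)

lemma (in free_action) act_bij: "g \<in> carrier G \<Longrightarrow> bij (act g)"
  by (rule bij_betw_byWitness[of _ "act (inv g)"]) auto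

lemma (in free_action) act_hom: "act \<in> hom G (BijGroup UNIV)"
  by (rule homI) (auto simp: BijGroup_UNIV act_bij act_mult)

text \<open>By \<open>power_mem_all\<close> a subgroup that contains \<open>act (1, 0, 0)\<close> contains the whole first axis, and
  likewise for the other two; the three axes together generate the group.\<close>

lemma generate_axes:
  assumes fa: "free_action G act" and car: "carrier G = UNIV"
    and axes: "\<And>m n. (m + n, 0, 0) = (m, 0, 0) \<otimes>\<^bsub>G\<^esub> (n, 0, 0)"
      "\<And>m n. (0, m + n, 0) = (0, m, 0) \<otimes>\<^bsub>G\<^esub> (0, n, 0)"
      "\<And>m n. (0, 0, m + n) = (0, 0, m) \<otimes>\<^bsub>G\<^esub> (0, 0, n)"
    and split: "\<And>a b c. (a, b, c) = (a, 0, 0) \<otimes>\<^bsub>G\<^esub> ((0, b, 0) \<otimes>\<^bsub>G\<^esub> (0, 0, c))"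
  shows "generate (BijGroup UNIV) {act (1::int, 0::int, 0::int), act (0, 1, 0), act (0, 0, 1)} =
      range act"
    (is "generate ?B ?S = _")
proof
  interpret free_action G act by fact
  interpret B: group ?B by (rule group_BijGroup)
  interpret h: group_hom G ?B act
    by unfold_locales (rule act_hom)
  have "subgroup (range act) ?B"
    using h.img_is_subgroup car by simp
  then show "generate ?B ?S \<subseteq> range act"
    by (intro B.generate_subgroup_incl) auto
  have S: "?S \<subseteq> carrier ?B"
    using car by (auto simp: h.hom_closed)
  have gen: "subgroup (generate ?B ?S) ?B"
    by (rule B.generate_is_subgroup) fact
  have m: "act (g \<otimes>\<^bsub>G\<^esub> h) = act g \<otimes>\<^bsub>?B\<^esub> act h" for g h
    using h.hom_mult car by simp
  have c: "act g \<in> carrier ?B" for g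
    using h.hom_closed car by simp
  have "act (a, 0, 0) \<in> generate ?B ?S" for a
    by (rule B.power_mem_all[OF gen, of "\<lambda>a. act (a, 0, 0)"])
      (auto simp: c m[symmetric] axes intro: generate.incl)
  moreover have "act (0, b, 0) \<in> generate ?B ?S" for b
    by (rule B.power_mem_all[OF gen, of "\<lambda>a. act (0, a, 0)"])
      (auto simp: c m[symmetric] axes intro: generate.incl)
  moreover have "act (0, 0, d) \<in> generate ?B ?S" for d
    by (rule B.power_mem_all[OF gen, of "\<lambda>a. act (0, 0, a)"])
      (auto simp: c m[symmetric] axes intro: generate.incl)
  ultimately have "act (a, b, d) \<in> generate ?B ?S" for a b d
    using split[of a b d] m generate.eng by metis
  then show "range act \<subseteq> generate ?B ?S"
    by auto
qed

lemma deck1_eq: "deck1 = act1 ` carrier pi1_G1"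
proof -
  have "translate 1 = act1 (1, 0, 0)" "translate 2 = act1 (0, 1, 0)" "translate 3 = act1 (0, 0, 1)"
    by (auto simp: fun_eq_iff vec3_eq_iff translate_def axis_def)
  moreover have "generate (BijGroup UNIV) {act1 (1, 0, 0), act1 (0, 1, 0), act1 (0, 0, 1)} = range act1"
    by (rule generate_axes[OF A1.free_action_axioms]) simp_all
  ultimately show ?thesis
    by (simp add: deck1_def)
qed

lemma deck2_eq: "deck2 = act2 ` carrier screw_group"
proof -
  have "translate 1 = act2 (1, 0, 0)" "translate 2 = act2 (0, 1, 0)" "screw = act2 (0, 0, 1)"
    by (auto simp: fun_eq_iff vec3_eq_iff translate_def screw_def axis_def)
  moreover have "generate (BijGroup UNIV) {act2 (1, 0, 0), act2 (0, 1, 0), act2 (0, 0, 1)} = range act2"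
    by (rule generate_axes[OF A2.free_action_axioms]) simp_all
  ultimately show ?thesis
    by (simp add: deck2_def)
qed

lemma manifold_G1_eq: "manifold_G1 = A1.base"
  and manifold_G2_eq: "manifold_G2 = A2.base"
  by (simp_all only: manifold_G1_def manifold_G2_def deck1_eq deck2_eq)

subsection \<open>Orbit spaces of the subgroups\<close>

lemma orbit_spaces_homeomorphic:
  assumes A: "free_action G act" and B: "free_action G' act'" and K': "subgroup (\<phi> ` carrier G) G'"
    and h: "homeomorphic_map euclidean euclidean B"
    and eq: "\<And>g x. g \<in> carrier G \<Longrightarrow> B (act g x) = act' (\<phi> g) (B x)"
  shows "orbit_space (act' ` \<phi> ` carrier G) homeomorphic_space orbit_space (act ` carrier G)"
proof -
  interpret A: free_action G act by fact
  interpret B: free_action G' act' by fact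
  let ?q' = "orbit_of (act' ` \<phi> ` carrier G) \<circ> B"
  have "\<exists>h. homeomorphic_map (orbit_space (act' ` \<phi> ` carrier G)) A.base h \<and>
      (\<forall>x\<in>topspace euclidean. h (?q' x) = A.proj x)"
  proof (rule quotient_maps_homeomorphic)
    show "quotient_map euclidean A.base A.proj"
      by (rule quotient_map_orbit_of)
    show "quotient_map euclidean (orbit_space (act' ` \<phi> ` carrier G)) ?q'"
      using h by (intro quotient_map_compose[OF _ quotient_map_orbit_of])
        (simp add: homeomorphic_map_def)
    fix x y
    have "inj B"
      using h by (simp add: homeomorphic_map_def)
    then have "y = act g x \<longleftrightarrow> B y = act' (\<phi> g) (B x)" if "g \<in> carrier G" for g
      unfolding eq[OF that, symmetric] by (simp only: inj_eq)
    then show "?q' x = ?q' y \<longleftrightarrow> A.proj x = A.proj y"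
      by (simp add: B.orbit_eq_iff[OF K'] A.proj_eq_iff)
  qed
  then show ?thesis
    using homeomorphic_map_imp_homeomorphic_space by blast
qed

text \<open>These maps conjugate the standard actions on \<open>real^3\<close> to those of the subgroups
  \<open>sub k d1 d2 s u\<close>. For even \<open>k\<close> the subgroup consists of translations and \<open>(p1, p2) = u\<close>,
  \<open>(q1, q2) = 0\<close>. For odd \<open>k\<close> the axis of the generating screw motion \<open>(u1, u2, k)\<close> passes through
  \<open>u / 2\<close>, so \<open>(p1, p2) = 0\<close> and \<open>(q1, q2) = u / 2\<close>.\<close>

definition affine_map :: "real \<Rightarrow> real \<Rightarrow> real \<Rightarrow> real \<Rightarrow> real \<Rightarrow> real \<Rightarrow> real \<Rightarrow> real \<Rightarrow> real^3 \<Rightarrow> real^3" where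
  "affine_map k d1 d2 s p1 p2 q1 q2 v =
     vector [d1 * v$1 + p1 * v$3 + q1, s * v$1 + d2 * v$2 + p2 * v$3 + q2, k * v$3]"

lemma homeomorphic_affine_map:
  assumes "k \<noteq> 0" "d1 \<noteq> 0" "d2 \<noteq> 0"
  shows "homeomorphic_map euclidean euclidean (affine_map k d1 d2 s p1 p2 q1 q2)"
proof -
  define B where "B w = (vector [(w$1 - p1 * (w$3 / k) - q1) / d1,
      (w$2 - q2 - p2 * (w$3 / k) - s * ((w$1 - p1 * (w$3 / k) - q1) / d1)) / d2, w$3 / k] ::
        real^3)" for w :: "real^3"
  have "homeomorphic_maps euclidean euclidean (affine_map k d1 d2 s p1 p2 q1 q2) B"
    unfolding homeomorphic_maps_def
  proof (intro conjI ballI)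
    show "continuous_map euclidean euclidean (affine_map k d1 d2 s p1 p2 q1 q2)"
      unfolding affine_map_def by (auto intro!: continuous_on_vector_3 continuous_intros)
    show "continuous_map euclidean euclidean B"
      unfolding B_def using assms by (auto intro!: continuous_on_vector_3 continuous_intros)
    show "B (affine_map k d1 d2 s p1 p2 q1 q2 v) = v" for v
      using assms by (simp add: vec3_eq_iff affine_map_def B_def)
    show "affine_map k d1 d2 s p1 p2 q1 q2 (B w) = w" for w
      using assms by (simp add: vec3_eq_iff affine_map_def B_def)
  qed
  then show ?thesis
    using homeomorphic_maps_map by blast
qed

lemma orbit_space_sub:
  assumes "k > 0" "d1 > 0" "d2 > 0"
  shows "odd k \<Longrightarrow> orbit_space (act2 ` sub k d1 d2 s u) homeomorphic_space manifold_G2"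
    "even k \<Longrightarrow> orbit_space (act2 ` sub k d1 d2 s u) homeomorphic_space manifold_G1"
proof -
  obtain u1 u2 where u: "u = (u1, u2)" by (cases u)
  have hom: "homeomorphic_map euclidean euclidean (affine_map k d1 d2 s p1 p2 q1 q2)" for p1 p2 q1 q2
    using assms by (intro homeomorphic_affine_map) auto
  have range: "subgroup (range (sub_param k d1 d2 s u)) screw_group"
    using subgroup_sub by (simp only: sub_def)
  show "orbit_space (act2 ` sub k d1 d2 s u) homeomorphic_space manifold_G2" if "odd k"
    unfolding manifold_G2_eq sub_def screw_carrier
  proof (rule orbit_spaces_homeomorphic[OF A2.free_action_axioms A2.free_action_axioms,
    unfolded screw_carrier, OF range hom])
    fix h :: "int \<times> int \<times> int" and x :: "real^3"
    obtain i l j where h: "h = (i, l, j)" by (cases h)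
    have sgn: "sgn_par (k * j) = 1 - 2 * twist k j" "sgn_par j = 1 - 2 * twist k j"
      using that by (auto simp: sgn_par_def twist_def mod_2_eq_odd)
    show "affine_map k d1 d2 s 0 0 (u1 / 2) (u2 / 2) (act2 h x) =
        act2 (sub_param k d1 d2 s u h) (affine_map k d1 d2 s 0 0 (u1 / 2) (u2 / 2) x)"
      by (simp add: h u vec3_eq_iff affine_map_def sub_param_def sgn) (simp add: algebra_simps)
  qed
  show "orbit_space (act2 ` sub k d1 d2 s u) homeomorphic_space manifold_G1" if "even k"
    unfolding manifold_G1_eq sub_def pi1_G1_simps(1)
  proof (rule orbit_spaces_homeomorphic[OF A1.free_action_axioms A2.free_action_axioms,
    unfolded pi1_G1_simps(1), OF range hom])
    fix h :: "int \<times> int \<times> int" and x :: "real^3"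
    obtain i l j where h: "h = (i, l, j)" by (cases h)
    have "sgn_par (k * j) = 1" "twist k j = j"
      using that by (auto simp: sgn_par_def twist_def)
    then show "affine_map k d1 d2 s u1 u2 0 0 (act1 h x) =
        act2 (sub_param k d1 d2 s u h) (affine_map k d1 d2 s u1 u2 0 0 x)"
      by (simp add: h u vec3_eq_iff affine_map_def sub_param_def algebra_simps)
  qed
qed

subsection \<open>The two types of subgroups\<close>

text \<open>Elements with odd last coordinate act as screw motions, all others as translations.\<close>

definition has_screw :: "(int \<times> int \<times> int) set \<Rightarrow> bool" where
  "has_screw K \<longleftrightarrow> (\<exists>a b c. (a, b, c) \<in> K \<and> odd c)"

lemma has_screw_sub: "has_screw (sub k d1 d2 s u) \<longleftrightarrow> odd k"
proof -
  obtain u1 u2 where u: "u = (u1, u2)" by (cases u)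
  have "(u1, u2, k) \<in> sub k d1 d2 s u"
    unfolding u mem_sub_iff by (intro exI[of _ 1]) simp
  then have "has_screw (sub k d1 d2 s u)" if "odd k"
    using that unfolding has_screw_def by blast
  moreover have "odd k" if "has_screw (sub k d1 d2 s u)"
    using that unfolding has_screw_def u mem_sub_iff by auto
  ultimately show ?thesis by blast
qed

lemma screw_not_comm:
  "(0, 0, 1) \<star> (1, 0, 0) \<noteq> (1, 0, 0) \<star> (0, 0, 1)"
  by simp

lemma screw_not_iso_G1: "\<not> screw_group \<cong> pi1_G1"
proof
  assume "screw_group \<cong> pi1_G1"
  then obtain \<phi> where \<phi>: "\<phi> \<in> iso screw_group pi1_G1"
    by (auto simp: is_iso_def)
  have "x \<otimes>\<^bsub>pi1_G1\<^esub> y = y \<otimes>\<^bsub>pi1_G1\<^esub> x" for x y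
    by (cases x; cases y) simp
  then have "\<phi> ((0, 0, 1) \<star> (1, 0, 0)) = \<phi> ((1, 0, 0) \<star> (0, 0, 1))"
    using hom_mult[of \<phi> screw_group pi1_G1] \<phi> unfolding iso_def by (simp del: screw_mult)
  moreover have "inj \<phi>"
    using \<phi> by (simp add: iso_def bij_betw_def)
  ultimately show False
    using screw_not_comm by (metis injD)
qed

lemma manifolds_not_homeomorphic: "\<not> manifold_G2 homeomorphic_space manifold_G1"
proof
  assume "manifold_G2 homeomorphic_space manifold_G1"
  then have h: "A2.base homeomorphic_space A1.base"
    by (simp only: manifold_G1_eq manifold_G2_eq)
  have "(0, 0, 1) \<star> (1, 0, 0) = (1, 0, 0) \<star> (0, 0, 1)"
  proof (rule homeomorphic_orbit_spaces_commute[OF A2.free_action_axioms A1.free_action_axioms h])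
    show "x \<otimes>\<^bsub>pi1_G1\<^esub> y = y \<otimes>\<^bsub>pi1_G1\<^esub> x" for x y
      by (cases x; cases y) simp
  qed simp_all
  then show False
    using screw_not_comm by blast
qed

lemma screw_iso_G2: "screw_group \<cong> pi1_G2"
  using screw_iso_pi1_G2 by (auto intro: is_isoI)

lemma group_pi1_G2: "group pi1_G2"
  unfolding pi1_G2_def by (rule group_presented)

text \<open>In terms of the parametrization \<open>has_screw K\<close> means that \<open>k\<close> is odd, and \<open>k\<close> divides the index.
  Each equivalence needs the two types to be distinct, for the groups and for the manifolds.\<close>

lemma finite_index_types:
  assumes K: "subgroup K screw_group" "finite (rcosets\<^bsub>screw_group\<^esub> K)"
  shows "screw_group\<lparr>carrier := K\<rparr> \<cong> pi1_G2 \<longleftrightarrow> has_screw K"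
    "screw_group\<lparr>carrier := K\<rparr> \<cong> pi1_G1 \<longleftrightarrow> \<not> has_screw K"
    "orbit_space (act2 ` K) homeomorphic_space manifold_G2 \<longleftrightarrow> has_screw K"
    "orbit_space (act2 ` K) homeomorphic_space manifold_G1 \<longleftrightarrow> \<not> has_screw K"
    "odd (card (rcosets\<^bsub>screw_group\<^esub> K)) \<Longrightarrow> has_screw K"
proof -
  obtain k d1 d2 s u where p: "k > 0" "d1 > 0" "d2 > 0" and Ks: "K = sub k d1 d2 s u"
    using finite_index_sub[OF K] by blast
  define L where "L = screw_group\<lparr>carrier := K\<rparr>"
  have L: "group L"
    unfolding L_def by (rule E.subgroup_imp_group) fact
  have t: "has_screw K \<longleftrightarrow> odd k"
    unfolding Ks by (rule has_screw_sub)
  have odd: "screw_group \<cong> L" if "has_screw K"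
    using sub_iso(1)[OF p] t[THEN iffD1, OF that] unfolding L_def Ks by blast
  have even: "pi1_G1 \<cong> L" if "\<not> has_screw K"
    using sub_iso(2)[OF p] that t unfolding L_def Ks by blast
  have "L \<cong> pi1_G2" if "has_screw K"
    using E.iso_sym[OF odd[OF that]] screw_iso_G2 by (rule iso_trans)
  moreover have "\<not> L \<cong> pi1_G2" if "\<not> has_screw K"
  proof
    assume "L \<cong> pi1_G2"
    then have "pi1_G1 \<cong> pi1_G2"
      using even[OF that] iso_trans by blast
    then have "pi1_G1 \<cong> screw_group"
      using E.iso_sym[OF screw_iso_G2] iso_trans by blast
    then show False
      using screw_not_iso_G1 A1.iso_sym by blast
  qed
  ultimately show "screw_group\<lparr>carrier := K\<rparr> \<cong> pi1_G2 \<longleftrightarrow> has_screw K"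
    unfolding L_def by blast
  have "L \<cong> pi1_G1" if "\<not> has_screw K"
    by (rule A1.iso_sym[OF even[OF that]])
  moreover have "\<not> L \<cong> pi1_G1" if "has_screw K"
    using odd[OF that] screw_not_iso_G1 iso_trans by blast
  ultimately show "screw_group\<lparr>carrier := K\<rparr> \<cong> pi1_G1 \<longleftrightarrow> \<not> has_screw K"
    unfolding L_def by blast
  have "orbit_space (act2 ` K) homeomorphic_space manifold_G2" if "has_screw K"
    using orbit_space_sub(1)[OF p] that t unfolding Ks by blast
  moreover have "orbit_space (act2 ` K) homeomorphic_space manifold_G1" if "\<not> has_screw K"
    using orbit_space_sub(2)[OF p] that t unfolding Ks by blast
  moreover have "\<not> (orbit_space (act2 ` K) homeomorphic_space manifold_G2 \<and>
    orbit_space (act2 ` K) homeomorphic_space manifold_G1)"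
    using manifolds_not_homeomorphic homeomorphic_space_sym homeomorphic_space_trans by metis
  ultimately show "orbit_space (act2 ` K) homeomorphic_space manifold_G2 \<longleftrightarrow> has_screw K"
    "orbit_space (act2 ` K) homeomorphic_space manifold_G1 \<longleftrightarrow> \<not> has_screw K"
    by blast+
  show "has_screw K" if "odd (card (rcosets\<^bsub>screw_group\<^esub> K))"
    using that p unfolding t[unfolded Ks] Ks index_sub(2)[OF p] by (auto simp: even_nat_iff)
qed

section \<open>Counting conjugacy classes\<close>

lemma quotient_pos: "0 < n \<Longrightarrow> k dvd n \<Longrightarrow> 0 < n div k" for n k :: nat
  by (auto elim!: dvdE)

lemma quotient_quotient:
  fixes n k :: nat
  assumes "0 < n" "k dvd n"
  shows "n div (n div k) = k" "n div k dvd n"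
proof -
  obtain j where j: "n = k * j" using assms(2) ..
  then have "0 < k" "0 < j"
    using assms(1) by simp_all
  then show "n div (n div k) = k" "n div k dvd n"
    by (simp_all add: j)
qed

subsection \<open>The classes with a fixed lattice\<close>

definition lat_classes :: "int \<Rightarrow> int \<Rightarrow> int \<Rightarrow> int \<Rightarrow> (int \<times> int \<times> int) set set set" where
  "lat_classes k d1 d2 s = range (\<lambda>u. sub_class k d1 d2 s u)"

text \<open>The order of the 2-torsion of \<open>A = \<int>\<^sup>2 / lat d1 d2 s\<close>. It is also the order of \<open>A / 2 A\<close>, because
  these groups are the kernel and the cokernel of multiplication by 2 on a finite group.\<close>

definition tor :: "int \<Rightarrow> int \<Rightarrow> int \<Rightarrow> nat" where
  "tor d1 d2 s = (if odd d1 \<and> odd d2 then 1 else if even d1 \<and> even d2 \<and> even s then 4 else 2)"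

text \<open>For odd \<open>k\<close> the sign is absorbed by the doubles, so the classes are those of \<open>(u1, u2)\<close> modulo
  \<open>lat d1 d2 s + 2 \<int>\<^sup>2\<close>.\<close>

lemma conj_class_odd_iff:
  assumes "k > 0" "d1 > 0" "d2 > 0" "0 \<le> s" "s < d2" "odd k"
  shows "sub_class k d1 d2 s (u1, u2) = sub_class k d1 d2 s (v1, v2) \<longleftrightarrow>
    (\<exists>i l. even (v1 - u1 - i * d1) \<and> even (v2 - u2 - (i * s + l * d2)))"
proof -
  have "sub_class k d1 d2 s (u1, u2) = sub_class k d1 d2 s (v1, v2) \<longleftrightarrow>
      (\<exists>a b e. (v1 - (sgn_par e * u1 + 2 * a), v2 - (sgn_par e * u2 + 2 * b)) \<in> lat d1 d2 s)"
    using conj_class_sub_eq_iff[OF assms(1-5) assms(1-5), of u1 u2 v1 v2] assms(6) by simp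
  also have "\<dots> \<longleftrightarrow> (\<exists>i l. even (v1 - u1 - i * d1) \<and> even (v2 - u2 - (i * s + l * d2)))"
  proof
    assume "\<exists>a b e. (v1 - (sgn_par e * u1 + 2 * a), v2 - (sgn_par e * u2 + 2 * b)) \<in> lat d1 d2 s"
    then obtain a b e i l where *: "v1 - (sgn_par e * u1 + 2 * a) = i * d1"
        "v2 - (sgn_par e * u2 + 2 * b) = i * s + l * d2"
      unfolding lat_def by auto
    have "v1 - u1 - i * d1 = (sgn_par e - 1) * u1 + 2 * a"
        "v2 - u2 - (i * s + l * d2) = (sgn_par e - 1) * u2 + 2 * b"
      unfolding *[symmetric] by (simp_all add: algebra_simps)
    moreover have "even (sgn_par e - 1)"
      by (simp add: sgn_par_def)
    ultimately show "\<exists>i l. even (v1 - u1 - i * d1) \<and> even (v2 - u2 - (i * s + l * d2))"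
      by (intro exI[of _ i] exI[of _ l]) simp
  next
    assume "\<exists>i l. even (v1 - u1 - i * d1) \<and> even (v2 - u2 - (i * s + l * d2))"
    then obtain i l a b where *: "v1 - u1 - i * d1 = 2 * a" "v2 - u2 - (i * s + l * d2) = 2 * b"
      by (metis evenE)
    then have "v1 - (sgn_par 0 * u1 + 2 * a) = i * d1 \<and> v2 - (sgn_par 0 * u2 + 2 * b) = i * s + l * d2"
      by simp
    then show "\<exists>a b e. (v1 - (sgn_par e * u1 + 2 * a), v2 - (sgn_par e * u2 + 2 * b)) \<in> lat d1 d2 s"
      unfolding lat_def by blast
  qed
  finally show ?thesis .
qed

text \<open>The set \<open>R\<close> in the proof is a transversal in \<open>{0, 1}\<^sup>2\<close> for the row space of the basis matrix
  \<open>(d1, s), (0, d2)\<close> modulo 2.\<close>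

lemma card_lat_classes_odd:
  assumes "k > 0" "d1 > 0" "d2 > 0" "0 \<le> s" "s < d2" "odd k"
  shows "finite (lat_classes k d1 d2 s)" "card (lat_classes k d1 d2 s) = tor d1 d2 s"
proof -
  define f where "f u = sub_class k d1 d2 s u" for u
  define R :: "(int \<times> int) set" where
    "R = {(x, y). x \<in> {0, 1} \<and> y \<in> {0, 1} \<and> (odd d1 \<longrightarrow> x = 0) \<and> (odd d2 \<or> even d1 \<and> odd s \<longrightarrow> y = 0)}"
  have f_iff: "f (u1, u2) = f (v1, v2) \<longleftrightarrow>
      (\<exists>i l. even (v1 - u1 - i * d1) \<and> even (v2 - u2 - (i * s + l * d2)))" for u1 u2 v1 v2
    unfolding f_def by (rule conj_class_odd_iff) fact+
  have inj: "inj_on f R"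
  proof (rule inj_onI)
    fix u v assume uv: "u \<in> R" "v \<in> R" "f u = f v"
    obtain u1 u2 v1 v2 where [simp]: "u = (u1, u2)" "v = (v1, v2)" by (cases u; cases v)
    obtain i l where il: "even (v1 - u1 - i * d1)" "even (v2 - u2 - (i * s + l * d2))"
      using uv(3) f_iff by auto
    have R: "u1 \<in> {0, 1}" "u2 \<in> {0, 1}" "v1 \<in> {0, 1}" "v2 \<in> {0, 1}" "odd d1 \<longrightarrow> u1 = 0 \<and> v1 = 0"
      "odd d2 \<or> even d1 \<and> odd s \<longrightarrow> u2 = 0 \<and> v2 = 0"
      using uv(1,2) by (auto simp: R_def)
    have "u1 = v1"
      using il(1) R by (cases "odd d1") auto
    moreover have "u2 = v2"
    proof (cases "odd d2 \<or> even d1 \<and> odd s")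
      case False
      then have "even (i * s + l * d2)"
        using il(1) \<open>u1 = v1\<close> by auto
      then have "even (v2 - u2)"
        using il(2) by simp
      then show ?thesis
        using R by auto
    qed (use R in auto)
    ultimately show "u = v" by simp
  qed
  have surj: "\<exists>v\<in>R. f u = f v" for u
  proof -
    obtain u1 u2 where u: "u = (u1, u2)" by (cases u)
    have bit: "x mod 2 \<in> {0, 1}" for x :: int
      by (cases "even x") (auto simp: even_iff_mod_2_eq_zero odd_iff_mod_2_eq_one)
    \<comment> \<open>Add \<open>i\<close> times the first and \<open>l\<close> times the second row to clear the coordinates outside \<open>R\<close>.\<close>
    define i where "i = (if odd d1 then u1 else if odd d2 then 0 else u2)"
    define x where "x = (if odd d1 then 0 else u1 mod 2)"
    define y where "y = (if odd d2 \<or> even d1 \<and>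
      odd s then 0 else (u2 + (if odd d1 then i * s else 0)) mod 2)"
    define l where "l = (if odd d2 then u2 + i * s else 0)"
    have "even (x - u1 - i * d1)"
      unfolding x_def i_def by (auto simp: mod_2_eq_odd)
    moreover have "even (y - u2 - (i * s + l * d2))"
      unfolding y_def l_def i_def by (auto simp: mod_2_eq_odd)
    ultimately have "f u = f (x, y)"
      unfolding u f_iff by blast
    moreover have "(x, y) \<in> R"
      using bit by (auto simp: R_def x_def y_def)
    ultimately show ?thesis by blast
  qed
  have "lat_classes k d1 d2 s = f ` R"
    unfolding lat_classes_def f_def[symmetric] using surj by blast
  moreover have R_eq: "R = {(0, 0)} \<union> (if even d1 then {(1, 0)} else {}) \<union>
      (if even d2 \<and> (odd d1 \<or> even s) then {(0, 1)} else {}) \<union>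
        (if even d1 \<and> even d2 \<and> even s then {(1, 1)} else {})"
    by (auto simp: R_def)
  moreover have "card R = tor d1 d2 s"
    unfolding R_eq tor_def by (cases "even d1"; cases "even d2"; cases "even s") simp_all
  moreover have "finite R"
    unfolding R_eq by simp
  ultimately show "finite (lat_classes k d1 d2 s)" "card (lat_classes k d1 d2 s) = tor d1 d2 s"
    using inj by (simp_all add: card_image del: Un_insert_left)
qed

lemma card_involution_orbits:
  assumes A: "finite A" and f: "\<And>x. x \<in> A \<Longrightarrow> f x \<in> A" "\<And>x. x \<in> A \<Longrightarrow> f (f x) = x"
  shows "2 * card ((\<lambda>x. {x, f x}) ` A) = card A + card {x \<in> A. f x = x}"
  using assms
proof (induction "card A" arbitrary: A rule: less_induct)
  case less
  show ?case
  proof (cases "A = {}")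
    case False
    then obtain a where a: "a \<in> A" by blast
    define B where "B = A - {a, f a}"
    have fB: "x \<in> B \<Longrightarrow> f x \<in> B" "x \<in> B \<Longrightarrow> f (f x) = x" for x
      using less.prems a unfolding B_def by auto metis
    have B: "finite B" "card B < card A"
      using less.prems(1) a by (auto simp: B_def intro!: psubset_card_mono)
    have IH: "2 * card ((\<lambda>x. {x, f x}) ` B) = card B + card {x \<in> B. f x = x}"
      by (rule less.hyps) (use B fB in auto)
    have A: "A = insert a (insert (f a) B)"
      using a less.prems by (auto simp: B_def)
    have "(\<lambda>x. {x, f x}) ` A = insert {a, f a} ((\<lambda>x. {x, f x}) ` B)"
      using less.prems(3)[OF a] by (subst A) (auto simp: insert_commute)
    moreover have "{a, f a} \<notin> (\<lambda>x. {x, f x}) ` B"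
      by (auto simp: B_def)
    ultimately have 1: "card ((\<lambda>x. {x, f x}) ` A) = Suc (card ((\<lambda>x. {x, f x}) ` B))"
      using B(1) by simp
    show ?thesis
    proof (cases "f a = a")
      case True
      then have "A = insert a B" "a \<notin> B" "{x \<in> A. f x = x} = insert a {x \<in> B. f x = x}"
        using A by (auto simp: B_def)
      then show ?thesis
        using IH 1 B(1) by simp
    next
      case False
      then have "a \<notin> insert (f a) B" "f a \<notin> B" "{x \<in> A. f x = x} = {x \<in> B. f x = x}"
        using A less.prems(3)[OF a] by (auto simp: B_def)
      then show ?thesis
        using IH 1 B(1) by (subst (2) A) simp
    qed
  qed simp
qed

text \<open>Halving \<open>i * (d1, s) + l * (0, d2)\<close> with \<open>i, l \<in> {0, 1}\<close>, whenever both coordinates are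
  even, gives each torsion point of the box exactly once.\<close>

lemma card_two_torsion:
  assumes "d1 > 0" "d2 > 0" "0 \<le> s" "s < d2"
  shows "card {(a, b) \<in> {0..<d1} \<times> {0..<d2}. (2 * a, 2 * b) \<in> lat d1 d2 s} = tor d1 d2 s"
proof -
  define S :: "(int \<times> int) set" where
    "S = {(i, l). i \<in> {0, 1} \<and> l \<in> {0, 1} \<and> even (i * d1) \<and> even (i * s + l * d2)}"
  define g where "g = (\<lambda>(i, l). (i * d1 div 2, (i * s + l * d2) div 2))"
  have "{(a, b) \<in> {0..<d1} \<times> {0..<d2}. (2 * a, 2 * b) \<in> lat d1 d2 s} = g ` S"
  proof (intro equalityI subsetI)
    fix x assume "x \<in> {(a, b) \<in> {0..<d1} \<times> {0..<d2}. (2 * a, 2 * b) \<in> lat d1 d2 s}"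
    then obtain a b i l where x: "x = (a, b)" "0 \<le> a" "a < d1" "0 \<le> b" "b < d2"
      "2 * a = i * d1" "2 * b = i * s + l * d2"
      by (auto simp: lat_def)
    have "0 \<le> i * d1" "i * d1 < 2 * d1"
      using x by linarith+
    then have i: "i \<in> {0, 1}"
      using assms(1) by (auto simp: zero_le_mult_iff)
    have i_s: "0 \<le> i * s" "i * s < d2"
      using i assms by auto
    have "(- 1) * d2 < l * d2" "l * d2 < 2 * d2"
      using x i_s by linarith+
    then have "- 1 < l" "l < 2"
      using assms(2) by (simp_all only: mult_less_cancel_right_pos)
    then have l: "l \<in> {0, 1}"
      by auto
    have "(i, l) \<in> S"
      using i l x unfolding S_def by (metis (mono_tags, lifting) case_prodI dvd_triv_left
        mem_Collect_eq)
    moreover have "x = g (i, l)"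
      using x by (simp add: g_def flip: x(6,7))
    ultimately show "x \<in> g ` S" by blast
  next
    fix x assume "x \<in> g ` S"
    then obtain i l where il: "x = g (i, l)" "i \<in> {0, 1}" "l \<in> {0, 1}" "even (i * d1)"
        "even (i * s + l * d2)"
      by (auto simp: S_def)
    obtain a where a: "i * d1 = 2 * a"
      using il(4) by (rule evenE)
    obtain b where b: "i * s + l * d2 = 2 * b"
      using il(5) by (rule evenE)
    note ab = a b
    have x: "x = (a, b)"
      by (simp add: il(1) g_def ab)
    have "0 \<le> i * d1" "i * d1 < 2 * d1" "0 \<le> i * s + l * d2" "i * s + l * d2 < 2 * d2"
      using il(2,3) assms by auto
    then have "a \<in> {0..<d1}" "b \<in> {0..<d2}"
      unfolding ab by auto
    moreover have "(2 * a, 2 * b) \<in> lat d1 d2 s"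
      unfolding ab[symmetric] lat_def by blast
    ultimately show "x \<in> {(a, b) \<in> {0..<d1} \<times> {0..<d2}. (2 * a, 2 * b) \<in> lat d1 d2 s}"
      by (simp add: x)
  qed
  moreover have "inj_on g S"
  proof (rule inj_onI)
    fix x y assume xy: "x \<in> S" "y \<in> S" "g x = g y"
    obtain i l i' l' where [simp]: "x = (i, l)" "y = (i', l')" by (cases x; cases y)
    have "even (i * d1)" "even (i' * d1)" "even (i * s + l * d2)" "even (i' * s + l' * d2)"
      "i * d1 div 2 = i' * d1 div 2" "(i * s + l * d2) div 2 = (i' * s + l' * d2) div 2"
      using xy unfolding S_def g_def by simp_all
    then have "i * d1 = i' * d1" "i * s + l * d2 = i' * s + l' * d2"
      using dvd_div_eq_iff by blast+
    then show "x = y"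
      using assms by simp
  qed
  moreover have S_eq: "S = {(0, 0)} \<union> (if even d2 then {(0, 1)} else {}) \<union>
      (if even d1 \<and> even s then {(1, 0)} else {}) \<union> (if even d1 \<and> even (s + d2) then {(1, 1)} else {})"
    by (auto simp: S_def)
  moreover have "card S = tor d1 d2 s"
    unfolding S_eq tor_def by (cases "even d1"; cases "even d2"; cases "even s") simp_all
  ultimately show ?thesis
    by (simp add: card_image)
qed

text \<open>For even \<open>k\<close> the classes are the orbits of \<open>u \<mapsto> - u\<close> modulo the lattice, whose fixed points are
  the 2-torsion points.\<close>

lemma card_lat_classes_even:
  assumes "k > 0" "d1 > 0" "d2 > 0" "0 \<le> s" "s < d2" "even k"
  shows "finite (lat_classes k d1 d2 s)" "2 * card (lat_classes k d1 d2 s) =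
      nat (d1 * d2) + tor d1 d2 s"
proof -
  define f where "f u = sub_class k d1 d2 s u" for u
  define A where "A = {0..<d1} \<times> {0..<d2}"
  define neg where "neg = (\<lambda>(a, b). reduce d1 d2 s (- a, - b))"
  have f_iff: "f (u1, u2) = f (v1, v2) \<longleftrightarrow> (v1 - u1, v2 - u2) \<in> lat d1 d2 s \<or>
      (v1 + u1, v2 + u2) \<in> lat d1 d2 s" for u1 u2 v1 v2
  proof -
    have "f (u1, u2) = f (v1, v2) \<longleftrightarrow> (\<exists>e. (v1 - sgn_par e * u1, v2 - sgn_par e * u2) \<in> lat d1 d2 s)"
      unfolding f_def using conj_class_sub_eq_iff[OF assms(1-5) assms(1-5), of u1 u2 v1 v2] assms(6)
        by simp
    also have "\<dots> \<longleftrightarrow> (v1 - u1, v2 - u2) \<in> lat d1 d2 s \<or> (v1 + u1, v2 + u2) \<in> lat d1 d2 s"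
    proof
      assume "\<exists>e. (v1 - sgn_par e * u1, v2 - sgn_par e * u2) \<in> lat d1 d2 s"
      then obtain e where "(v1 - sgn_par e * u1, v2 - sgn_par e * u2) \<in> lat d1 d2 s" ..
      then show "(v1 - u1, v2 - u2) \<in> lat d1 d2 s \<or> (v1 + u1, v2 + u2) \<in> lat d1 d2 s"
        using sgn_par_cases[of e] by auto
    next
      assume "(v1 - u1, v2 - u2) \<in> lat d1 d2 s \<or> (v1 + u1, v2 + u2) \<in> lat d1 d2 s"
      then have "(v1 - sgn_par 0 * u1, v2 - sgn_par 0 * u2) \<in> lat d1 d2 s \<or>
          (v1 - sgn_par 1 * u1, v2 - sgn_par 1 * u2) \<in> lat d1 d2 s"
        by simp
      then show "\<exists>e. (v1 - sgn_par e * u1, v2 - sgn_par e * u2) \<in> lat d1 d2 s"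
        by blast
    qed
    finally show ?thesis .
  qed
  have fixed: "reduce d1 d2 s x = x" if "x \<in> A" for x
    using that reduce_fixed by (cases x) (auto simp: A_def)
  have negA: "neg x \<in> A" for x
    unfolding neg_def A_def using reduce_box[OF assms(2,3)] by (cases x) auto
  have neg_eq_iff: "neg (a, b) = (a', b') \<longleftrightarrow> (a' + a, b' + b) \<in> lat d1 d2 s" if "(a', b') \<in> A"
      for a b a' b'
  proof -
    have "neg (a, b) = (a', b') \<longleftrightarrow> reduce d1 d2 s (a', b') = reduce d1 d2 s (- a, - b)"
      using fixed[OF that] by (auto simp: neg_def)
    then show ?thesis
      by (simp add: reduce_eq_iff[OF assms(2,3)])
  qed
  have negneg: "neg (neg x) = x" if "x \<in> A" for x
  proof -
    obtain a b a' b' where ab: "x = (a, b)" "neg x = (a', b')" by (cases x; cases "neg x")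
    then have "(a' + a, b' + b) \<in> lat d1 d2 s"
      using neg_eq_iff[of a' b' a b] negA[of x] by simp
    then have "neg (a', b') = (a, b)"
      using neg_eq_iff[of a b a' b'] that ab(1) by (simp add: add.commute)
    then show ?thesis
      using ab by simp
  qed
  have f_eq: "f x = f y \<longleftrightarrow> y = x \<or> y = neg x" if xy: "x \<in> A" "y \<in> A" for x y
  proof -
    obtain a b a' b' where [simp]: "x = (a, b)" "y = (a', b')" by (cases x; cases y)
    have "(a' - a, b' - b) \<in> lat d1 d2 s \<longleftrightarrow> y = x"
      using reduce_eq_iff[OF assms(2,3), of s a' b' a b] fixed[OF xy(1)] fixed[OF xy(2)] by auto
    moreover have "(a' + a, b' + b) \<in> lat d1 d2 s \<longleftrightarrow> y = neg x"
      using neg_eq_iff[of a' b' a b] xy(2) by auto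
    ultimately show ?thesis
      by (simp add: f_iff)
  qed
  have "\<exists>v\<in>A. f u = f v" for u
  proof -
    obtain a b where [simp]: "u = (a, b)" by (cases u)
    obtain a' b' where r: "reduce d1 d2 s (a, b) = (a', b')" by (cases "reduce d1 d2 s (a, b)")
    have "(a' - a, b' - b) \<in> lat d1 d2 s"
      using lat_uminus[OF reduce_diff[OF assms(2,3) r]] by simp
    then have "f u = f (a', b')"
      by (simp add: f_iff)
    moreover have "(a', b') \<in> A"
      using reduce_box[OF assms(2,3), of s "(a, b)"] r by (simp add: A_def)
    ultimately show ?thesis by blast
  qed
  then have C: "lat_classes k d1 d2 s = f ` A"
    unfolding lat_classes_def f_def[symmetric] by blast
  have finA: "finite A"
    by (simp add: A_def)
  show "finite (lat_classes k d1 d2 s)"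
    unfolding C using finA by simp
  have "card (f ` A) = card ((\<lambda>x. {x, neg x}) ` A)"
  proof (rule matched_images_card(1)[where R = "(=)"])
    fix x x' y y' assume xx: "x \<in> A" "x' \<in> A" and y: "x = y" "x' = y'"
    have "{x, neg x} = {x', neg x'}" if "x' = neg x"
      unfolding that negneg[OF xx(1)] by (rule insert_commute)
    moreover have "x' = x \<or> x' = neg x" if "{x, neg x} = {x', neg x'}"
      using that by blast
    ultimately show "f x = f x' \<longleftrightarrow> {y, neg y} = {y', neg y'}"
      unfolding f_eq[OF xx] y[symmetric] by blast
  qed auto
  moreover have "card {x \<in> A. neg x = x} = tor d1 d2 s"
  proof -
    have "neg (a, b) = (a, b) \<longleftrightarrow> (2 * a, 2 * b) \<in> lat d1 d2 s" if "(a, b) \<in> A" for a b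
      unfolding neg_eq_iff[OF that] by (simp only: mult_2)
    then have "{x \<in> A. neg x = x} = {(a, b) \<in> A. (2 * a, 2 * b) \<in> lat d1 d2 s}"
      by blast
    then show ?thesis
      using card_two_torsion[OF assms(2-5)] by (simp only: A_def)
  qed
  moreover have "card A = nat (d1 * d2)"
    using assms by (simp add: A_def card_cartesian_product nat_mult_distrib)
  ultimately show "2 * card (lat_classes k d1 d2 s) = nat (d1 * d2) + tor d1 d2 s"
    using card_involution_orbits[OF finA, of neg] negA negneg C by simp
qed

subsection \<open>Summation over the lattices\<close>

definition index_classes :: "nat \<Rightarrow> bool \<Rightarrow> (int \<times> int \<times> int) set set set" where
  "index_classes n t = conj_class screw_group ` {K. subgroup K screw_group \<and>
     finite (rcosets\<^bsub>screw_group\<^esub> K) \<and> card (rcosets\<^bsub>screw_group\<^esub> K) = n \<and> has_screw K = t}"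

text \<open>Since conjugation preserves \<open>k\<close> and the lattice, the classes split into the disjoint sets
  \<open>lat_classes\<close>; the first diagonal entry of the lattice is \<open>n div k div d\<close> and its index is
  \<open>n div k\<close>.\<close>

lemma card_index_classes:
  assumes n: "n > 0"
  shows "finite (index_classes n t)"
    "card (index_classes n t) = (\<Sum>k | k dvd n \<and> odd k = t. \<Sum>d | d dvd n div k. \<Sum>s<d.
       card (lat_classes (int k) (int (n div k div d)) (int d) (int s)))"
proof -
  define T where "T = (SIGMA k:{k. k dvd n \<and> odd k = t}. SIGMA d:{d. d dvd n div k}. {..<d})"
  define C where "C = (\<lambda>(k, d, s). lat_classes (int k) (int (n div k div d)) (int d) (int s))"
  have pos: "k > 0" "d > 0" "n div k div d > 0" "s < d" "odd k = t" "k * (n div k div d) * d = n" if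
      "(k, d, s) \<in> T" for k d s
  proof -
    have kd: "k dvd n" "d dvd n div k" "s < d" "odd k = t"
      using that by (auto simp: T_def)
    then show "k > 0" "d > 0" "s < d" "odd k = t"
      using n by (auto intro: Nat.gr0I)
    have "n = k * (n div k)" "n div k = d * (n div k div d)"
      using kd by simp_all
    then show "k * (n div k div d) * d = n"
      by (metis mult.assoc mult.commute)
    then show "n div k div d > 0"
      using n by (intro Nat.gr0I) auto
  qed
  have finT: "finite T"
    unfolding T_def using n by (intro finite_SigmaI) (auto intro!: finite_divisors_nat quotient_pos)
  have finC: "finite (C x)" if "x \<in> T" for x
  proof -
    obtain k d s where x: "x = (k, d, s)" by (cases x)
    then show ?thesis
      using pos[of k d s] that card_lat_classes_odd(1)[of k "n div k div d" d s]
        card_lat_classes_even(1)[of k "n div k div d" d s] by (cases "odd k") (auto simp: C_def)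
  qed
  have disj: "C x \<inter> C y = {}" if xy: "x \<in> T" "y \<in> T" "x \<noteq> y" for x y
  proof -
    obtain k d s k' d' s' where [simp]: "x = (k, d, s)" "y = (k', d', s')" by (cases x; cases y)
    have "sub_class k (n div k div d) d s u \<noteq> sub_class k' (n div k' div d') d' s' v" for u v
    proof -
      obtain u1 u2 v1 v2 where "u = (u1, u2)" "v = (v1, v2)" by (cases u; cases v)
      then show ?thesis
        using conj_class_sub_eq_iff[of k "n div k div d" d s k' "n div k' div d'" d' s' u1 u2 v1 v2]
          pos[of k d s] pos[of k' d' s'] xy by auto
    qed
    then show ?thesis
      by (auto simp: C_def lat_classes_def)
  qed
  have UN: "index_classes n t = (\<Union>x\<in>T. C x)"
  proof (intro equalityI subsetI)
    fix X assume "X \<in> index_classes n t"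
    then obtain K where K: "subgroup K screw_group" "finite (rcosets\<^bsub>screw_group\<^esub> K)"
      "card (rcosets\<^bsub>screw_group\<^esub> K) = n" "has_screw K = t" "X = conj_class screw_group K"
      by (auto simp: index_classes_def)
    obtain k d1 d2 s u where p: "k > 0" "d1 > 0" "d2 > 0" "0 \<le> s" "s < d2" "K = sub k d1 d2 s u"
      using finite_index_sub[OF K(1,2)] by blast
    have t: "odd k = t"
      using K(4) has_screw_sub p(6) by simp
    have "nat (k * d1 * d2) = n"
      using index_sub(2)[OF p(1-3)] K(3) p(6) by simp
    then have n_eq: "n = nat k * nat d1 * nat d2"
      using p by (simp add: nat_mult_distrib)
    then have d1: "n div nat k div nat d2 = nat d1"
      using p by (simp add: mult.assoc)
    have "n div nat k = nat d1 * nat d2"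
      using n_eq p by (simp add: mult.assoc)
    then have "(nat k, nat d2, nat s) \<in> T"
      using p t n_eq by (auto simp: T_def even_nat_iff)
    moreover have "X \<in> C (nat k, nat d2, nat s)"
      using p K(5) by (simp add: C_def d1 lat_classes_def)
    ultimately show "X \<in> (\<Union>x\<in>T. C x)" by blast
  next
    fix X assume "X \<in> (\<Union>x\<in>T. C x)"
    then obtain k d s u where x: "(k, d, s) \<in> T"
        "X = conj_class screw_group (sub (int k) (int (n div k div d)) (int d) (int s) u)"
      by (auto simp: C_def lat_classes_def)
    note p = pos[OF x(1)]
    have p': "int k > 0" "int (n div k div d) > 0" "int d > 0"
      using p by simp_all
    have "nat (int k * int (n div k div d) * int d) = n"
      unfolding of_nat_mult[symmetric] nat_int using p(6) .
    then show "X \<in> index_classes n t"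
      unfolding index_classes_def x(2) using subgroup_sub index_sub[OF p'] has_screw_sub p(5)
      by (intro imageI) simp
  qed
  show "finite (index_classes n t)"
    unfolding UN using finT finC by blast
  have "card (index_classes n t) = (\<Sum>x\<in>T. card (C x))"
    unfolding UN using finT finC disj by (intro card_UN_disjoint) auto
  also have "\<dots> = (\<Sum>k | k dvd n \<and> odd k = t. \<Sum>y\<in>(SIGMA d:{d. d dvd n div k}. {..<d}). card (C (k, y)))"
    unfolding T_def using n by (subst sum.Sigma)
      (auto intro!: finite_SigmaI finite_divisors_nat quotient_pos)
  also have "\<dots> = (\<Sum>k | k dvd n \<and> odd k = t. \<Sum>d | d dvd n div k. \<Sum>s<d. card (C (k, d, s)))"
    using n by (intro sum.cong HOL.refl, subst sum.Sigma)
      (auto intro!: finite_divisors_nat quotient_pos)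
  finally show "card (index_classes n t) = (\<Sum>k | k dvd n \<and> odd k = t. \<Sum>d | d dvd n div k. \<Sum>s<d.
       card (lat_classes (int k) (int (n div k div d)) (int d) (int s)))"
    by (simp add: C_def)
qed

subsection \<open>Divisor sums\<close>

definition half :: "(nat \<Rightarrow> rat) \<Rightarrow> nat \<Rightarrow> rat" where
  "half f n = (if even n then f (n div 2) else 0)"

text \<open>Summation over \<open>n div k\<close> rather than \<open>k\<close> matches lattices of index \<open>n div k\<close>.\<close>

definition divisor_sum :: "(nat \<Rightarrow> rat) \<Rightarrow> nat \<Rightarrow> rat" where
  "divisor_sum f n = (\<Sum>k | k dvd n. f (n div k))"

abbreviation sigma1 :: "nat \<Rightarrow> rat" where
  "sigma1 n \<equiv> of_nat (sigma1_nat n)"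

lemma sum_divisors_flip:
  fixes n :: nat
  assumes "n > 0"
  shows "(\<Sum>k | k dvd n. f (n div k)) = (\<Sum>k | k dvd n. f k :: 'a::comm_monoid_add)"
  using assms by (intro sum.reindex_bij_witness[of _ "\<lambda>k. n div k" "\<lambda>k. n div k"])
    (auto simp: quotient_quotient)

lemma sum_even_divisors_double:
  fixes h :: nat
  shows "(\<Sum>k | k dvd 2 * h \<and> even k. f k) = (\<Sum>j | j dvd h. f (2 * j) :: 'a::comm_monoid_add)"
proof -
  have "{k. k dvd 2 * h \<and> even k} = (\<lambda>j. 2 * j) ` {j. j dvd h}"
    by (auto elim!: evenE)
  moreover have "inj_on (\<lambda>j::nat. 2 * j) {j. j dvd h}"
    by (auto simp: inj_on_def)
  ultimately show ?thesis
    by (simp add: sum.reindex)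
qed

lemma no_even_divisors: "odd n \<Longrightarrow> {k. k dvd n \<and> even k} = {}" for n :: nat
  using dvd_trans by blast

lemma sum_even_divisors:
  "(\<Sum>k | k dvd n \<and> even k. f (n div k)) = half (divisor_sum f) n"
proof (cases "even n")
  case True
  then obtain h where "n = 2 * h" by blast
  then show ?thesis
    by (simp add: sum_even_divisors_double half_def divisor_sum_def)
next
  case False
  then show ?thesis
    unfolding no_even_divisors[OF False] by (simp add: half_def)
qed

lemma sum_odd_divisors:
  assumes "n > 0"
  shows "(\<Sum>k | k dvd n \<and> odd k. f (n div k)) = divisor_sum f n - half (divisor_sum f) n"
proof -
  have "{k. k dvd n \<and> even k} \<union> {k. k dvd n \<and> odd k} = {k. k dvd n}"
    by blast
  then have "divisor_sum f n = (\<Sum>k\<in>{k. k dvd n \<and> even k} \<union> {k. k dvd n \<and> odd k}. f (n div k))"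
    by (simp only: divisor_sum_def)
  also have "\<dots> = (\<Sum>k | k dvd n \<and> even k. f (n div k)) + (\<Sum>k | k dvd n \<and> odd k. f (n div k))"
    using finite_divisors_nat[OF assms] by (intro sum.union_disjoint) auto
  finally show ?thesis
    using sum_even_divisors[of f n] by simp
qed

lemma divisor_sum_half:
  assumes "n > 0"
  shows "divisor_sum (half f) n = half (divisor_sum f) n"
proof -
  have "divisor_sum (half f) n = (\<Sum>k | k dvd n. half f k)"
    unfolding divisor_sum_def by (rule sum_divisors_flip) fact
  also have "\<dots> = (\<Sum>k | k dvd n \<and> even k. f (k div 2))"
    using finite_divisors_nat[OF assms] by (intro sum.mono_neutral_cong_right) (auto simp: half_def)
  also have "\<dots> = half (divisor_sum f) n"
  proof (cases "even n")
    case True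
    then obtain h where h: "n = 2 * h" by blast
    then show ?thesis
      using assms sum_divisors_flip[of h f] by
        (simp add: sum_even_divisors_double half_def divisor_sum_def)
  next
    case False
    then show ?thesis
      unfolding no_even_divisors[OF False] by (simp add: half_def)
  qed
  finally show ?thesis .
qed

lemma sum_tor:
  "(\<Sum>s<d. tor (int c) (int d) (int s)) =
     d * (if odd c \<and> odd d then 1 else if even c \<and> even d then 3 else 2)"
proof (cases "even c \<and> even d")
  case True
  then obtain h where h: "d = 2 * h" by blast
  have "(\<Sum>s<2 * h. if even s then 4 else 2 :: nat) = 6 * h" for h
    by (induction h) simp_all
  moreover have "tor (int c) (int d) (int s) = (if even s then 4 else 2)" for s
    using True by (simp add: tor_def)
  ultimately show ?thesis
    using True by (simp add: h)
next
  case False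
  then show ?thesis
    by (auto simp: tor_def)
qed

text \<open>For even \<open>m\<close> the weight of \<open>d\<close> coming from \<open>sum_tor\<close> is 1, plus 1 if \<open>m div d\<close> is even, plus
  1 if \<open>d\<close> is even. The last two contribute \<open>\<sigma>\<^sub>1(m / 2)\<close> and \<open>2 \<sigma>\<^sub>1(m / 2)\<close>.\<close>

lemma sum_tor_lattices:
  assumes m: "m > 0"
  shows "(\<Sum>d | d dvd m. \<Sum>s<d. of_nat (tor (int (m div d)) (int d) (int s))) =
      sigma1 m + 3 * half sigma1 m"
proof -
  define w where "w d = (if odd (m div d) \<and> odd d then 1 else
    if even (m div d) \<and> even d then 3 else 2 :: nat)" for d
  have fin: "finite {d. d dvd m}"
    using m by (rule finite_divisors_nat)
  have "(\<Sum>d | d dvd m. \<Sum>s<d. tor (int (m div d)) (int d) (int s)) = (\<Sum>d | d dvd m. d * w d)"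
    unfolding sum_tor w_def ..
  also have "of_nat \<dots> = sigma1 m + 3 * half sigma1 m"
  proof (cases "even m")
    case False
    then have "w d = 1" if "d dvd m" for d
    proof -
      have "odd (d * (m div d))"
        using that False by simp
      then show ?thesis
        by (simp add: w_def)
    qed
    then show ?thesis
      using False by (simp add: half_def sigma1_nat_def)
  next
    case True
    then obtain h where h: "m = 2 * h" by blast
    then have hpos: "h > 0"
      using m by simp
    have w: "w d = 1 + of_bool (even (m div d)) + of_bool (even d)" if "d dvd m" for d
    proof -
      have "even (m div d) \<or> even d"
        using that True by (metis dvd_mult_div_cancel even_mult_iff)
      then show ?thesis
        by (auto simp: w_def)
    qed
    have "(\<Sum>d | d dvd m. d * w d) = (\<Sum>d | d dvd m. d + d * of_bool (even (m div d)) +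
        d * of_bool (even d))"
      by (intro sum.cong) (auto simp: w algebra_simps)
    also have "\<dots> = sigma1_nat m + (\<Sum>d | d dvd m. d * of_bool (even (m div d))) +
        (\<Sum>d | d dvd m. d * of_bool (even d))"
      by (simp add: sum.distrib sigma1_nat_def)
    also have "(\<Sum>d | d dvd m. d * of_bool (even (m div d))) = sigma1_nat h"
    proof -
      have "{d. d dvd m \<and> even (m div d)} = {d. d dvd h}"
      proof (intro equalityI subsetI CollectI; elim CollectE conjE)
        fix d assume "d dvd m" "even (m div d)"
        then obtain e where "m = d * (2 * e)"
          by (metis dvd_mult_div_cancel evenE)
        then show "d dvd h"
          using h by simp
      next
        fix d assume "d dvd h"
        then obtain e where e: "h = d * e" ..
        then have "m div d = 2 * e"
          using hpos h by simp
        then show "d dvd m \<and> even (m div d)"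
          using e h by simp
      qed
      moreover have "(\<Sum>d | d dvd m. d * of_bool (even (m div d))) = (\<Sum>d | d dvd m \<and> even (m div d). d)"
        using fin by (intro sum.mono_neutral_cong_right) auto
      ultimately show ?thesis
        by (simp add: sigma1_nat_def)
    qed
    also have "(\<Sum>d | d dvd m. d * of_bool (even d)) = 2 * sigma1_nat h"
    proof -
      have "(\<Sum>d | d dvd m. d * of_bool (even d)) = (\<Sum>d | d dvd m \<and> even d. d)"
        using fin by (intro sum.mono_neutral_cong_right) auto
      then show ?thesis
        unfolding h by (simp only: sum_even_divisors_double sigma1_nat_def sum_distrib_left)
    qed
    finally show ?thesis
      using True by (simp add: half_def h)
  qed
  finally show ?thesis
    by simp
qed

lemma extend_by_zero_div:
  assumes "n > 0" "m > 0"
  shows "extend_by_zero f (of_nat n / of_nat m) = (if m dvd n then of_nat (f (n div m)) else 0)"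
proof (cases "m dvd n")
  case True
  then obtain j where j: "n = m * j" ..
  then have "j > 0" "of_nat n / of_nat m = (of_nat j :: rat)"
    using assms by simp_all
  then show ?thesis
    using True j assms by (simp add: extend_by_zero_def)
next
  case False
  have "(of_nat n / of_nat m :: rat) \<notin> \<nat>"
  proof
    assume "(of_nat n / of_nat m :: rat) \<in> \<nat>"
    then obtain j where "of_nat n / of_nat m = (of_nat j :: rat)"
      by (auto elim: Nats_cases)
    then have "of_nat n = (of_nat (m * j) :: rat)"
      using assms by (simp add: field_simps)
    then have "n = m * j"
      by (simp only: of_nat_eq_iff)
    then show False
      using False by simp
  qed
  then show ?thesis
    using False by (simp add: extend_by_zero_def)
qed

lemma half_half:
  "half (half f) n = (if 4 dvd n then f (n div 4) else 0)"
proof (cases "4 dvd n")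
  case True
  then obtain j where "n = 4 * j" ..
  then show ?thesis by (simp add: half_def)
next
  case False
  then have "\<not> (even n \<and> even (n div 2))"
    by (auto elim!: evenE)
  then show ?thesis
    using False by (auto simp: half_def)
qed

lemma sigma2_eq:
  assumes "n > 0"
  shows "sigma2 (of_nat n) = divisor_sum sigma1 n" "sigma2 (of_nat n / 2) = half (divisor_sum sigma1) n"
    "sigma2 (of_nat n / 4) = half (half (divisor_sum sigma1)) n"
    "omega (of_nat n / 2) = half (divisor_sum (\<lambda>m. of_nat m * sigma1 m)) n"
proof -
  have s: "of_nat (\<Sum>k | k dvd m. sigma1_nat k) = divisor_sum sigma1 m"
    and o: "of_nat (\<Sum>k | k dvd m. k * sigma1_nat k) = divisor_sum (\<lambda>m. of_nat m * sigma1 m) m" if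
      "m > 0" for m
    unfolding divisor_sum_def using sum_divisors_flip[OF that, of sigma1] sum_divisors_flip[OF that,
      of "\<lambda>m. of_nat m * sigma1 m"]
    by simp_all
  have p: "n div 2 > 0" if "even n"
    using assms that by auto
  have q: "n div 4 > 0" if "4 dvd n"
    using assms that by (auto elim!: dvdE)
  show "sigma2 (of_nat n) = divisor_sum sigma1 n"
    using extend_by_zero_div[OF assms, of 1] s[OF assms] by (simp add: sigma2_def)
  show "sigma2 (of_nat n / 2) = half (divisor_sum sigma1) n"
    using extend_by_zero_div[OF assms, of 2] s p by (simp add: sigma2_def half_def)
  show "sigma2 (of_nat n / 4) = half (half (divisor_sum sigma1)) n"
    using extend_by_zero_div[OF assms, of 4] s q by (simp add: sigma2_def half_half)
  show "omega (of_nat n / 2) = half (divisor_sum (\<lambda>m. of_nat m * sigma1 m)) n"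
    using extend_by_zero_div[OF assms, of 2] o p by (simp add: omega_def half_def)
qed

text \<open>The value that \<open>sum_tor_lattices\<close> gives for the sum of \<open>tor\<close> over the lattices of index \<open>m\<close>.\<close>

definition tor_sum :: "nat \<Rightarrow> rat" where
  "tor_sum m = sigma1 m + 3 * half sigma1 m"

lemma divisor_sum_tor:
  assumes "n > 0"
  shows "divisor_sum tor_sum n = divisor_sum sigma1 n + 3 * half (divisor_sum sigma1) n"
    "half (divisor_sum tor_sum) n = half (divisor_sum sigma1) n +
      3 * half (half (divisor_sum sigma1)) n"
proof -
  have 1: "divisor_sum tor_sum m = divisor_sum sigma1 m + 3 * half (divisor_sum sigma1) m" if
      "m > 0" for m
    unfolding divisor_sum_half[OF that, symmetric]
    by (simp add: tor_sum_def divisor_sum_def sum.distrib sum_distrib_left)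
  then show "divisor_sum tor_sum n = divisor_sum sigma1 n + 3 * half (divisor_sum sigma1) n"
    using assms by simp
  show "half (divisor_sum tor_sum) n = half (divisor_sum sigma1) n +
      3 * half (half (divisor_sum sigma1)) n"
    using 1[of "n div 2"] assms by (auto simp: half_def elim!: evenE)
qed

lemma card_screw_classes:
  assumes n: "n > 0"
  shows "of_nat (card (index_classes n True)) =
      sigma2 (of_nat n) + 2 * sigma2 (of_nat n / 2) - 3 * sigma2 (of_nat n / 4)"
proof -
  have eq: "(\<Sum>d | d dvd n div k. \<Sum>s<d. card
      (lat_classes (int k) (int (n div k div d)) (int d) (int s))) =
      (\<Sum>d | d dvd n div k. \<Sum>s<d. tor (int (n div k div d)) (int d) (int s))" if k: "k dvd n" "odd k"
        for k
  proof (intro sum.cong HOL.refl)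
    fix d s assume d: "d \<in> {d. d dvd n div k}" and s: "s \<in> {..<d}"
    have "n div k > 0"
      using k n by (auto simp: quotient_pos)
    then have "n div k div d > 0" "d > 0" "k > 0"
      using d k n dvd_pos_nat[of "n div k" d] dvd_pos_nat[of n k] by (auto simp: quotient_pos)
    then show "card (lat_classes (int k) (int (n div k div d)) (int d) (int s)) =
        tor (int (n div k div d)) (int d) (int s)"
      using s k by (intro card_lat_classes_odd) auto
  qed
  have "card (index_classes n True) =
      (\<Sum>k | k dvd n \<and> odd k. \<Sum>d | d dvd n div k. \<Sum>s<d. tor (int (n div k div d)) (int d) (int s))"
    unfolding card_index_classes(2)[OF n] by (rule sum.cong) (simp_all add: eq)
  then have "of_nat (card (index_classes n True)) =
      (\<Sum>k | k dvd n \<and> odd k. \<Sum>d | d dvd n div k. \<Sum>s<d. of_nat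
        (tor (int (n div k div d)) (int d) (int s)))"
    by simp
  also have "\<dots> = (\<Sum>k | k dvd n \<and> odd k. tor_sum (n div k))"
    unfolding tor_sum_def using n by (intro sum.cong HOL.refl sum_tor_lattices)
      (auto simp: quotient_pos)
  also have "\<dots> = divisor_sum tor_sum n - half (divisor_sum tor_sum) n"
    by (rule sum_odd_divisors) fact
  also have "\<dots> = sigma2 (of_nat n) + 2 * sigma2 (of_nat n / 2) - 3 * sigma2 (of_nat n / 4)"
    unfolding sigma2_eq[OF n] divisor_sum_tor[OF n] by simp
  finally show ?thesis .
qed

lemma card_translation_classes:
  assumes n: "n > 0"
  shows "of_nat (card (index_classes n False)) =
    1/2 * (omega (of_nat n / 2) + sigma2 (of_nat n / 2) + 3 * sigma2 (of_nat n / 4))"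
proof -
  have *: "2 * (\<Sum>d | d dvd n div k. \<Sum>s<d. card
      (lat_classes (int k) (int (n div k div d)) (int d) (int s))) =
      (\<Sum>d | d dvd n div k. \<Sum>s<d. n div k + tor (int (n div k div d)) (int d) (int s))"
        if k: "k dvd n" "even k" for k
    unfolding sum_distrib_left
  proof (intro sum.cong HOL.refl)
    fix d s assume d: "d \<in> {d. d dvd n div k}" and s: "s \<in> {..<d}"
    have "n div k > 0"
      using k n by (auto simp: quotient_pos)
    then have "n div k div d > 0" "d > 0" "k > 0"
      using d k n dvd_pos_nat[of "n div k" d] dvd_pos_nat[of n k] by (auto simp: quotient_pos)
    moreover have "nat (int (n div k div d) * int d) = n div k"
      unfolding of_nat_mult[symmetric] nat_int using d by simp
    ultimately show "2 * card (lat_classes (int k) (int (n div k div d)) (int d) (int s)) =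
        n div k + tor (int (n div k div d)) (int d) (int s)"
      using s k card_lat_classes_even(2)[of "int k" "int (n div k div d)" "int d" "int s"] by simp
  qed
  have "2 * card (index_classes n False) =
      (\<Sum>k | k dvd n \<and> even k. \<Sum>d | d dvd n div k. \<Sum>s<d. n div k +
        tor (int (n div k div d)) (int d) (int s))"
    unfolding card_index_classes(2)[OF n] sum_distrib_left[of 2 _ "{k. k dvd n \<and> odd k = False}"]
    by (rule sum.cong) (simp_all add: *)
  then have "rat_of_nat (2 * card (index_classes n False)) = of_nat
      (\<Sum>k | k dvd n \<and> even k. \<Sum>d | d dvd n div k. \<Sum>s<d. n div k +
        tor (int (n div k div d)) (int d) (int s))"
    by (rule arg_cong)
  then have "2 * of_nat (card (index_classes n False)) =
      (\<Sum>k | k dvd n \<and> even k. \<Sum>d | d dvd n div k. \<Sum>s<d. of_nat (n div k) +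
        (of_nat (tor (int (n div k div d)) (int d) (int s)) :: rat))"
    by (simp only: of_nat_add of_nat_mult of_nat_numeral of_nat_sum)
  also have "\<dots> = (\<Sum>k | k dvd n \<and> even k. of_nat (n div k) * sigma1 (n div k) + tor_sum (n div k))"
  proof (intro sum.cong HOL.refl)
    fix k assume "k \<in> {k. k dvd n \<and> even k}"
    then have "n div k > 0"
      using n by (auto simp: quotient_pos)
    have "(\<Sum>d | d dvd n div k. \<Sum>s<d. of_nat (n div k)) = of_nat (n div k) * sigma1 (n div k)"
      by (simp add: sigma1_nat_def sum_distrib_left mult.commute)
    then show "(\<Sum>d | d dvd n div k. \<Sum>s<d. of_nat (n div k) +
        (of_nat (tor (int (n div k div d)) (int d) (int s)) :: rat)) =
        of_nat (n div k) * sigma1 (n div k) + tor_sum (n div k)"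
      unfolding sum.distrib tor_sum_def sum_tor_lattices[OF \<open>n div k > 0\<close>] by simp
  qed
  also have "\<dots> = half (divisor_sum (\<lambda>m. of_nat m * sigma1 m + tor_sum m)) n"
    by (rule sum_even_divisors)
  also have "\<dots> = half (divisor_sum (\<lambda>m. of_nat m * sigma1 m)) n + half (divisor_sum tor_sum) n"
    by (simp add: half_def divisor_sum_def sum.distrib)
  finally show ?thesis
    unfolding sigma2_eq[OF n] divisor_sum_tor(2)[OF n] by simp
qed

subsection \<open>The number of coverings\<close>

lemma index_classes_eq:
  "index_classes n True = subgroup_classes pi1_G2 screw_group n"
  "index_classes n False = subgroup_classes pi1_G1 screw_group n"
proof -
  have "{K. subgroup K screw_group \<and> finite (rcosets\<^bsub>screw_group\<^esub> K) \<and>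
      card (rcosets\<^bsub>screw_group\<^esub> K) = n \<and> has_screw K = True} =
      {K. subgroup K screw_group \<and> finite (rcosets\<^bsub>screw_group\<^esub> K) \<and> card (rcosets\<^bsub>screw_group\<^esub> K) =
        n \<and> screw_group\<lparr>carrier := K\<rparr> \<cong> pi1_G2}"
    using finite_index_types(1) by blast
  then show "index_classes n True = subgroup_classes pi1_G2 screw_group n"
    unfolding index_classes_def subgroup_classes_eq by (rule arg_cong)
  have "{K. subgroup K screw_group \<and> finite (rcosets\<^bsub>screw_group\<^esub> K) \<and>
      card (rcosets\<^bsub>screw_group\<^esub> K) = n \<and> has_screw K = False} =
      {K. subgroup K screw_group \<and> finite (rcosets\<^bsub>screw_group\<^esub> K) \<and> card (rcosets\<^bsub>screw_group\<^esub> K) =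
        n \<and> screw_group\<lparr>carrier := K\<rparr> \<cong> pi1_G1}"
    using finite_index_types(2) by blast
  then show "index_classes n False = subgroup_classes pi1_G1 screw_group n"
    unfolding index_classes_def subgroup_classes_eq by (rule arg_cong)
qed

lemma subgroup_classes_pi1_G2:
  "card (subgroup_classes H pi1_G2 n) = card (subgroup_classes H screw_group n)"
  "finite (subgroup_classes H pi1_G2 n) \<longleftrightarrow> finite (subgroup_classes H screw_group n)"
proof -
  obtain \<phi> where \<phi>: "\<phi> \<in> iso screw_group pi1_G2"
    using screw_iso_pi1_G2 by blast
  show "card (subgroup_classes H pi1_G2 n) = card (subgroup_classes H screw_group n)"
    "finite (subgroup_classes H pi1_G2 n) \<longleftrightarrow> finite (subgroup_classes H screw_group n)"
    using subgroup_classes_iso[OF group_screw group_pi1_G2 \<phi>, of H n] by simp_all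
qed

lemma covering_classes_index_classes:
  fixes n :: nat and emb :: "real^3 \<Rightarrow> 'a"
  assumes emb: "inj emb" and M: "M = (if t then manifold_G2 else manifold_G1)"
  defines "Q \<equiv> covering_classes n M manifold_G2 :: ('a topology \<times> ('a \<Rightarrow> (real^3) set)) set set"
  shows "card Q = card (index_classes n t)" "finite Q \<longleftrightarrow> finite (index_classes n t)"
proof -
  have P: "orbit_space (act2 ` K) homeomorphic_space M \<longleftrightarrow> has_screw K = t"
    if "subgroup K screw_group" "finite (rcosets\<^bsub>screw_group\<^esub> K)" for K
    using finite_index_types(3,4)[OF that] by (cases t) (simp_all add: M)
  show "card Q = card (index_classes n t)" "finite Q \<longleftrightarrow> finite (index_classes n t)"
    unfolding Q_def manifold_G2_eq index_classes_def
    by (rule A2.covering_classes_card[OF emb]; rule P; assumption)+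
qed

lemma total_space_type:
  assumes "fold_covering n N manifold_G2 p"
  shows "N homeomorphic_space manifold_G2 \<or> even n \<and> N homeomorphic_space manifold_G1"
proof -
  have cov: "fold_covering n N A2.base p"
    using assms by (simp only: manifold_G2_eq)
  then obtain K q where K: "subgroup K screw_group" "A2.uniformizes K N p q"
    using A2.covering_uniformized[of N p] by (auto simp: fold_covering_def)
  have idx: "finite (rcosets\<^bsub>screw_group\<^esub> K)" "card (rcosets\<^bsub>screw_group\<^esub> K) = n"
    using A2.fold_covering_iff[OF K, of n] cov by simp_all
  have "N homeomorphic_space orbit_space (act2 ` K)"
    by (rule A2.uniformizes_homeomorphic[OF K])
  then show ?thesis
    using finite_index_types(3-5)[OF K(1) idx(1)] idx(2) homeomorphic_space_trans by blast
qed

theorem theorem2: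
  fixes n :: nat
  assumes "0 < n" and "\<exists>emb :: real^3 \<Rightarrow> 'a. inj emb"
  shows
    "(\<forall>(N :: 'b topology) p. fold_covering n N manifold_G2 p \<longrightarrow>
        (odd n \<longrightarrow> N homeomorphic_space manifold_G2) \<and>
        (even n \<longrightarrow> N homeomorphic_space manifold_G2 \<or> N homeomorphic_space manifold_G1)) \<and>
     (let covers_G2 = (covering_classes n manifold_G2 manifold_G2
            :: ('a topology \<times> ('a \<Rightarrow> (real^3) set)) set set);
          covers_G1 = (covering_classes n manifold_G1 manifold_G2
            :: ('a topology \<times> ('a \<Rightarrow> (real^3) set)) set set)
      in
        finite covers_G2 \<and> finite (subgroup_classes pi1_G2 pi1_G2 n) \<and>
        card covers_G2 = class_count pi1_G2 pi1_G2 n \<and>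
        rat_of_nat (class_count pi1_G2 pi1_G2 n) =
          sigma2 (of_nat n) + 2 * sigma2 (of_nat n / 2) - 3 * sigma2 (of_nat n / 4) \<and>
        finite covers_G1 \<and> finite (subgroup_classes pi1_G1 pi1_G2 n) \<and>
        card covers_G1 = class_count pi1_G1 pi1_G2 n \<and>
        rat_of_nat (class_count pi1_G1 pi1_G2 n) =
          1/2 * (omega (of_nat n / 2) + sigma2 (of_nat n / 2) + 3 * sigma2 (of_nat n / 4)))"
proof -
  obtain emb :: "real^3 \<Rightarrow> 'a" where emb: "inj emb"
    using assms(2) by blast
  note cov = covering_classes_index_classes[OF emb if_True[symmetric], of n]
    covering_classes_index_classes[OF emb if_False[symmetric], of n]
  note fin = card_index_classes(1)[OF assms(1)]
  have types: "\<forall>(N :: 'b topology) p. fold_covering n N manifold_G2 p \<longrightarrow>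
        (odd n \<longrightarrow> N homeomorphic_space manifold_G2) \<and>
        (even n \<longrightarrow> N homeomorphic_space manifold_G2 \<or> N homeomorphic_space manifold_G1)"
    using total_space_type by blast
  have count: "class_count pi1_G2 pi1_G2 n = card (index_classes n True)"
    "class_count pi1_G1 pi1_G2 n = card (index_classes n False)"
    by (simp_all only: class_count_def subgroup_classes_pi1_G2 index_classes_eq)
  have fins: "finite (subgroup_classes pi1_G2 pi1_G2 n)" "finite (subgroup_classes pi1_G1 pi1_G2 n)"
    using fin by (simp_all only: subgroup_classes_pi1_G2 index_classes_eq[symmetric])
  show ?thesis
    unfolding Let_def count cov
    using types fin[of True] fin[of False] fins card_screw_classes[OF assms(1)]
      card_translation_classes[OF assms(1)]
    by (intro conjI HOL.refl)
qed

end
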